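(* For almost every $\omega\in\Omega$ and $T$ either a minimal shift $T\omega=\omega+\mathfrak{a}$ on $\Omega=\mathbb{T}^d$ or a skew-shift on $\Omega=\mathbb{T}^2$ given by $T(\omega_1,\omega_2)=(\omega_1+2\mathfrak{a},\omega_1+\omega_2)$, there exists a dense $G_\delta$ set of sampling functions $f$ in $C(\Omega,\mathbb{D})$ for which the corresponding CMV operator $\mathcal{E}_\omega$, with Verblunsky coefficients $\alpha(n)=f(T^n\omega)$, $n\in\mathbb{Z}$, has empty point spectrum.
   Context: $\mathbb{T}=\mathbb{R}/\mathbb{Z}$, $d\ge 1$, $\mathbb{D}$ is the open unit disk in $\mathbb{C}$, and $C(\Omega,\mathbb{D})$ is the set of continuous functions $\Omega\to\mathbb{D}$ with the topology of the supremum norm. The symbol $\mathfrak{a}$ denotes an element of $\mathbb{T}^d$ in the case of the shift and an element of $\mathbb{T}$ in the case of the skew-shift. "Almost every $\omega$" refers to Lebesgue (Haar) measure on the torus. A shift is minimal if every orbit is dense. Empty point spectrum means that the operator has no eigenvalues. Given a sequence $\{\alpha(n)\}_{n\in\mathbb{Z}}$ in $\mathbb{D}$ (Verblunsky coefficients), put $\rho(n)=(1-|\alpha(n)|^2)^{1/2}$. The corresponding (two-sided) CMV operator $\mathcal{E}$ is the unitary operator on $\ell^2(\mathbb{Z})$ whose matrix entries are, for every $m\in\mathbb{Z}$, $$\mathcal{E}_{2m,2m-1}=\overline{\alpha(2m)}\rho(2m-1),\quad \mathcal{E}_{2m,2m}=-\overline{\alpha(2m)}\alpha(2m-1),\quad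 \mathcal{E}_{2m,2m+1}=\overline{\alpha(2m+1)}\rho(2m),\quad \mathcal{E}_{2m,2m+2}=\rho(2m+1)\rho(2m),$$ $$\mathcal{E}_{2m+1,2m-1}=\rho(2m)\rho(2m-1),\quad \mathcal{E}_{2m+1,2m}=-\rho(2m)\alpha(2m-1),\quad \mathcal{E}_{2m+1,2m+1}=-\overline{\alpha(2m+1)}\alpha(2m),\quad \mathcal{E}_{2m+1,2m+2}=-\rho(2m+1)\alpha(2m),$$ and all other entries are zero. For a homeomorphism $T$ of $\Omega$, a sampling function $f\in C(\Omega,\mathbb{D})$ and $\omega\in\Omega$, $\mathcal{E}_\omega$ denotes the CMV operator with $\alpha(n)=f(T^n\omega)$. *)

theory Defs
  imports "HOL-Analysis.Analysis"
begin

section \<open>The torus\<close>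

quotient_type circle = real / "\<lambda>x y. x - y \<in> \<int>"
proof (rule equivpI)
  show "reflp (\<lambda>x y::real. x - y \<in> \<int>)"
    by (simp add: reflp_def)
  show "symp (\<lambda>x y::real. x - y \<in> \<int>)"
    by (metis (mono_tags, lifting) Ints_minus minus_diff_eq sympI)
  show "transp (\<lambda>x y::real. x - y \<in> \<int>)"
  proof (rule transpI)
    fix x y z :: real
    assume "x - y \<in> \<int>" "y - z \<in> \<int>"
    then have "(x - y) + (y - z) \<in> \<int>" by (rule Ints_add)
    then show "x - z \<in> \<int>" by simp
  qed
qed

lift_definition circle_of :: "real \<Rightarrow> circle" is "\<lambda>x. x" .

instantiation circle :: ab_group_add
begin

lift_definition zero_circle :: circle is 0 .

lift_definition plus_circle :: "circle \<Rightarrow> circle \<Rightarrow> circle" is "(+)"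
  by (metis Ints_add add_diff_add)

lift_definition minus_circle :: "circle \<Rightarrow> circle \<Rightarrow> circle" is "(-)"
  by (metis Ints_diff diff_diff_eq2 diff_diff_eq diff_add_eq add.commute)

lift_definition uminus_circle :: "circle \<Rightarrow> circle" is uminus
  by (metis Ints_minus minus_diff_minus)

instance
  by standard (transfer; simp add: algebra_simps)+

end

text \<open>The quotient topology of \<open>\<real>/\<int>\<close>.\<close>

instantiation circle :: topological_space
begin

definition open_circle :: "circle set \<Rightarrow> bool"
  where "open_circle U \<longleftrightarrow> open (circle_of -` U)"

instance
  by standard (auto simp: open_circle_def vimage_Union)

end

lemma continuous_on_circle_of: "continuous_on UNIV circle_of"
  by (simp add: continuous_on_open_vimage open_circle_def)

text \<open>Haar probability measure, as the image of Lebesgue measure on the closed unit cube;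
  the faces that the projection glues together are null sets.\<close>

definition haar_torus :: "(circle ^ 'd) measure"
  where "haar_torus =
    distr (restrict_space lborel (cbox 0 (\<chi> i. 1))) borel (\<lambda>x :: real ^ 'd. \<chi> i. circle_of (x $ i))"

definition haar_torus2 :: "(circle \<times> circle) measure"
  where "haar_torus2 =
    distr (restrict_space lborel (cbox (0, 0) (1, 1))) borel (\<lambda>(x, y). (circle_of x, circle_of y))"

section \<open>Dynamics\<close>

definition iterate :: "('a \<Rightarrow> 'a) \<Rightarrow> int \<Rightarrow> 'a \<Rightarrow> 'a"
  where "iterate T n = (if 0 \<le> n then T ^^ nat n else inv T ^^ nat (- n))"

definition minimal :: "('a::topological_space \<Rightarrow> 'a) \<Rightarrow> bool"
  where "minimal T \<longleftrightarrow> (\<forall>\<omega>. closure (range (\<lambda>n. iterate T n \<omega>)) = UNIV)"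

definition shift :: "circle ^ 'd \<Rightarrow> circle ^ 'd \<Rightarrow> circle ^ 'd"
  where "shift a \<omega> = \<omega> + a"

definition skew_shift :: "circle \<Rightarrow> circle \<times> circle \<Rightarrow> circle \<times> circle"
  where "skew_shift a = (\<lambda>(\<omega>1, \<omega>2). (\<omega>1 + (a + a), \<omega>1 + \<omega>2))"

section \<open>Sampling functions\<close>

text \<open>On a compact space every continuous function is bounded, so bounded continuous functions
  with their supremum metric are the appropriate ambient space for \<open>C(\<Omega>, \<bbbD>)\<close>.\<close>

definition disk_functions :: "('a::topological_space \<Rightarrow>\<^sub>C complex) set"
  where "disk_functions = {f. \<forall>\<omega>. apply_bcontfun f \<omega> \<in> ball 0 1}"

section \<open>CMV operators\<close>

definition rho :: "(int \<Rightarrow> complex) \<Rightarrow> int \<Rightarrow> complex"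
  where "rho \<alpha> n = complex_of_real (sqrt (1 - (cmod (\<alpha> n))\<^sup>2))"

definition cmv_entry :: "(int \<Rightarrow> complex) \<Rightarrow> int \<Rightarrow> int \<Rightarrow> complex"
  where "cmv_entry \<alpha> j k = (let m = j div 2 in
    if j = 2 * m then
      (if k = 2 * m - 1 then cnj (\<alpha> (2 * m)) * rho \<alpha> (2 * m - 1)
       else if k = 2 * m then - cnj (\<alpha> (2 * m)) * \<alpha> (2 * m - 1)
       else if k = 2 * m + 1 then cnj (\<alpha> (2 * m + 1)) * rho \<alpha> (2 * m)
       else if k = 2 * m + 2 then rho \<alpha> (2 * m + 1) * rho \<alpha> (2 * m)
       else 0)
    else
      (if k = 2 * m - 1 then rho \<alpha> (2 * m) * rho \<alpha> (2 * m - 1)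
       else if k = 2 * m then - rho \<alpha> (2 * m) * \<alpha> (2 * m - 1)
       else if k = 2 * m + 1 then - cnj (\<alpha> (2 * m + 1)) * \<alpha> (2 * m)
       else if k = 2 * m + 2 then - rho \<alpha> (2 * m + 1) * \<alpha> (2 * m)
       else 0))"

definition ell2 :: "(int \<Rightarrow> complex) set"
  where "ell2 = {\<psi>. (\<lambda>n. (cmod (\<psi> n))\<^sup>2) summable_on UNIV}"

text \<open>Each row of the matrix has at most four nonzero entries, so the sum is finite.\<close>

definition cmv :: "(int \<Rightarrow> complex) \<Rightarrow> (int \<Rightarrow> complex) \<Rightarrow> int \<Rightarrow> complex"
  where "cmv \<alpha> \<psi> j = (\<Sum>\<^sub>\<infinity>k. cmv_entry \<alpha> j k * \<psi> k)"

definition point_spectrum :: "((int \<Rightarrow> complex) \<Rightarrow> int \<Rightarrow> complex) \<Rightarrow> complex set"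
  where "point_spectrum A = {z. \<exists>\<psi>\<in>ell2. \<psi> \<noteq> (\<lambda>n. 0) \<and> A \<psi> = (\<lambda>n. z * \<psi> n)}"

definition verblunsky :: "('a \<Rightarrow> 'a) \<Rightarrow> ('a::topological_space \<Rightarrow>\<^sub>C complex) \<Rightarrow> 'a \<Rightarrow> int \<Rightarrow> complex"
  where "verblunsky T f \<omega> n = apply_bcontfun f (iterate T n \<omega>)"

end

theory Submission
  imports Defs
begin

text \<open>
  For a fixed point \<open>\<omega>\<close> with infinite orbit, a finite stretch of the coefficients
  \<open>\<alpha>(n) = f (T\<^sup>n \<omega>)\<close> can be prescribed freely by a small perturbation of \<open>f\<close>. Hence, if the absence
  of eigenvectors with a fixed proportion of their mass near the origin were not generic, then all
  sequences uniformly close to some \<open>g (T\<^sup>n \<omega>)\<close> would have such an eigenvector. An extremal choice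
  makes these eigenvectors uniformly tight, so that their eigenvalues depend continuously and
  monotonically on a phase inserted at the origin; thus one eigenvalue \<open>z\<close> is attained, for a
  suitable small phase, whatever the far coefficients are. If the orbit is recurrent, a copy of the
  localizing stretch fits into the far coefficients, and small phases inserted around it turn the
  decaying solution at \<open>z\<close> into any prescribed direction, in particular into one that belongs to a
  different phase at the origin, a contradiction. Recurrence along even times holds for every
  orbit of a shift or a skew-shift, and almost every orbit of a skew-shift is infinite.\<close>

section \<open>Local form of the eigenvalue equation\<close>

text \<open>In block form unitarity is one identity: for two solutions with data \<open>z\<close>,
  \<open>d\<close> and \<open>z'\<close>, \<open>d'\<close>, the window sums of
  \<open>(1 - z d cnj (z' d')) \<psi> cnj \<psi>'\<close> reduce to boundary terms. If both
  solutions decay, share \<open>z\<close>, and have site phases differing only at 0, a single term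
  survives, so one \<open>z\<close> cannot serve two different small kicks. For different
  \<open>z\<close> the identity ties the ratio of the eigenvalues to the kick through the inner
  product of the eigenvectors. Its speed is under control only if this inner product is bounded,
  with real part away from 0 and small imaginary part; the extremal choice together with a
  pigeonhole on the central values provides that. The second structure is the form |\<psi>|^2 -
  |\<xi>|^2, preserved up to sign. Decaying solutions are null vectors, so their direction
  \<open>\<xi>/\<psi>\<close> is a point of the unit circle, which a phase kick rotates. Crossing
  half of the copy, one of two kicked trial solutions must be large at the centre, and there it
  nearly has the direction of the localized solution. This holds from both sides, so a third small
  kick joins the halves. Kicks sit at even sites and translations must respect the two kinds of
  blocks, hence the even times.\<close>

text \<open>A CMV operator factors as \<open>L M\<close>, where \<open>L\<close> and \<open>M\<close> are direct sums of the unitary blocks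
  \<open>\<Theta>(\<alpha>) = [[cnj \<alpha>, \<rho>], [\<rho>, -\<alpha>]]\<close> acting on the sites \<open>j, j + 1\<close> with \<open>j\<close> even and odd,
  respectively. With \<open>\<xi> = M \<psi>\<close> the eigenvalue equation becomes the local relations below. The
  unimodular site phases \<open>d\<close> are \<open>1\<close> for a CMV operator; in general they describe
  \<open>L M \<psi> = z d \<psi>\<close>.\<close>

definition step ::
  "(int \<Rightarrow> complex) \<Rightarrow> (int \<Rightarrow> complex) \<Rightarrow> complex \<Rightarrow> (int \<Rightarrow> complex) \<Rightarrow> (int \<Rightarrow> complex) \<Rightarrow> int \<Rightarrow> bool"
  where "step a d z \<psi> \<xi> j \<longleftrightarrow>
    (if odd j then
       \<xi> j = cnj (a j) * \<psi> j + rho a j * \<psi> (j + 1) \<and>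
       \<xi> (j + 1) = rho a j * \<psi> j - a j * \<psi> (j + 1)
     else
       z * d j * \<psi> j = cnj (a j) * \<xi> j + rho a j * \<xi> (j + 1) \<and>
       z * d (j + 1) * \<psi> (j + 1) = rho a j * \<xi> j - a j * \<xi> (j + 1))"

lemma cnj_rho [simp]: "cnj (rho a j) = rho a j"
  by (simp add: rho_def)

lemma rho_sq: "cmod (a j) \<le> 1 \<Longrightarrow> rho a j * rho a j = 1 - a j * cnj (a j)"
  unfolding rho_def
  by (simp flip: of_real_mult add: complex_norm_square[symmetric])
     (simp add: power_le_one)

lemma rho_nonzero: "cmod (a j) < 1 \<Longrightarrow> rho a j \<noteq> 0"
  using power_strict_mono[of "cmod (a j)" 1 2] by (auto simp: rho_def)

text \<open>Unitarity of the block in polarized form; two vectors are kept apart because solutions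
  with different \<open>z\<close> or \<open>d\<close> will be compared.\<close>

lemma theta_isometry:
  fixes p q p' q' a r :: complex
  assumes "r * r = 1 - a * cnj a" "cnj r = r"
  shows "(cnj a * p + r * q) * cnj (cnj a * p' + r * q') + (r * p - a * q) * cnj (r * p' - a * q')
         = p * cnj p' + q * cnj q'"
proof -
  have "(cnj a * p + r * q) * cnj (cnj a * p' + r * q') + (r * p - a * q) * cnj (r * p' - a * q')
      = (a * cnj a + r * r) * (p * cnj p' + q * cnj q')"
    by (simp add: assms(2) algebra_simps)
  then show ?thesis by (simp add: assms(1))
qed

lemma step_odd_form:
  assumes "odd j" "cmod (a j) \<le> 1" "step a d z \<psi> \<xi> j" "step a d' z' \<psi>' \<xi>' j"
  shows "\<xi> j * cnj (\<xi>' j) + \<xi> (j+1) * cnj (\<xi>' (j+1)) = \<psi> j * cnj (\<psi>' j) + \<psi> (j+1) * cnj (\<psi>' (j+1))"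
proof -
  have *: "\<xi> j = cnj (a j) * \<psi> j + rho a j * \<psi> (j + 1)"
    "\<xi> (j + 1) = rho a j * \<psi> j - a j * \<psi> (j + 1)"
    "\<xi>' j = cnj (a j) * \<psi>' j + rho a j * \<psi>' (j + 1)"
    "\<xi>' (j + 1) = rho a j * \<psi>' j - a j * \<psi>' (j + 1)"
    using assms(1,3,4) by (auto simp: step_def)
  show ?thesis
    unfolding * by (rule theta_isometry) (use rho_sq assms(2) in auto)
qed

text \<open>Spectral parameter and site phases enter through the even blocks alone. The two
  solutions may carry different ones, and the weights record the discrepancy.\<close>

lemma step_even_form:
  assumes "even j" "cmod (a j) \<le> 1" "step a d z \<psi> \<xi> j" "step a d' z' \<psi>' \<xi>' j"
  shows "z * d j * cnj (z' * d' j) * (\<psi> j * cnj (\<psi>' j))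
           + z * d (j+1) * cnj (z' * d' (j+1)) * (\<psi> (j+1) * cnj (\<psi>' (j+1)))
         = \<xi> j * cnj (\<xi>' j) + \<xi> (j+1) * cnj (\<xi>' (j+1))"
proof -
  have *: "z * d j * \<psi> j = cnj (a j) * \<xi> j + rho a j * \<xi> (j + 1)"
    "z * d (j+1) * \<psi> (j+1) = rho a j * \<xi> j - a j * \<xi> (j + 1)"
    "z' * d' j * \<psi>' j = cnj (a j) * \<xi>' j + rho a j * \<xi>' (j + 1)"
    "z' * d' (j+1) * \<psi>' (j+1) = rho a j * \<xi>' j - a j * \<xi>' (j + 1)"
    using assms(1,3,4) by (auto simp: step_def)
  have "(z * d j * \<psi> j) * cnj (z' * d' j * \<psi>' j) + (z * d (j+1) * \<psi> (j+1)) * cnj (z' * d' (j+1) * \<psi>' (j+1))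
     = \<xi> j * cnj (\<xi>' j) + \<xi> (j+1) * cnj (\<xi>' (j+1))"
    unfolding * by (rule theta_isometry) (use rho_sq assms(2) in auto)
  then show ?thesis by (simp add: algebra_simps)
qed

section \<open>The conserved form and solutions on segments\<close>

definition wronski :: "(int \<Rightarrow> complex) \<Rightarrow> (int \<Rightarrow> complex) \<Rightarrow> (int \<Rightarrow> complex) \<Rightarrow> (int \<Rightarrow> complex) \<Rightarrow> int \<Rightarrow> complex"
  where "wronski \<psi> \<xi> \<psi>' \<xi>' j = \<psi> j * cnj (\<psi>' j) - \<xi> j * cnj (\<xi>' j)"

lemma unit_mult_cnj: "cmod w = 1 \<Longrightarrow> w * cnj w = 1"
  by (metis complex_norm_square of_real_1 power_one)

text \<open>With equal \<open>z\<close> and \<open>d\<close> all weights are 1, and the isometry of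
  either kind of block rearranges to this sign change. The form has signature (1,1); it plays the
  part of the determinant of transfer matrices.\<close>

lemma wronski_step:
  assumes "cmod (a j) \<le> 1" "cmod z = 1" "\<And>j. cmod (d j) = 1"
    "step a d z \<psi> \<xi> j" "step a d z \<psi>' \<xi>' j"
  shows "wronski \<psi> \<xi> \<psi>' \<xi>' (j+1) = - wronski \<psi> \<xi> \<psi>' \<xi>' j"
proof (cases "odd j")
  case True
  from step_odd_form[of j a d z \<psi> \<xi> d z \<psi>' \<xi>', OF True assms(1,4,5)] show ?thesis
    by (simp add: wronski_def algebra_simps)
next
  case False
  have u: "z * d j * cnj (z * d j) = 1" for j
    by (rule unit_mult_cnj) (simp add: norm_mult assms)
  have "\<psi> j * cnj (\<psi>' j) + \<psi> (j+1) * cnj (\<psi>' (j+1)) = \<xi> j * cnj (\<xi>' j) + \<xi> (j+1) * cnj (\<xi>' (j+1))"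
    using step_even_form[of j a d z \<psi> \<xi> d z \<psi>' \<xi>'] False assms(1,4,5) unfolding u by simp
  then show ?thesis
    by (simp add: wronski_def algebra_simps)
qed

lemma wronski_segment:
  assumes "q \<le> j" and "\<And>j. cmod (a j) \<le> 1" "cmod z = 1" "\<And>j. cmod (d j) = 1"
    and "\<And>i. q \<le> i \<Longrightarrow> i < j \<Longrightarrow> step a d z \<psi> \<xi> i"
    and "\<And>i. q \<le> i \<Longrightarrow> i < j \<Longrightarrow> step a d z \<psi>' \<xi>' i"
  shows "cmod (wronski \<psi> \<xi> \<psi>' \<xi>' j) = cmod (wronski \<psi> \<xi> \<psi>' \<xi>' q)"
  using assms
proof (induction j rule: int_ge_induct)
  case base
  then show ?case by simp
next
  case (step i)
  then show ?case
    using wronski_step[of a i z d \<psi> \<xi> \<psi>' \<xi>'] by simp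
qed

lemma step_zero_iff:
  assumes "cmod (a j) < 1" "z \<noteq> 0" "\<And>j. d j \<noteq> 0" "step a d z \<psi> \<xi> j"
  shows "\<psi> j = 0 \<and> \<xi> j = 0 \<longleftrightarrow> \<psi> (j+1) = 0 \<and> \<xi> (j+1) = 0"
  using rho_nonzero[of a j, OF assms(1)] assms(2-4) by (auto simp: step_def split: if_splits)

text \<open>Solvability rests on \<open>rho\<close> being nonzero. Quantifying over all functions
  with the four given values lets the result be applied to updated functions when a segment is
  extended.\<close>

lemma step_exists_right:
  assumes "cmod (a j) < 1" "z \<noteq> 0" "\<And>j. d j \<noteq> 0"
  shows "\<exists>u v. \<forall>\<psi> \<xi>. \<psi> j = p \<longrightarrow> \<xi> j = q \<longrightarrow> \<psi> (j+1) = u \<longrightarrow> \<xi> (j+1) = v \<longrightarrow> step a d z \<psi> \<xi> j"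
proof (cases "odd j")
  case True
  define u where "u = (q - cnj (a j) * p) / rho a j"
  have "q = cnj (a j) * p + rho a j * u"
    using rho_nonzero[of a j, OF assms(1)] by (simp add: u_def)
  then show ?thesis using True
    by (intro exI[of _ u] exI[of _ "rho a j * p - a j * u"]) (auto simp: step_def)
next
  case False
  define v where "v = (z * d j * p - cnj (a j) * q) / rho a j"
  define u where "u = (rho a j * q - a j * v) / (z * d (j+1))"
  have "z * d j * p = cnj (a j) * q + rho a j * v"
    using rho_nonzero[of a j, OF assms(1)] by (simp add: v_def)
  moreover have "z * d (j+1) * u = rho a j * q - a j * v"
    using assms by (simp add: u_def)
  ultimately show ?thesis using False
    by (intro exI[of _ u] exI[of _ v]) (auto simp: step_def)
qed

lemma step_exists_left:
  assumes "cmod (a j) < 1" "z \<noteq> 0" "\<And>j. d j \<noteq> 0"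
  shows "\<exists>u v. \<forall>\<psi> \<xi>. \<psi> j = u \<longrightarrow> \<xi> j = v \<longrightarrow> \<psi> (j+1) = p \<longrightarrow> \<xi> (j+1) = q \<longrightarrow> step a d z \<psi> \<xi> j"
proof (cases "odd j")
  case True
  define u where "u = (q + a j * p) / rho a j"
  have "q = rho a j * u - a j * p"
    using rho_nonzero[of a j, OF assms(1)] by (simp add: u_def)
  then show ?thesis using True
    by (intro exI[of _ u] exI[of _ "cnj (a j) * u + rho a j * p"]) (auto simp: step_def)
next
  case False
  define v where "v = (z * d (j+1) * p + a j * q) / rho a j"
  define u where "u = (cnj (a j) * v + rho a j * q) / (z * d j)"
  have "z * d (j+1) * p = rho a j * v - a j * q"
    using rho_nonzero[of a j, OF assms(1)] by (simp add: v_def)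
  moreover have "z * d j * u = cnj (a j) * v + rho a j * q"
    using assms by (simp add: u_def)
  ultimately show ?thesis using False
    by (intro exI[of _ u] exI[of _ v]) (auto simp: step_def)
qed

lemma step_cong:
  assumes "a j = a' j" "even j \<Longrightarrow> d j = d' j" "even j \<Longrightarrow> d (j+1) = d' (j+1)"
    "\<psi> j = \<psi>' j" "\<xi> j = \<xi>' j" "\<psi> (j+1) = \<psi>' (j+1)" "\<xi> (j+1) = \<xi>' (j+1)"
  shows "step a d z \<psi> \<xi> j \<longleftrightarrow> step a' d' z \<psi>' \<xi>' j"
  using assms by (auto simp: step_def rho_def)

lemma segment_forward:
  assumes "\<And>j. cmod (a j) < 1" "z \<noteq> 0" "\<And>j. d j \<noteq> 0" and "q \<le> k"
  shows "\<exists>\<psi> \<xi>. \<psi> q = u \<and> \<xi> q = v \<and> (\<forall>i. q \<le> i \<longrightarrow> i < k \<longrightarrow> step a d z \<psi> \<xi> i)"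
  using assms(4)
proof (induction k rule: int_ge_induct)
  case base
  show ?case by (rule exI[of _ "\<lambda>_. u"], rule exI[of _ "\<lambda>_. v"]) auto
next
  case (step k)
  then obtain \<psi> \<xi> where s: "\<psi> q = u" "\<xi> q = v" "\<And>i. q \<le> i \<Longrightarrow> i < k \<Longrightarrow> step a d z \<psi> \<xi> i"
    by blast
  obtain u' v' where uv: "\<And>\<psi>' \<xi>'. \<psi>' k = \<psi> k \<Longrightarrow> \<xi>' k = \<xi> k \<Longrightarrow> \<psi>' (k+1) = u' \<Longrightarrow> \<xi>' (k+1) = v' \<Longrightarrow>
      step a d z \<psi>' \<xi>' k"
    using step_exists_right[of a k z d "\<psi> k" "\<xi> k"] assms by blast
  have "step a d z (\<psi>(k+1 := u')) (\<xi>(k+1 := v')) i" if "q \<le> i" "i < k + 1" for i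
  proof (cases "i = k")
    case True
    then show ?thesis using uv by simp
  next
    case False
    then have "step a d z \<psi> \<xi> i" using s that by simp
    then show ?thesis using False that by (subst step_cong[of a i a d d _ \<psi> _ \<xi>]) auto
  qed
  moreover have "(\<psi>(k+1 := u')) q = u" "(\<xi>(k+1 := v')) q = v"
    using s step(1) by auto
  ultimately show ?case by blast
qed

lemma segment_backward:
  assumes "\<And>j. cmod (a j) < 1" "z \<noteq> 0" "\<And>j. d j \<noteq> 0" and "q \<le> k"
  shows "\<exists>\<psi> \<xi>. \<psi> k = u \<and> \<xi> k = v \<and> (\<forall>i. q \<le> i \<longrightarrow> i < k \<longrightarrow> step a d z \<psi> \<xi> i)"
  using assms(4)
proof (induction q rule: int_le_induct)
  case base
  show ?case by (rule exI[of _ "\<lambda>_. u"], rule exI[of _ "\<lambda>_. v"]) auto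
next
  case (step q)
  then obtain \<psi> \<xi> where s: "\<psi> k = u" "\<xi> k = v" "\<And>i. q \<le> i \<Longrightarrow> i < k \<Longrightarrow> step a d z \<psi> \<xi> i"
    by blast
  obtain u' v' where uv: "\<And>\<psi>' \<xi>'. \<psi>' (q-1) = u' \<Longrightarrow> \<xi>' (q-1) = v' \<Longrightarrow> \<psi>' q = \<psi> q \<Longrightarrow> \<xi>' q = \<xi> q \<Longrightarrow>
      step a d z \<psi>' \<xi>' (q-1)"
    using step_exists_left[of a "q-1" z d "\<psi> q" "\<xi> q"] assms(1-3) unfolding diff_add_cancel by blast
  have "step a d z (\<psi>(q-1 := u')) (\<xi>(q-1 := v')) i" if "q-1 \<le> i" "i < k" for i
  proof (cases "i = q-1")
    case True
    then show ?thesis using uv by simp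
  next
    case False
    then have "step a d z \<psi> \<xi> i" using s that by simp
    then show ?thesis using False that by (subst step_cong[of a i a d d _ \<psi> _ \<xi>]) auto
  qed
  moreover have "(\<psi>(q-1 := u')) k = u" "(\<xi>(q-1 := v')) k = v"
    using s step(1) by auto
  ultimately show ?case by blast
qed

lemma step_scale:
  assumes "step a d z \<psi> \<xi> j"
  shows "step a d z (\<lambda>i. c * \<psi> i) (\<lambda>i. c * \<xi> i) j"
proof -
  have "p = q \<Longrightarrow> c * p = c * q" for p q :: complex by simp
  show ?thesis
  proof (cases "odd j")
    case True
    then have "\<xi> j = cnj (a j) * \<psi> j + rho a j * \<psi> (j + 1)" "\<xi> (j + 1) = rho a j * \<psi> j - a j * \<psi> (j + 1)"
      using assms by (auto simp: step_def)
    then have "c * \<xi> j = c * (cnj (a j) * \<psi> j + rho a j * \<psi> (j + 1))"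
       "c * \<xi> (j + 1) = c * (rho a j * \<psi> j - a j * \<psi> (j + 1))"
      by simp_all
    then show ?thesis using True by (simp add: step_def algebra_simps del: mult_cancel_left mult_cancel_right)
  next
    case False
    then have "z * d j * \<psi> j = cnj (a j) * \<xi> j + rho a j * \<xi> (j + 1)"
       "z * d (j + 1) * \<psi> (j + 1) = rho a j * \<xi> j - a j * \<xi> (j + 1)"
      using assms by (auto simp: step_def)
    then have "c * (z * d j * \<psi> j) = c * (cnj (a j) * \<xi> j + rho a j * \<xi> (j + 1))"
       "c * (z * d (j + 1) * \<psi> (j + 1)) = c * (rho a j * \<xi> j - a j * \<xi> (j + 1))"
      by simp_all
    then show ?thesis using False by (simp add: step_def algebra_simps del: mult_cancel_left mult_cancel_right)
  qed
qed

text \<open>A jump of the phase of \<open>\<psi>\<close> at an even site is absorbed by the site phase there, because the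
  odd blocks do not involve \<open>d\<close>.\<close>

lemma solution_glue:
  assumes "even s" "cmod w = 1"
    and left: "\<And>i. i < s \<Longrightarrow> i \<in> A \<Longrightarrow> step a d z \<psi> \<xi> i"
    and right: "\<And>i. s \<le> i \<Longrightarrow> i \<in> A \<Longrightarrow> step a d z \<psi>' \<xi>' i"
    and "\<psi>' s = w * \<psi> s" "\<xi>' s = \<xi> s" and "i \<in> A"
  shows "step a (d(s := w * d s)) z (\<lambda>j. if j \<le> s then \<psi> j else \<psi>' j) (\<lambda>j. if j \<le> s then \<xi> j else \<xi>' j) i"
proof -
  consider "i < s - 1" | "i = s - 1" | "i = s" | "i > s" by linarith
  then show ?thesis
  proof cases
    case 1
    then show ?thesis using left[of i] \<open>i \<in> A\<close> by (simp add: step_def rho_def)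
  next
    case 2
    then have "odd i" using \<open>even s\<close> by simp
    then show ?thesis using 2 left[of i] \<open>i \<in> A\<close> by (simp add: step_def rho_def)
  next
    case 3
    \<comment> \<open>The even block at \<open>s\<close> sees the left value \<psi> s with the new
      phase \<open>w * d s\<close>; this product is the old phase times \<psi>' s.\<close>
    then show ?thesis using right[of i] assms by (simp add: step_def rho_def mult.assoc mult.left_commute)
  next
    case 4
    then show ?thesis using right[of i] \<open>i \<in> A\<close> by (simp add: step_def rho_def)
  qed
qed

text \<open>From an odd site to an even one: odd blocks tile the window, and the only blocks cut by
  its ends are two even ones.\<close>

definition window :: "nat \<Rightarrow> int set" where "window n = {1 - 2 * int n..2 * int n}"

lemma finite_window [simp]: "finite (window n)" by (simp add: window_def)
lemma window_mono: "m \<le> n \<Longrightarrow> window m \<subseteq> window n" by (auto simp: window_def)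
lemma window_Suc: "window (Suc n) = window n \<union> {-1 - 2 * int n, - 2 * int n, 2 * int n + 1, 2 * int n + 2}"
  by (auto simp: window_def)

lemma sum_window_Suc:
  fixes f :: "int \<Rightarrow> 'a::comm_monoid_add"
  shows "sum f (window (Suc n)) = sum f (window n) + (f (-1 - 2 * int n) + f (- 2 * int n)) + (f (2 * int n + 1) + f (2 * int n + 2))"
  unfolding window_Suc by (subst sum.union_disjoint) (auto simp: window_def add.assoc)

text \<open>Truncated unitarity of \<open>L M\<close>. The odd blocks turn the window sum for \<psi>
  into the one for \<xi>, the even blocks turn it back with weights, and the two cut blocks leave
  the boundary terms.\<close>

lemma form_sum:
  assumes a: "\<And>j. cmod (a j) \<le> 1"
    and s: "\<And>j. step a d z \<psi> \<xi> j" "\<And>j. step a d' z' \<psi>' \<xi>' j"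
    and "n \<ge> 1"
  shows "(\<Sum>j\<in>window n. (1 - z * d j * cnj (z' * d' j)) * (\<psi> j * cnj (\<psi>' j)))
     = (\<xi> (1 - 2 * int n) * cnj (\<xi>' (1 - 2 * int n)) - z * d (1 - 2 * int n) * cnj (z' * d' (1 - 2 * int n)) * (\<psi> (1 - 2 * int n) * cnj (\<psi>' (1 - 2 * int n))))
     + (\<xi> (2 * int n) * cnj (\<xi>' (2 * int n)) - z * d (2 * int n) * cnj (z' * d' (2 * int n)) * (\<psi> (2 * int n) * cnj (\<psi>' (2 * int n))))"
proof -
  define p where "p j = \<psi> j * cnj (\<psi>' j)" for j
  define c where "c j = \<xi> j * cnj (\<xi>' j)" for j
  define w where "w j = z * d j * cnj (z' * d' j)" for j
  have odd: "odd j \<Longrightarrow> c j + c (j+1) = p j + p (j+1)" for j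
    using step_odd_form[OF _ a s, of j] by (simp add: p_def c_def)
  have even: "even j \<Longrightarrow> w j * p j + w (j+1) * p (j+1) = c j + c (j+1)" for j
    using step_even_form[OF _ a s, of j] by (simp add: p_def c_def w_def)
  have 1: "(\<Sum>j\<in>window n. p j) = (\<Sum>j\<in>window n. c j)" for n
  proof (induction n)
    case 0
    then show ?case by (simp add: window_def)
  next
    case (Suc n)
    show ?case unfolding sum_window_Suc Suc
      using odd[of "-1 - 2 * int n"] odd[of "2 * int n + 1"] by (simp add: add.assoc)
  qed
  \<comment> \<open>The end sites belong to cut even blocks, so their \<xi>-terms are removed and
    their weighted \<psi>-terms put back.\<close>
  have 2: "(\<Sum>j\<in>window n. w j * p j) = (\<Sum>j\<in>window n. c j) - (c (1 - 2 * int n) - w (1 - 2 * int n) * p (1 - 2 * int n))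
      - (c (2 * int n) - w (2 * int n) * p (2 * int n))"
    using \<open>n \<ge> 1\<close>
  proof (induction n rule: nat_induct_at_least)
    case base
    have "window 1 = {-1, 0, 1, 2}" by (auto simp: window_def)
    then show ?case using even[of 0] by (simp add: algebra_simps)
  next
    case (Suc n)
    have e1: "w (2 * int n + 1) * p (2 * int n + 1) = c (2 * int n) + c (2 * int n + 1) - w (2 * int n) * p (2 * int n)"
      using even[of "2 * int n"] by (simp add: algebra_simps)
    have e2: "w (- 2 * int n) * p (- 2 * int n) = c (- 2 * int n) + c (1 - 2 * int n) - w (1 - 2 * int n) * p (1 - 2 * int n)"
      using even[of "- 2 * int n"] by (simp add: algebra_simps)
    have i: "1 - 2 * int (Suc n) = -1 - 2 * int n" "2 * int (Suc n) = 2 * int n + 2" by auto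
    show ?case unfolding sum_window_Suc Suc.IH i e1 e2 by simp
  qed
  have "(\<Sum>j\<in>window n. (1 - w j) * p j) = (\<Sum>j\<in>window n. p j) - (\<Sum>j\<in>window n. w j * p j)"
    by (simp add: left_diff_distrib sum_subtractf)
  also have "\<dots> = (c (1 - 2 * int n) - w (1 - 2 * int n) * p (1 - 2 * int n))
      + (c (2 * int n) - w (2 * int n) * p (2 * int n))"
    unfolding 1 2 by simp
  finally show ?thesis by (simp add: p_def c_def w_def)
qed

section \<open>Localized solutions and compactness\<close>

lemma tendsto_fun_iff:
  fixes X :: "'a \<Rightarrow> 'i \<Rightarrow> 'b::topological_space"
  shows "(X \<longlongrightarrow> l) F \<longleftrightarrow> (\<forall>j. ((\<lambda>k. X k j) \<longlongrightarrow> l j) F)"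
proof -
  have "(X \<longlongrightarrow> l) F \<longleftrightarrow> limitin (product_topology (\<lambda>i. euclidean) UNIV) X l F"
    by (simp add: euclidean_product_topology)
  also have "\<dots> \<longleftrightarrow> (\<forall>j. ((\<lambda>k. X k j) \<longlongrightarrow> l j) F)"
    by (simp add: limitin_componentwise)
  finally show ?thesis .
qed

lemma compact_fun_box:
  fixes S :: "'i \<Rightarrow> 'b::topological_space set"
  assumes "\<And>j. compact (S j)"
  shows "compact {y. \<forall>j. y j \<in> S j}"
proof -
  have "compactin (product_topology (\<lambda>i. euclidean) UNIV) (PiE UNIV S)"
    by (subst compactin_PiE) (use assms in auto)
  moreover have "PiE UNIV S = {y. \<forall>j. y j \<in> S j}" by auto
  ultimately show ?thesis by (simp add: euclidean_product_topology)
qed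

text \<open>Tychonoff for the closures of the coordinate ranges; with a countable index set the
  product is metrizable, so compactness gives subsequences.\<close>

lemma bounded_pointwise_subsequence:
  fixes y :: "nat \<Rightarrow> int \<Rightarrow> 'b::heine_borel"
  assumes "\<And>j. bounded (range (\<lambda>k. y k j))"
  obtains r l where "strict_mono r" "\<And>j. (\<lambda>k. y (r k) j) \<longlonglongrightarrow> l j"
proof -
  define S where "S j = closure (range (\<lambda>k. y k j))" for j
  have "compact {y. \<forall>j. y j \<in> S j}"
    using assms by (intro compact_fun_box) (simp add: S_def compact_eq_bounded_closed bounded_closure)
  moreover have "\<forall>n. y n \<in> {y. \<forall>j. y j \<in> S j}"
    unfolding S_def using closure_subset by fastforce
  ultimately obtain l r where "strict_mono r" "(y \<circ> r) \<longlonglongrightarrow> l"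
    unfolding compact_def by meson
  then show ?thesis using that[of r l] by (simp add: tendsto_fun_iff)
qed

text \<open>A configuration consists of coefficients and phases; as lemma \<open>gauge\<close> shows, it
  encodes the coefficients \<open>cis (\<phi> j) * a j\<close>.\<close>

definition amp :: "(int \<Rightarrow> complex \<times> real) \<Rightarrow> int \<Rightarrow> complex"
  where "amp x j = fst (x j)"

definition site_phase :: "(int \<Rightarrow> complex \<times> real) \<Rightarrow> int \<Rightarrow> complex"
  where "site_phase x j = cis (snd (x j) - snd (x (j - 1)))"

lemma norm_site_phase [simp]: "cmod (site_phase x j) = 1"
  by (simp add: site_phase_def)

lemma site_phase_nonzero [simp]: "site_phase x j \<noteq> 0"
  by (metis norm_site_phase norm_zero zero_neq_one)

text \<open>The value 1 at the origin turns a mass bound \<open>N\<close> into a share of at least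
  \<open>1/N\<close> of the mass there, and it prevents pointwise limits from being zero.\<close>

definition normalized_solution :: "(int \<Rightarrow> complex \<times> real) \<Rightarrow> complex \<Rightarrow> (int \<Rightarrow> complex) \<Rightarrow> (int \<Rightarrow> complex) \<Rightarrow> bool"
  where "normalized_solution x z \<psi> \<xi> \<longleftrightarrow> cmod z = 1 \<and> \<psi> 0 = 1 \<and> (\<forall>j. step (amp x) (site_phase x) z \<psi> \<xi> j)"

definition mass :: "(int \<Rightarrow> complex) \<Rightarrow> nat \<Rightarrow> real"
  where "mass \<psi> n = (\<Sum>j\<in>window n. (cmod (\<psi> j))\<^sup>2)"

definition localized :: "(int \<Rightarrow> complex \<times> real) \<Rightarrow> real \<Rightarrow> bool"
  where "localized x N \<longleftrightarrow> (\<exists>z \<psi> \<xi>. normalized_solution x z \<psi> \<xi> \<and> (\<forall>n. mass \<psi> n \<le> N))"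

lemma mass_mono: "m \<le> n \<Longrightarrow> mass \<psi> m \<le> mass \<psi> n"
  unfolding mass_def by (rule sum_mono2) (auto simp: window_mono)

lemma term_le_mass: "j \<in> window n \<Longrightarrow> (cmod (\<psi> j))\<^sup>2 \<le> mass \<psi> n"
  unfolding mass_def by (rule member_le_sum) auto

lemma in_window: "nat \<bar>j\<bar> + 1 \<le> n \<Longrightarrow> j \<in> window n"
  by (auto simp: window_def)

lemma mass_ge_1: "normalized_solution x z \<psi> \<xi> \<Longrightarrow> mass \<psi> n \<le> N \<Longrightarrow> n \<ge> 1 \<Longrightarrow> 1 \<le> N"
  using term_le_mass[of 0 n \<psi>] in_window[of 0 n] by (simp add: normalized_solution_def)

lemma step_xi_bound:
  assumes "odd j" "cmod (a j) \<le> 1" "step a d z \<psi> \<xi> j"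
  shows "(cmod (\<xi> j))\<^sup>2 + (cmod (\<xi> (j+1)))\<^sup>2 = (cmod (\<psi> j))\<^sup>2 + (cmod (\<psi> (j+1)))\<^sup>2"
proof -
  have "complex_of_real ((cmod (\<xi> j))\<^sup>2 + (cmod (\<xi> (j+1)))\<^sup>2) = complex_of_real ((cmod (\<psi> j))\<^sup>2 + (cmod (\<psi> (j+1)))\<^sup>2)"
    using step_odd_form[OF assms(1,2,3,3)] unfolding of_real_add complex_norm_square .
  then show ?thesis by (simp only: of_real_eq_iff)
qed

text \<open>Site \<open>j\<close> lies in exactly one odd block, where \<xi> and \<psi> have the
  same norm; listing both neighbours makes the bound independent of parity.\<close>

lemma xi_bound:
  assumes s: "\<And>j. step a d z \<psi> \<xi> j" and a: "\<And>j. cmod (a j) \<le> 1"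
  shows "(cmod (\<xi> j))\<^sup>2 \<le> (cmod (\<psi> (j-1)))\<^sup>2 + (cmod (\<psi> j))\<^sup>2 + (cmod (\<psi> (j+1)))\<^sup>2"
proof (cases "odd j")
  case True
  from step_xi_bound[OF True a s] show ?thesis
    using zero_le_power2[of "cmod (\<xi> (j+1))"] zero_le_power2[of "cmod (\<psi> (j-1))"] by linarith
next
  case False
  then have "odd (j - 1)" by simp
  from step_xi_bound[OF this a s] show ?thesis
    using zero_le_power2[of "cmod (\<xi> (j-1))"] zero_le_power2[of "cmod (\<psi> (j+1))"] unfolding diff_add_cancel by linarith
qed

lemma tendsto_rho:
  assumes "((\<lambda>k. a k j) \<longlongrightarrow> a' j) F"
  shows "((\<lambda>k. rho (a k) j) \<longlongrightarrow> rho a' j) F"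
  unfolding rho_def by (intro tendsto_intros assms)

lemma step_limit:
  assumes "\<And>j. (\<lambda>k. a k j) \<longlonglongrightarrow> a' j" "\<And>j. (\<lambda>k. d k j) \<longlonglongrightarrow> d' j" "z \<longlonglongrightarrow> z'"
    "\<And>j. (\<lambda>k. \<psi> k j) \<longlonglongrightarrow> \<psi>' j" "\<And>j. (\<lambda>k. \<xi> k j) \<longlonglongrightarrow> \<xi>' j"
    "\<And>k::nat. step (a k) (d k) (z k) (\<psi> k) (\<xi> k) j"
  shows "step a' d' z' \<psi>' \<xi>' j"
proof -
  note t = assms(1-5) tendsto_rho[where a=a and a'=a' and j=j, OF assms(1)]
  show ?thesis
  proof (cases "odd j")
    case True
    have e1: "\<xi> k j = cnj (a k j) * \<psi> k j + rho (a k) j * \<psi> k (j + 1)" for k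
      using assms(6)[of k] True by (simp add: step_def)
    have e2: "\<xi> k (j + 1) = rho (a k) j * \<psi> k j - a k j * \<psi> k (j + 1)" for k
      using assms(6)[of k] True by (simp add: step_def)
    have "(\<lambda>k. \<xi> k j) \<longlonglongrightarrow> cnj (a' j) * \<psi>' j + rho a' j * \<psi>' (j + 1)"
      unfolding e1 by (intro tendsto_intros t)
    moreover have "(\<lambda>k. \<xi> k (j+1)) \<longlonglongrightarrow> rho a' j * \<psi>' j - a' j * \<psi>' (j + 1)"
      unfolding e2 by (intro tendsto_intros t)
    ultimately show ?thesis using True assms(5) LIMSEQ_unique unfolding step_def by (auto)
  next
    case False
    have e1: "z k * d k j * \<psi> k j = cnj (a k j) * \<xi> k j + rho (a k) j * \<xi> k (j + 1)" for k
      using assms(6)[of k] False by (simp add: step_def)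
    have e2: "z k * d k (j+1) * \<psi> k (j + 1) = rho (a k) j * \<xi> k j - a k j * \<xi> k (j + 1)" for k
      using assms(6)[of k] False by (simp add: step_def)
    have "(\<lambda>k. z k * d k j * \<psi> k j) \<longlonglongrightarrow> cnj (a' j) * \<xi>' j + rho a' j * \<xi>' (j + 1)"
      unfolding e1 by (intro tendsto_intros t)
    moreover have "(\<lambda>k. z k * d k (j+1) * \<psi> k (j+1)) \<longlonglongrightarrow> rho a' j * \<xi>' j - a' j * \<xi>' (j + 1)"
      unfolding e2 by (intro tendsto_intros t)
    moreover have "(\<lambda>k. z k * d k i * \<psi> k i) \<longlonglongrightarrow> z' * d' i * \<psi>' i" for i
      by (intro tendsto_intros t)
    ultimately show ?thesis using False LIMSEQ_unique unfolding step_def by (auto)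
  qed
qed

lemma tendsto_mass: "(\<And>j. ((\<lambda>k. \<psi> k j) \<longlongrightarrow> \<psi>' j) F) \<Longrightarrow> ((\<lambda>k. mass (\<psi> k) n) \<longlongrightarrow> mass \<psi>' n) F"
  unfolding mass_def by (intro tendsto_intros)

lemma bounded_range_eventually:
  fixes f :: "nat \<Rightarrow> 'a::real_normed_vector"
  assumes "\<And>k. k \<ge> m \<Longrightarrow> norm (f k) \<le> C"
  shows "bounded (range f)"
proof -
  have "range f \<subseteq> f ` {..<m} \<union> cball 0 C"
    using assms by (auto simp: image_iff) (metis lessThan_iff not_less)
  then show ?thesis
    by (meson bounded_Un bounded_cball bounded_subset finite_imageI finite_imp_bounded finite_lessThan)
qed

text \<open>Only the mass of the \<open>k\<close>-th solution in the \<open>k\<close>-th window is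
  bounded, which is all that a failure of tightness provides. Every fixed site is eventually
  covered, and so is every fixed window in the limit.\<close>

lemma normalized_solution_limit:
  assumes x: "\<And>j. (\<lambda>k. x k j) \<longlonglongrightarrow> x' j"
    and s: "\<And>k. normalized_solution (x k) (z k) (\<psi> k) (\<xi> k)" and a: "\<And>k j. cmod (amp (x k) j) \<le> 1"
    and m: "\<And>k. mass (\<psi> k) k \<le> N"
  obtains r z' \<psi>' \<xi>' where "strict_mono r" "(\<lambda>k. z (r k)) \<longlonglongrightarrow> z'"
    "\<And>j. (\<lambda>k. \<psi> (r k) j) \<longlonglongrightarrow> \<psi>' j" "\<And>j. (\<lambda>k. \<xi> (r k) j) \<longlonglongrightarrow> \<xi>' j"
    "normalized_solution x' z' \<psi>' \<xi>'" "\<And>n. mass \<psi>' n \<le> N"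
proof -
  have N: "(cmod (\<psi> k j))\<^sup>2 \<le> N" if "k \<ge> nat \<bar>j\<bar> + 1" for k j
    using term_le_mass[OF in_window[OF that], of "\<psi> k"] m[of k] by linarith
  have b1: "bounded (range (\<lambda>k. \<psi> k j))" for j
    by (rule bounded_range_eventually[of "nat \<bar>j\<bar> + 1" _ "sqrt N"]) (use N in \<open>auto intro: real_le_rsqrt\<close>)
  have b2: "bounded (range (\<lambda>k. \<xi> k j))" for j
  \<comment> \<open>The offset 2 makes room for the neighbours \<open>j - 1\<close> and
    \<open>j + 1\<close>.\<close>
  proof (rule bounded_range_eventually[of "nat \<bar>j\<bar> + 2" _ "sqrt (3 * N)"])
    fix k assume k: "nat \<bar>j\<bar> + 2 \<le> k"
    have "(cmod (\<xi> k j))\<^sup>2 \<le> (cmod (\<psi> k (j-1)))\<^sup>2 + (cmod (\<psi> k j))\<^sup>2 + (cmod (\<psi> k (j+1)))\<^sup>2"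
      by (rule xi_bound) (use s a in \<open>auto simp: normalized_solution_def\<close>)
    also have "\<dots> \<le> 3 * N" using N[of "j-1" k] N[of j k] N[of "j+1" k] k by linarith
    finally show "cmod (\<xi> k j) \<le> sqrt (3 * N)" by (rule real_le_rsqrt)
  qed
  have b3: "bounded (range z)"
    by (rule boundedI[of _ 1]) (use s in \<open>auto simp: normalized_solution_def\<close>)
  have "bounded (range (\<lambda>k. (\<psi> k j, \<xi> k j, z k)))" for j
    by (rule bounded_subset[of "range (\<lambda>k. \<psi> k j) \<times> range (\<lambda>k. \<xi> k j) \<times> range z"])
       (auto intro!: bounded_Times b1 b2 b3)
  then obtain r l where r: "strict_mono r" and l: "\<And>j. (\<lambda>k. (\<psi> (r k) j, \<xi> (r k) j, z (r k))) \<longlonglongrightarrow> l j"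
    using bounded_pointwise_subsequence[of "\<lambda>k j. (\<psi> k j, \<xi> k j, z k)"] by blast
  define \<psi>' where "\<psi>' j = fst (l j)" for j
  define \<xi>' where "\<xi>' j = fst (snd (l j))" for j
  define z' where "z' = snd (snd (l 0))"
  have l1: "(\<lambda>k. \<psi> (r k) j) \<longlonglongrightarrow> \<psi>' j" for j
    using tendsto_fst[OF l[of j]] by (simp add: \<psi>'_def)
  have l2: "(\<lambda>k. \<xi> (r k) j) \<longlonglongrightarrow> \<xi>' j" for j
    using tendsto_fst[OF tendsto_snd[OF l[of j]]] by (simp add: \<xi>'_def)
  have l3: "(\<lambda>k. z (r k)) \<longlonglongrightarrow> z'"
    using tendsto_snd[OF tendsto_snd[OF l[of 0]]] by (simp add: z'_def)
  have xr: "(\<lambda>k. x (r k) j) \<longlonglongrightarrow> x' j" for j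
    using LIMSEQ_subseq_LIMSEQ[OF x r, of j] by (simp add: o_def)
  have "(\<lambda>k. cmod (z (r k))) \<longlonglongrightarrow> cmod z'" by (intro tendsto_intros l3)
  moreover have "(\<lambda>k. cmod (z (r k))) \<longlonglongrightarrow> 1" using s by (simp add: normalized_solution_def)
  ultimately have "cmod z' = 1" using LIMSEQ_unique by blast
  moreover have "\<psi>' 0 = 1"
    using l1[of 0] s LIMSEQ_unique[of "\<lambda>k. \<psi> (r k) 0" "\<psi>' 0" 1] by (simp add: normalized_solution_def)
  moreover have "step (amp x') (site_phase x') z' \<psi>' \<xi>' j" for j
  proof (rule step_limit[where a="\<lambda>k. amp (x (r k))" and d="\<lambda>k. site_phase (x (r k))", OF _ _ l3 l1 l2])
    show "(\<lambda>k. amp (x (r k)) j) \<longlonglongrightarrow> amp x' j" for j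
      unfolding amp_def by (intro tendsto_intros xr)
    show "(\<lambda>k. site_phase (x (r k)) j) \<longlonglongrightarrow> site_phase x' j" for j
      unfolding site_phase_def by (intro tendsto_intros xr)
  qed (use s in \<open>auto simp: normalized_solution_def\<close>)
  ultimately have "normalized_solution x' z' \<psi>' \<xi>'" by (simp add: normalized_solution_def)
  moreover have "mass \<psi>' n \<le> N" for n
  proof (rule LIMSEQ_le_const2)
    show "(\<lambda>k. mass (\<psi> (r k)) n) \<longlonglongrightarrow> mass \<psi>' n" by (rule tendsto_mass[OF l1])
    have "mass (\<psi> (r k)) n \<le> N" if "k \<ge> n" for k
      using mass_mono[of n "r k" "\<psi> (r k)"] m[of "r k"] seq_suble[OF r, of k] that by linarith
    then show "\<exists>N0. \<forall>k\<ge>N0. mass (\<psi> (r k)) n \<le> N" by blast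
  qed
  ultimately show ?thesis using that r l1 l2 l3 by blast
qed

text \<open>Serves twice: it makes the exceptional sets of sampling functions closed, and it passes
  from sampling functions to arbitrary nearby sequences.\<close>

corollary localized_limit:
  assumes "\<And>j. (\<lambda>k. x k j) \<longlonglongrightarrow> x' j" "\<And>k j. cmod (amp (x k) j) \<le> 1" "\<And>k. localized (x k) N"
  shows "localized x' N"
proof -
  obtain z \<psi> \<xi> where "\<And>k. normalized_solution (x k) (z k) (\<psi> k) (\<xi> k)" "\<And>k n. mass (\<psi> k) n \<le> N"
    using assms(3) unfolding localized_def by metis
  from normalized_solution_limit[OF assms(1) this(1) assms(2) this(2)] show ?thesis
    unfolding localized_def by metis
qed

section \<open>Extremal localization\<close>

text \<open>A finite form of Baire: either \<open>W\<close> lies in one \<open>A i\<close>, or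
  removing \<open>A i\<close> leaves a nonempty open set covered by the others.\<close>

lemma finite_closed_cover_open:
  assumes "finite I" "openin X W" "W \<noteq> {}" "\<And>i. i \<in> I \<Longrightarrow> closedin X (A i)" "W \<subseteq> (\<Union>i\<in>I. A i)"
  obtains i V where "i \<in> I" "openin X V" "V \<noteq> {}" "V \<subseteq> W" "V \<subseteq> A i"
proof -
  have "\<exists>i\<in>I. \<exists>V. openin X V \<and> V \<noteq> {} \<and> V \<subseteq> W \<and> V \<subseteq> A i"
    using assms
  proof (induction I arbitrary: W rule: finite_induct)
    case empty
    then show ?case by auto
  next
    case (insert i I)
    show ?case
    proof (cases "W \<subseteq> A i")
      case True
      then show ?thesis using insert.prems by blast
    next
      case False
      have "openin X (W - A i)" using insert.prems by (intro openin_diff) auto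
      moreover have "W - A i \<subseteq> (\<Union>i\<in>I. A i)" using insert.prems by auto
      ultimately show ?thesis using insert.IH[of "W - A i"] insert.prems(3) False by blast
    qed
  qed
  then show ?thesis using that by blast
qed

definition inner_window :: "(int \<Rightarrow> complex) \<Rightarrow> (int \<Rightarrow> complex) \<Rightarrow> nat \<Rightarrow> complex"
  where "inner_window \<psi> \<psi>' n = (\<Sum>j\<in>window n. \<psi> j * cnj (\<psi>' j))"

text \<open>On the core \<open>window L\<close> the product is close to the mass of \<psi>; beyond
  it both vectors have mass at most \<open>M - m\<close>. The budget \<open>h\<close> is spent once
  on the core and once on the tail.\<close>

lemma inner_window_estimates:
  assumes M: "\<And>n. mass \<psi> n \<le> M" "\<And>n. mass \<psi>' n \<le> M"
    and L: "mass \<psi> L > m" "mass \<psi>' L > m"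
    and close: "\<And>j. j \<in> window L \<Longrightarrow> cmod (\<psi> j - \<psi>' j) \<le> \<kappa>"
    and \<kappa>: "real (card (window L)) * (M + 1) * \<kappa> \<le> h" and mM: "M - m \<le> h" and M1: "M \<ge> 1" "\<kappa> \<ge> 0" and n: "n \<ge> L"
  shows "Re (inner_window \<psi> \<psi>' n) \<ge> m - 2 * h" "\<bar>Im (inner_window \<psi> \<psi>' n)\<bar> \<le> 2 * h"
    "cmod (inner_window \<psi> \<psi>' n) \<le> M"
proof -
  have am: "cmod (u * cnj v) \<le> ((cmod u)\<^sup>2 + (cmod v)\<^sup>2) / 2" for u v
    using sum_squares_bound[of "cmod u" "cmod v"] by (simp add: norm_mult)
  have "cmod (inner_window \<psi> \<psi>' n) \<le> (\<Sum>j\<in>window n. ((cmod (\<psi> j))\<^sup>2 + (cmod (\<psi>' j))\<^sup>2) / 2)"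
    unfolding inner_window_def by (rule order_trans[OF norm_sum sum_mono]) (rule am)
  also have "\<dots> = (mass \<psi> n + mass \<psi>' n) / 2"
    by (simp add: mass_def sum_divide_distrib[symmetric] sum.distrib)
  also have "\<dots> \<le> M" using M(1)[of n] M(2)[of n] by simp
  finally show "cmod (inner_window \<psi> \<psi>' n) \<le> M" .
  have split: "sum f (window n) = sum f (window L) + sum f (window n - window L)" for f :: "int \<Rightarrow> complex"
    by (subst sum.subset_diff[of "window L"]) (auto simp: window_mono n add.commute)
  have split': "mass \<phi> n = mass \<phi> L + (\<Sum>j\<in>window n - window L. (cmod (\<phi> j))\<^sup>2)" for \<phi>
    unfolding mass_def by (subst sum.subset_diff[of "window L"]) (auto simp: window_mono n add.commute)
  have "cmod (\<Sum>j\<in>window n - window L. \<psi> j * cnj (\<psi>' j))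
      \<le> (\<Sum>j\<in>window n - window L. ((cmod (\<psi> j))\<^sup>2 + (cmod (\<psi>' j))\<^sup>2) / 2)"
    by (rule order_trans[OF norm_sum sum_mono]) (rule am)
  also have "\<dots> = ((mass \<psi> n - mass \<psi> L) + (mass \<psi>' n - mass \<psi>' L)) / 2"
    unfolding split' by (simp add: sum_divide_distrib[symmetric] sum.distrib)
  also have "\<dots> \<le> h" using M(1)[of n] M(2)[of n] L mM by simp
  finally have tail: "cmod (\<Sum>j\<in>window n - window L. \<psi> j * cnj (\<psi>' j)) \<le> h" .
  have b: "cmod (\<psi> j) \<le> M + 1" if "j \<in> window L" for j
  proof -
    have "(cmod (\<psi> j))\<^sup>2 \<le> M" using term_le_mass[OF that, of \<psi>] M(1)[of L] by simp
    also have "M \<le> (M + 1)\<^sup>2" using M1 by (simp add: power2_eq_square algebra_simps)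
    finally show ?thesis using power2_le_imp_le M1 by fastforce
  qed
  have "cmod (\<Sum>j\<in>window L. \<psi> j * cnj (\<psi>' j - \<psi> j)) \<le> (\<Sum>j\<in>window L. (M + 1) * \<kappa>)"
  proof (rule order_trans[OF norm_sum sum_mono])
    fix j assume "j \<in> window L"
    then show "cmod (\<psi> j * cnj (\<psi>' j - \<psi> j)) \<le> (M + 1) * \<kappa>"
      unfolding norm_mult complex_mod_cnj
      using b close M1 by (intro mult_mono) (auto simp: norm_minus_commute)
  qed
  also have "\<dots> \<le> h" using \<kappa> by (simp add: mult.assoc)
  finally have core: "cmod (\<Sum>j\<in>window L. \<psi> j * cnj (\<psi>' j - \<psi> j)) \<le> h" .
  have "complex_of_real (mass \<psi> L) = (\<Sum>j\<in>window L. \<psi> j * cnj (\<psi> j))"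
    unfolding mass_def of_real_sum complex_norm_square ..
  then have eq: "inner_window \<psi> \<psi>' n - complex_of_real (mass \<psi> L) =
      (\<Sum>j\<in>window L. \<psi> j * cnj (\<psi>' j - \<psi> j)) + (\<Sum>j\<in>window n - window L. \<psi> j * cnj (\<psi>' j))"
    unfolding inner_window_def split by (simp add: algebra_simps sum_subtractf)
  have d: "cmod (inner_window \<psi> \<psi>' n - complex_of_real (mass \<psi> L)) \<le> 2 * h"
    unfolding eq using norm_triangle_mono[OF core tail] by simp
  show "Re (inner_window \<psi> \<psi>' n) \<ge> m - 2 * h"
    using abs_Re_le_cmod[of "inner_window \<psi> \<psi>' n - complex_of_real (mass \<psi> L)"] d L by simp
  show "\<bar>Im (inner_window \<psi> \<psi>' n)\<bar> \<le> 2 * h"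
    using abs_Im_le_cmod[of "inner_window \<psi> \<psi>' n - complex_of_real (mass \<psi> L)"] d by simp
qed

text \<open>The situation to be refuted: near \<open>g\<close>, every configuration has an eigenvector with a fixed
  proportion of its mass at the origin.\<close>

locale persistent =
  fixes g :: "int \<Rightarrow> complex" and e f N :: real
  assumes e: "e > 0" and f: "f > 0" and room: "\<And>j. cmod (g j) + e < 1"
    and loc: "\<And>x. (\<And>j. cmod (fst (x j) - g j) \<le> e) \<Longrightarrow> (\<And>j. \<bar>snd (x j)\<bar> \<le> f) \<Longrightarrow> localized x N"
begin

definition B :: "(int \<Rightarrow> complex \<times> real) set"
  where "B = {x. \<forall>j. cmod (fst (x j) - g j) \<le> e \<and> \<bar>snd (x j)\<bar> \<le> f}"

lemma amp_less_1: "x \<in> B \<Longrightarrow> cmod (amp x j) < 1"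
  using room[of j] norm_triangle_sub[of "fst (x j)" "g j"] unfolding B_def amp_def mem_Collect_eq
  by (smt (verit))

lemmas amp_le_1 = less_imp_le[OF amp_less_1]

lemma B_limit:
  assumes x: "\<And>j. (\<lambda>k. x k j) \<longlonglongrightarrow> x' j" and "\<And>k. x k \<in> B"
  shows "x' \<in> B"
proof -
  have "cmod (fst (x' j) - g j) \<le> e" for j
  proof (rule LIMSEQ_le_const2)
    show "(\<lambda>k. cmod (fst (x k j) - g j)) \<longlonglongrightarrow> cmod (fst (x' j) - g j)" by (intro tendsto_intros x)
  qed (use assms in \<open>auto simp: B_def\<close>)
  moreover have "\<bar>snd (x' j)\<bar> \<le> f" for j
  proof (rule LIMSEQ_le_const2)
    show "(\<lambda>k. \<bar>snd (x k j)\<bar>) \<longlonglongrightarrow> \<bar>snd (x' j)\<bar>" by (intro tendsto_intros x)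
  qed (use assms in \<open>auto simp: B_def\<close>)
  ultimately show ?thesis by (simp add: B_def)
qed

text \<open>Levels are taken over open sets so that a level below the infimum fails somewhere in
  every nonempty open set, in particular inside one where a level just above the infimum
  holds.\<close>

definition robust_levels :: "real set"
  where "robust_levels = {m. \<exists>W. openin (top_of_set B) W \<and> W \<noteq> {} \<and> (\<forall>x\<in>W. localized x m)}"

text \<open>Near the infimum of the robust levels, the mass of an eigenvector is almost determined, so
  that its tail is negligible uniformly in the far coefficients.\<close>

lemma exists_extremal:
  obtains M m W c where "1 \<le> M" "M - m < 2/100" "m > 98/100" "openin (top_of_set B) W" "c \<in> W"
    "\<And>x. x \<in> W \<Longrightarrow> localized x M" "\<not> localized c m"
proof -
  have "(\<lambda>j. (g j, 0)) \<in> B" using e f by (auto simp: B_def)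
  moreover have "\<And>x. x \<in> B \<Longrightarrow> localized x N" by (rule loc) (auto simp: B_def)
  ultimately have ne: "robust_levels \<noteq> {}" unfolding robust_levels_def by blast
  have ge: "1 \<le> m" if "m \<in> robust_levels" for m
    using that unfolding robust_levels_def localized_def using mass_ge_1 by blast
  then have bdd: "bdd_below robust_levels" by (meson bdd_belowI)
  define m0 where "m0 = Inf robust_levels"
  have m0: "m0 \<ge> 1" unfolding m0_def using ge ne by (meson cInf_greatest)
  obtain M where M: "M \<in> robust_levels" "M < m0 + 1/100"
    using cInf_lessD[OF ne, of "m0 + 1/100"] unfolding m0_def by auto
  then obtain W where W: "openin (top_of_set B) W" "W \<noteq> {}" "\<And>x. x \<in> W \<Longrightarrow> localized x M"
    unfolding robust_levels_def by blast
  \<comment> \<open>The failure of this level on \<open>W\<close> supplies the point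
    \<open>c\<close> around which tightness will hold.\<close>
  have "m0 - 1/100 \<notin> robust_levels"
    using cInf_lower[OF _ bdd, of "m0 - 1/100"] unfolding m0_def by auto
  then obtain c where "c \<in> W" "\<not> localized c (m0 - 1/100)"
    using W unfolding robust_levels_def by blast
  then show ?thesis using that[of M "m0 - 1/100" W c] W M m0 ge[OF M(1)] by auto
qed

text \<open>Otherwise solutions with mass at most \<open>m\<close> on growing windows, over
  configurations tending to \<open>c\<close>, would converge to one that localizes \<open>c\<close>
  at level \<open>m\<close>. The number \<open>L\<close> bounds both the window and the radius
  around \<open>c\<close>.\<close>

lemma exists_tight:
  obtains M m W L where "1 \<le> M" "M - m < 2/100" "m > 98/100" "openin (top_of_set B) W" "W \<noteq> {}"
    "\<And>x. x \<in> W \<Longrightarrow> localized x M"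
    "\<And>x z \<psi> \<xi>. x \<in> W \<Longrightarrow> normalized_solution x z \<psi> \<xi> \<Longrightarrow> m < mass \<psi> L"
proof -
  obtain M m W c where *: "1 \<le> M" "M - m < 2/100" "m > 98/100" "openin (top_of_set B) W" "c \<in> W"
    "\<And>x. x \<in> W \<Longrightarrow> localized x M" "\<not> localized c m"
    by (rule exists_extremal) (rule that)
  have "\<exists>L. \<forall>x \<in> W \<inter> ball c (1 / Suc L). \<forall>z \<psi> \<xi>. normalized_solution x z \<psi> \<xi> \<longrightarrow> m < mass \<psi> L"
  proof (rule ccontr)
    assume "\<not> ?thesis"
    then have "\<forall>L. \<exists>x z \<psi> \<xi>. x \<in> W \<inter> ball c (1 / Suc L) \<and> normalized_solution x z \<psi> \<xi> \<and> mass \<psi> L \<le> m"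
      by (meson not_less)
    then obtain x z \<psi> \<xi> where x: "\<And>L::nat. x L \<in> W \<inter> ball c (1 / Suc L)" "\<And>L. normalized_solution (x L) (z L) (\<psi> L) (\<xi> L)"
        "\<And>L. mass (\<psi> L) L \<le> m"
      by metis
    have "x \<longlonglongrightarrow> c"
    proof (rule metric_tendsto_imp_tendsto)
      show "(\<lambda>n. 1 / real (Suc n)) \<longlonglongrightarrow> 0" using LIMSEQ_inverse_real_of_nat by (simp add: field_simps)
      show "\<forall>\<^sub>F n in sequentially. dist (x n) c \<le> dist (1 / real (Suc n)) 0"
        using x(1) by (auto simp: dist_commute less_imp_le)
    qed
    then have "(\<lambda>k. x k j) \<longlonglongrightarrow> c j" for j by (simp add: tendsto_fun_iff)
    moreover have "cmod (amp (x k) j) \<le> 1" for k j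
      using x(1)[of k] *(4) amp_le_1 openin_imp_subset by fastforce
    ultimately have "localized c m"
      using normalized_solution_limit[of x c z \<psi> \<xi> m] x(2,3) unfolding localized_def by metis
    then show False using * by blast
  qed
  then obtain L where L: "\<And>x z \<psi> \<xi>. x \<in> W \<inter> ball c (1 / Suc L) \<Longrightarrow> normalized_solution x z \<psi> \<xi> \<Longrightarrow> m < mass \<psi> L"
    by blast
  show ?thesis
  proof (rule that[of M m "W \<inter> ball c (1 / Suc L)" L])
    show "openin (top_of_set B) (W \<inter> ball c (1 / real (Suc L)))"
      using *(4) by (simp add: openin_Int_open)
  qed (use * L in auto)
qed

text \<open>\<open>G\<close> selects the solutions whose core follows one fixed pattern. Finitely
  many patterns suffice, each defines a closed set by compactness, so one of them works on an open
  set. Then good solutions of any two configurations nearly agree, and goodness survives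
  limits.\<close>

lemma exists_rigid:
  obtains M W L and G :: "(int \<Rightarrow> complex \<times> real) \<Rightarrow> complex \<Rightarrow> (int \<Rightarrow> complex) \<Rightarrow> (int \<Rightarrow> complex) \<Rightarrow> bool"
  where "1 \<le> M" "openin (top_of_set B) W" "W \<noteq> {}"
    "\<And>x. x \<in> W \<Longrightarrow> \<exists>z \<psi> \<xi>. G x z \<psi> \<xi>"
    "\<And>x z \<psi> \<xi>. G x z \<psi> \<xi> \<Longrightarrow> x \<in> W \<and> normalized_solution x z \<psi> \<xi> \<and> (\<forall>n. mass \<psi> n \<le> M)"
    "\<And>x z \<psi> \<xi> x' z' \<psi>' \<xi>' n. G x z \<psi> \<xi> \<Longrightarrow> G x' z' \<psi>' \<xi>' \<Longrightarrow> n \<ge> L \<Longrightarrow>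
       Re (inner_window \<psi> \<psi>' n) \<ge> 9/10 \<and> \<bar>Im (inner_window \<psi> \<psi>' n)\<bar> \<le> 1/10 \<and> cmod (inner_window \<psi> \<psi>' n) \<le> M"
    "\<And>x z \<psi> \<xi> x' z'. \<forall>j. (\<lambda>k. x k j) \<longlonglongrightarrow> x' j \<Longrightarrow> x' \<in> W \<Longrightarrow> \<forall>k. G (x k) (z k) (\<psi> k) (\<xi> k) \<Longrightarrow>
       z \<longlonglongrightarrow> z' \<Longrightarrow> \<exists>\<psi>' \<xi>'. G x' z' \<psi>' \<xi>'"
proof -
  obtain M m W L where *: "1 \<le> M" "M - m < 2/100" "m > 98/100" "openin (top_of_set B) W" "W \<noteq> {}"
    "\<And>x. x \<in> W \<Longrightarrow> localized x M"
    "\<And>x z \<psi> \<xi>. x \<in> W \<Longrightarrow> normalized_solution x z \<psi> \<xi> \<Longrightarrow> m < mass \<psi> L"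
    by (rule exists_tight) (rule that)
  define K where "K = real (card (window L)) + 1"
  \<comment> \<open>Two solutions within \<kappa> of the same pattern differ by
    \<open>2 * \<kappa>\<close>, which has to cost at most 2/100 in the core.\<close>
  define \<kappa> where "\<kappa> = 1/100 / (K * (M + 1))"
  have K: "K > 0" "K \<ge> real (card (window L))" by (auto simp: K_def add_nonneg_pos)
  have \<kappa>: "\<kappa> > 0" using *(1) K by (simp add: \<kappa>_def)
  have "real (card (window L)) * (M + 1) * (2 * \<kappa>) \<le> K * (M + 1) * (2 * \<kappa>)"
    using *(1) K(2) \<kappa> by (intro mult_right_mono) auto
  also have "\<dots> = 2/100" using *(1) K(1) by (simp add: \<kappa>_def)
  finally have \<kappa>2: "real (card (window L)) * (M + 1) * (2 * \<kappa>) \<le> 2/100" .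
  obtain F where F: "finite F" "cball 0 (sqrt M) \<subseteq> (\<Union>x\<in>F. ball (x::complex) \<kappa>)"
  proof -
    obtain D where "D \<subseteq> cball 0 (sqrt M)" "finite D" "cball 0 (sqrt M) \<subseteq> (\<Union>x\<in>D. ball (x::complex) \<kappa>)"
    proof (rule compactE_image[of "cball (0::complex) (sqrt M)" "cball 0 (sqrt M)" "\<lambda>x. ball x \<kappa>"])
      show "cball (0::complex) (sqrt M) \<subseteq> (\<Union>c\<in>cball 0 (sqrt M). ball c \<kappa>)" using \<kappa> by force
    qed auto
    then show ?thesis using that by blast
  qed
  define Q where "Q p x z \<psi> \<xi> \<longleftrightarrow> normalized_solution x z \<psi> \<xi> \<and> (\<forall>n. mass \<psi> n \<le> M) \<and> (\<forall>j\<in>window L. cmod (\<psi> j - p j) \<le> \<kappa>)" for p x z \<psi> \<xi>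
  have lim: "\<exists>\<psi>' \<xi>' z' r. strict_mono (r::nat\<Rightarrow>nat) \<and> (\<lambda>k. z (r k)) \<longlonglongrightarrow> z' \<and> Q p x' z' \<psi>' \<xi>'"
    if "\<And>j. (\<lambda>k. x k j) \<longlonglongrightarrow> x' j" "\<And>k. x k \<in> B" "\<And>k. Q p (x k) (z k) (\<psi> k) (\<xi> k)" for p x x' z \<psi> \<xi>
  proof -
    have n: "\<And>k. normalized_solution (x k) (z k) (\<psi> k) (\<xi> k)" "\<And>k. mass (\<psi> k) k \<le> M"
      using that(3) by (auto simp: Q_def)
    note x = that(1) and xB = that(2)
    obtain r z' \<psi>' \<xi>' where r: "strict_mono r" "(\<lambda>k. z (r k)) \<longlonglongrightarrow> z'"
      "\<And>j. (\<lambda>k. \<psi> (r k) j) \<longlonglongrightarrow> \<psi>' j" "\<And>j. (\<lambda>k. \<xi> (r k) j) \<longlonglongrightarrow> \<xi>' j"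
      "normalized_solution x' z' \<psi>' \<xi>'" "\<And>n. mass \<psi>' n \<le> M"
      by (rule normalized_solution_limit[OF x n(1) amp_le_1[OF xB] n(2)]) (rule that)
    have "cmod (\<psi>' j - p j) \<le> \<kappa>" if "j \<in> window L" for j
    proof (rule LIMSEQ_le_const2)
      show "(\<lambda>k. cmod (\<psi> (r k) j - p j)) \<longlonglongrightarrow> cmod (\<psi>' j - p j)" by (intro tendsto_intros r)
    qed (use \<open>\<And>k. Q p (x k) (z k) (\<psi> k) (\<xi> k)\<close> \<open>j \<in> window L\<close> in \<open>auto simp: Q_def\<close>)
    then show ?thesis using r unfolding Q_def by blast
  qed
  define A where "A p = {x \<in> B. \<exists>z \<psi> \<xi>. Q p x z \<psi> \<xi>}" for p
  have closedA: "closedin (top_of_set B) (A p)" for p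
  proof -
    have "closed (A p)"
      unfolding closed_sequential_limits
    proof (intro allI impI, elim conjE)
      fix x l assume x: "\<forall>n. x n \<in> A p" "x \<longlonglongrightarrow> l"
      then have x': "\<And>j. (\<lambda>k. x k j) \<longlonglongrightarrow> l j" by (simp add: tendsto_fun_iff)
      obtain z \<psi> \<xi> where Q: "\<And>k. Q p (x k) (z k) (\<psi> k) (\<xi> k)"
        using x(1) unfolding A_def by (simp add: Bex_def) metis
      have xB: "\<And>k. x k \<in> B" using x(1) by (simp add: A_def)
      show "l \<in> A p" using lim[OF x' xB Q] B_limit[OF x' xB] by (auto simp: A_def)
    qed
    moreover have "A p = B \<inter> A p" by (auto simp: A_def)
    ultimately show ?thesis by (metis closedin_closed_Int)
  qed
  have cover: "W \<subseteq> (\<Union>p\<in>PiE (window L) (\<lambda>_. F). A p)"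
  proof
    fix x assume x: "x \<in> W"
    then obtain z \<psi> \<xi> where s: "normalized_solution x z \<psi> \<xi>" "\<And>n. mass \<psi> n \<le> M"
      using *(6)[OF x] unfolding localized_def by blast
    have "\<exists>q\<in>F. cmod (\<psi> j - q) \<le> \<kappa>" if "j \<in> window L" for j
    proof -
      have "(cmod (\<psi> j))\<^sup>2 \<le> M" using term_le_mass[OF that, of \<psi>] s(2)[of L] by simp
      then have "\<psi> j \<in> cball 0 (sqrt M)" by (simp add: real_le_rsqrt)
      then obtain q where "q \<in> F" "\<psi> j \<in> ball q \<kappa>" using F by blast
      then show ?thesis by (auto simp: dist_norm norm_minus_commute intro!: bexI[of _ q])
    qed
    then obtain p where p: "\<And>j. j \<in> window L \<Longrightarrow> p j \<in> F \<and> cmod (\<psi> j - p j) \<le> \<kappa>" by metis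
    have "x \<in> A (restrict p (window L))"
      using s p openin_imp_subset[OF *(4)] x unfolding A_def Q_def by fastforce
    then show "x \<in> (\<Union>p\<in>PiE (window L) (\<lambda>_. F). A p)" using p by (auto intro!: bexI[of _ "restrict p (window L)"])
  qed
  have fin: "finite (PiE (window L) (\<lambda>_. F))" using F(1) by (intro finite_PiE) auto
  obtain p V where V': "p \<in> PiE (window L) (\<lambda>_. F)"
    and V: "openin (top_of_set B) V" "V \<noteq> {}" "V \<subseteq> W" "V \<subseteq> A p"
    by (rule finite_closed_cover_open[OF fin *(4,5) closedA cover]) (rule that)
  show ?thesis
  proof (rule that[of M V "\<lambda>x z \<psi> \<xi>. x \<in> V \<and> Q p x z \<psi> \<xi>" L])
    fix x z \<psi> \<xi> x' z' \<psi>' \<xi>' n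
    assume a: "x \<in> V \<and> Q p x z \<psi> \<xi>" "x' \<in> V \<and> Q p x' z' \<psi>' \<xi>'" and n: "L \<le> n"
    have c: "cmod (\<psi> j - \<psi>' j) \<le> 2 * \<kappa>" if "j \<in> window L" for j
    proof -
      have "cmod (\<psi> j - p j) \<le> \<kappa>" "cmod (\<psi>' j - p j) \<le> \<kappa>" using a that by (auto simp: Q_def)
      then show ?thesis using norm_triangle_ineq4[of "\<psi> j - p j" "\<psi>' j - p j"] by simp
    qed
    have m: "m < mass \<psi> L" "m < mass \<psi>' L" using a V(3) *(7) unfolding Q_def by blast+
    have M: "mass \<psi> n \<le> M" "mass \<psi>' n \<le> M" for n using a by (auto simp: Q_def)
    have mM: "M - m \<le> 2/100" "0 \<le> 2 * \<kappa>" using * \<kappa> by auto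
    \<comment> \<open>With \<open>h = 2/100\<close> the real part is at least
      \<open>m - 4/100 > 94/100\<close> and the imaginary part at most 4/100.\<close>
    note est = inner_window_estimates[OF M m c \<kappa>2 mM(1) *(1) mM(2) n]
    show "Re (inner_window \<psi> \<psi>' n) \<ge> 9/10 \<and> \<bar>Im (inner_window \<psi> \<psi>' n)\<bar> \<le> 1/10 \<and> cmod (inner_window \<psi> \<psi>' n) \<le> M"
      using est *(3) by linarith
  next
    fix x z \<psi> \<xi> x' z'
    assume x': "\<forall>j. (\<lambda>k. x k j) \<longlonglongrightarrow> x' j" "x' \<in> V" and q': "\<forall>k. x k \<in> V \<and> Q p (x k) (z k) (\<psi> k) (\<xi> k)"
      and z: "z \<longlonglongrightarrow> z'"
    note x = x'(1)[rule_format] x'(2) and q = q'[rule_format]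
    have "\<And>k. x k \<in> B" using q openin_imp_subset[OF V(1)] by blast
    from lim[OF x(1) this, where p=p and z=z and \<psi>=\<psi> and \<xi>=\<xi>] q obtain \<psi>' \<xi>' z'' r
      where r: "strict_mono (r::nat\<Rightarrow>nat)" "(\<lambda>k. z (r k)) \<longlonglongrightarrow> z''" "Q p x' z'' \<psi>' \<xi>'" by blast
    have "z'' = z'" using LIMSEQ_subseq_LIMSEQ[OF z r(1)] r(2) LIMSEQ_unique by (auto simp: o_def)
    then show "\<exists>\<psi>' \<xi>'. x' \<in> V \<and> Q p x' z' \<psi>' \<xi>'" using r x(2) by blast
  next
    show "\<exists>z \<psi> \<xi>. x \<in> V \<and> Q p x z \<psi> \<xi>" if "x \<in> V" for x
      using that V(4) unfolding A_def by blast
  next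
    show "x \<in> V \<and> normalized_solution x z \<psi> \<xi> \<and> (\<forall>n. mass \<psi> n \<le> M)" if "x \<in> V \<and> Q p x z \<psi> \<xi>" for x z \<psi> \<xi>
      using that by (simp add: Q_def)
  qed (use * V in auto)
qed

end

section \<open>Tuning the eigenvalue\<close>

text \<open>Decay is all that the boundary terms need, and unlike a mass bound it is immediate for
  solutions glued from pieces.\<close>

definition vanishes :: "(int \<Rightarrow> complex) \<Rightarrow> bool"
  where "vanishes \<psi> \<longleftrightarrow> (\<forall>\<epsilon>>0. \<exists>J. \<forall>j. J \<le> \<bar>j\<bar> \<longrightarrow> cmod (\<psi> j) < \<epsilon>)"

lemma vanishes_mass:
  assumes "\<And>n. mass \<psi> n \<le> M"
  shows "vanishes \<psi>"
  unfolding vanishes_def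
proof (intro allI impI)
  fix \<epsilon> :: real assume \<epsilon>: "\<epsilon> > 0"
  have "incseq (mass \<psi>)" by (simp add: incseq_def mass_mono)
  then obtain l where l: "mass \<psi> \<longlonglongrightarrow> l" "\<And>n. mass \<psi> n \<le> l"
    using incseq_convergent[of "mass \<psi>" M] assms by blast
  then obtain n0 where n0: "l - mass \<psi> n0 < \<epsilon>\<^sup>2"
    using LIMSEQ_D[OF l(1), of "\<epsilon>\<^sup>2"] \<epsilon> by (auto simp: abs_less_iff)
  have "cmod (\<psi> j) < \<epsilon>" if "2 * int n0 + 2 \<le> \<bar>j\<bar>" for j
  proof -
    define n where "n = nat \<bar>j\<bar> + 1"
    have j: "j \<in> window n" "j \<notin> window n0" using in_window[of j n] that by (auto simp: n_def window_def)
    have "insert j (window n0) \<subseteq> window n" using j that by (auto simp: window_def n_def)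
    then have "(\<Sum>j\<in>insert j (window n0). (cmod (\<psi> j))\<^sup>2) \<le> mass \<psi> n"
      unfolding mass_def by (intro sum_mono2) auto
    then have "(cmod (\<psi> j))\<^sup>2 < \<epsilon>\<^sup>2" using j n0 l(2)[of n] by (simp add: mass_def)
    then show ?thesis using \<epsilon> by (simp add: power2_less_imp_less)
  qed
  then show "\<exists>J. \<forall>j. J \<le> \<bar>j\<bar> \<longrightarrow> cmod (\<psi> j) < \<epsilon>" by blast
qed

lemma vanishes_tendsto:
  assumes "vanishes \<psi>" "\<And>n::nat. int n \<le> \<bar>h n\<bar>"
  shows "(\<lambda>n. \<psi> (h n)) \<longlonglongrightarrow> 0"
proof (rule LIMSEQ_I)
  fix r :: real assume "r > 0"
  then obtain J where J: "\<And>j. J \<le> \<bar>j\<bar> \<Longrightarrow> cmod (\<psi> j) < r" using assms(1) unfolding vanishes_def by blast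
  have "norm (\<psi> (h n) - 0) < r" if "n \<ge> nat J" for n
    using J[of "h n"] assms(2)[of n] that by simp
  then show "\<exists>no. \<forall>n\<ge>no. norm (\<psi> (h n) - 0) < r" by blast
qed

lemma vanishes_xi:
  assumes "vanishes \<psi>" and s: "\<And>j. step a d z \<psi> \<xi> j" and a: "\<And>j. cmod (a j) \<le> 1"
  shows "vanishes \<xi>"
  unfolding vanishes_def
proof (intro allI impI)
  fix \<epsilon> :: real assume \<epsilon>: "\<epsilon> > 0"
  then obtain J where J: "\<And>j. J \<le> \<bar>j\<bar> \<Longrightarrow> cmod (\<psi> j) < \<epsilon> / 2"
    using assms(1) unfolding vanishes_def by (meson half_gt_zero)
  have "cmod (\<xi> j) < \<epsilon>" if "J + 1 \<le> \<bar>j\<bar>" for j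
  proof -
    have sq: "(cmod (\<psi> i))\<^sup>2 \<le> (\<epsilon>/2)\<^sup>2" if "J \<le> \<bar>i\<bar>" for i
      using J[OF that] by (intro power_mono) auto
    have "(cmod (\<xi> j))\<^sup>2 \<le> (cmod (\<psi> (j-1)))\<^sup>2 + (cmod (\<psi> j))\<^sup>2 + (cmod (\<psi> (j+1)))\<^sup>2"
      by (rule xi_bound[OF s a])
    also have "\<dots> \<le> 3 * (\<epsilon>/2)\<^sup>2" using sq[of "j-1"] sq[of j] sq[of "j+1"] that by linarith
    also have "\<dots> < \<epsilon>\<^sup>2" using \<epsilon> by (simp add: power2_eq_square)
    finally show ?thesis using \<epsilon> by (simp add: power2_less_imp_less)
  qed
  then show "\<exists>J. \<forall>j. J \<le> \<bar>j\<bar> \<longrightarrow> cmod (\<xi> j) < \<epsilon>" by blast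
qed

text \<open>The boundary terms of \<open>form_sum\<close> tend to zero, the unimodular phases
  dropping out in modulus.\<close>

lemma form_limit:
  assumes a: "\<And>j. cmod (a j) \<le> 1" and d: "\<And>j. cmod (d j) = 1" "\<And>j. cmod (d' j) = 1"
    and s: "\<And>j. step a d z \<psi> \<xi> j" "\<And>j. step a d' z' \<psi>' \<xi>' j"
    and v: "vanishes \<psi>" "vanishes \<psi>'"
  shows "(\<lambda>n. \<Sum>j\<in>window n. (1 - z * d j * cnj (z' * d' j)) * (\<psi> j * cnj (\<psi>' j))) \<longlonglongrightarrow> 0"
proof -
  note vx = vanishes_xi[OF v(1) s(1) a] vanishes_xi[OF v(2) s(2) a]
  have b: "(\<lambda>n. \<xi> (h n) * cnj (\<xi>' (h n)) - z * d (h n) * cnj (z' * d' (h n)) * (\<psi> (h n) * cnj (\<psi>' (h n)))) \<longlonglongrightarrow> 0"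
    if h: "\<And>n::nat. int n \<le> \<bar>h n\<bar>" for h
  proof -
    have 1: "(\<lambda>n. \<xi> (h n) * cnj (\<xi>' (h n))) \<longlonglongrightarrow> 0 * cnj 0"
      by (intro tendsto_intros vanishes_tendsto vx h)
    have "(\<lambda>n. (z * cnj z') * (\<psi> (h n) * cnj (\<psi>' (h n)))) \<longlonglongrightarrow> (z * cnj z') * (0 * cnj 0)"
      by (intro tendsto_intros vanishes_tendsto v h)
    then have "(\<lambda>n. cmod ((z * cnj z') * (\<psi> (h n) * cnj (\<psi>' (h n))))) \<longlonglongrightarrow> 0"
      using tendsto_norm_zero by fastforce
    then have "(\<lambda>n. cmod (z * d (h n) * cnj (z' * d' (h n)) * (\<psi> (h n) * cnj (\<psi>' (h n))))) \<longlonglongrightarrow> 0"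
      by (simp add: norm_mult d)
    then have 2: "(\<lambda>n. z * d (h n) * cnj (z' * d' (h n)) * (\<psi> (h n) * cnj (\<psi>' (h n)))) \<longlonglongrightarrow> 0"
      by (rule tendsto_norm_zero_cancel)
    show ?thesis using tendsto_diff[OF 1 2] by simp
  qed
  have "(\<lambda>n. (\<xi> (1 - 2 * int n) * cnj (\<xi>' (1 - 2 * int n)) - z * d (1 - 2 * int n) * cnj (z' * d' (1 - 2 * int n)) * (\<psi> (1 - 2 * int n) * cnj (\<psi>' (1 - 2 * int n))))
     + (\<xi> (2 * int n) * cnj (\<xi>' (2 * int n)) - z * d (2 * int n) * cnj (z' * d' (2 * int n)) * (\<psi> (2 * int n) * cnj (\<psi>' (2 * int n))))) \<longlonglongrightarrow> 0 + 0"
    by (intro tendsto_add b) auto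
  moreover have "\<forall>\<^sub>F n in sequentially. (\<xi> (1 - 2 * int n) * cnj (\<xi>' (1 - 2 * int n)) - z * d (1 - 2 * int n) * cnj (z' * d' (1 - 2 * int n)) * (\<psi> (1 - 2 * int n) * cnj (\<psi>' (1 - 2 * int n))))
     + (\<xi> (2 * int n) * cnj (\<xi>' (2 * int n)) - z * d (2 * int n) * cnj (z' * d' (2 * int n)) * (\<psi> (2 * int n) * cnj (\<psi>' (2 * int n))))
     = (\<Sum>j\<in>window n. (1 - z * d j * cnj (z' * d' j)) * (\<psi> j * cnj (\<psi>' j)))"
    using eventually_ge_at_top[of 1] by eventually_elim (rule form_sum[OF a s, symmetric])
  ultimately show ?thesis by (simp add: filterlim_cong)
qed

text \<open>Here \<open>w\<close> is the ratio of two eigenvalues, \<mu> the difference of their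
  kicks and \<open>T n\<close> the truncated inner product. The relation
  \<open>(1 - w) T = w (cis \<mu> - 1)\<close> gives a Lipschitz bound from |T| \<ge> 9/10, and
  clockwise motion at a definite speed from its imaginary part.\<close>

lemma eigenvalue_shift_bounds:
  assumes w: "cmod w = 1" and lim: "(\<lambda>n. (1 - w) * T n - w * (cis \<mu> - 1)) \<longlonglongrightarrow> 0"
    and T: "\<And>n. n \<ge> L \<Longrightarrow> Re (T n) \<ge> 9/10 \<and> \<bar>Im (T n)\<bar> \<le> 1/10 \<and> cmod (T n) \<le> M" and M: "M \<ge> 1"
  shows "cmod (1 - w) \<le> 2 * \<bar>\<mu>\<bar>" "0 < \<mu> \<Longrightarrow> \<mu> \<le> 1 \<Longrightarrow> Im w \<le> - sin \<mu> / (2 * M\<^sup>2)"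
proof -
  have "9/10 * cmod (1 - w) \<le> \<bar>\<mu>\<bar>"
  proof (rule LIMSEQ_le)
    show "(\<lambda>n. 9/10 * cmod (1 - w)) \<longlonglongrightarrow> 9/10 * cmod (1 - w)" by simp
    have "(\<lambda>n. cmod ((1 - w) * T n - w * (cis \<mu> - 1)) + \<bar>\<mu>\<bar>) \<longlonglongrightarrow> cmod 0 + \<bar>\<mu>\<bar>"
      by (intro tendsto_intros lim)
    then show "(\<lambda>n. cmod ((1 - w) * T n - w * (cis \<mu> - 1)) + \<bar>\<mu>\<bar>) \<longlonglongrightarrow> \<bar>\<mu>\<bar>" by simp
    have "9/10 * cmod (1 - w) \<le> cmod ((1 - w) * T n - w * (cis \<mu> - 1)) + \<bar>\<mu>\<bar>" if "n \<ge> L" for n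
    proof -
      have "9/10 \<le> cmod (T n)" using T[OF that] complex_Re_le_cmod[of "T n"] by linarith
      then have "9/10 * cmod (1 - w) \<le> cmod ((1 - w) * T n)" unfolding norm_mult using mult_right_mono[of "9/10" "cmod (T n)" "cmod (1 - w)"] by (simp add: mult.commute)
      also have "\<dots> \<le> cmod ((1 - w) * T n - w * (cis \<mu> - 1)) + cmod (w * (cis \<mu> - 1))"
        using norm_triangle_sub[of "(1 - w) * T n" "w * (cis \<mu> - 1)"] by simp
      also have "cmod (w * (cis \<mu> - 1)) \<le> \<bar>\<mu>\<bar>"
        using dist_exp_i_1[of \<mu>] abs_sin_x_le_abs_x[of "\<mu> / 2"] by (simp add: norm_mult w cis_conv_exp)
      finally show ?thesis by simp
    qed
    then show "\<exists>N. \<forall>n\<ge>N. 9/10 * cmod (1 - w) \<le> cmod ((1 - w) * T n - w * (cis \<mu> - 1)) + \<bar>\<mu>\<bar>" by blast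
  qed
  then show "cmod (1 - w) \<le> 2 * \<bar>\<mu>\<bar>" using norm_ge_zero[of "1 - w"] by linarith
  assume \<mu>: "0 < \<mu>" "\<mu> \<le> 1"
  have sin: "sin \<mu> > 0" using \<mu> pi_gt3 by (intro sin_gt_zero) auto
  have cos: "cos \<mu> > 0" using \<mu> pi_gt3 by (intro cos_gt_zero) auto
  have "1\<^sup>2 \<le> (sin \<mu> + cos \<mu>)\<^sup>2"
    using sin cos by (simp add: power2_sum)
  \<comment> \<open>This lets the term with \<open>Im (T n)\<close> be absorbed: of
    \<open>sin \<mu>\<close> there remain 9/10 - 1/10 - 3/10 = 1/2, the last loss being the error
    \<open>r\<close>.\<close>
  then have sc: "1 - cos \<mu> \<le> sin \<mu>" using power2_le_imp_le[of 1 "sin \<mu> + cos \<mu>"] sin cos by simp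
  obtain n1 where n1: "\<And>n. n \<ge> n1 \<Longrightarrow> cmod ((1 - w) * T n - w * (cis \<mu> - 1)) < (3/10 * sin \<mu>) / M"
    using LIMSEQ_D[OF lim, of "(3/10 * sin \<mu>) / M"] sin M by auto
  define n where "n = max L n1"
  define r where "r = (1 - w) * T n - w * (cis \<mu> - 1)"
  have Tn: "Re (T n) \<ge> 9/10" "\<bar>Im (T n)\<bar> \<le> 1/10" "cmod (T n) \<le> M" using T[of n] by (auto simp: n_def)
  have "cmod (cnj w * cnj (T n) * r) \<le> M * (3/10 * sin \<mu> / M)"
    using n1[of n] Tn M unfolding norm_mult complex_mod_cnj w
    by (intro mult_mono) (auto simp: r_def n_def intro: less_imp_le)
  then have rs: "\<bar>Im (cnj w * cnj (T n) * r)\<bar> \<le> 3/10 * sin \<mu>"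
    using abs_Im_le_cmod[of "cnj w * cnj (T n) * r"] M by simp
  have wc: "cnj w * w = 1" using unit_mult_cnj[OF w] by (simp add: mult.commute)
  \<comment> \<open>Multiplying by \<open>cnj w * cnj (T n)\<close> makes the factor of
    \<open>cnj w - 1\<close> real, so that \<open>Im w\<close> can be isolated.\<close>
  have "cnj w * cnj (T n) * r = (cnj w - cnj w * w) * (T n * cnj (T n)) - (cnj w * w) * (cis \<mu> - 1) * cnj (T n)"
    by (simp add: r_def algebra_simps)
  also have "\<dots> = (cnj w - 1) * complex_of_real ((cmod (T n))\<^sup>2) - (cis \<mu> - 1) * cnj (T n)"
    unfolding wc complex_norm_square by simp
  finally have eq: "cnj w * cnj (T n) * r = \<dots>" .
  have im: "Im ((cnj w - 1) * complex_of_real S - (cis \<mu> - 1) * cnj t) = - Im w * S - (sin \<mu> * Re t - (cos \<mu> - 1) * Im t)" for S t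
    by (simp add: algebra_simps)
  have "Im (cnj w * cnj (T n) * r) = - Im w * (cmod (T n))\<^sup>2 - (sin \<mu> * Re (T n) - (cos \<mu> - 1) * Im (T n))"
    unfolding eq by (rule im)
  moreover have "sin \<mu> * Re (T n) \<ge> sin \<mu> * (9/10)" using sin Tn by (intro mult_left_mono) auto
  moreover have "\<bar>(cos \<mu> - 1) * Im (T n)\<bar> \<le> sin \<mu> * (1/10)"
    unfolding abs_mult using Tn sc cos_le_one[of \<mu>] sin by (intro mult_mono) auto
  ultimately have *: "- Im w * (cmod (T n))\<^sup>2 \<ge> sin \<mu> / 2" using rs by linarith
  have "(cmod (T n))\<^sup>2 \<le> M\<^sup>2" using Tn(3) by (intro power_mono) auto
  moreover have "- Im w \<ge> 0"
    using * sin zero_le_power2[of "cmod (T n)"] by (smt (verit) half_gt_zero mult_nonpos_nonneg)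
  ultimately have "- Im w * (cmod (T n))\<^sup>2 \<le> - Im w * M\<^sup>2" by (intro mult_left_mono)
  then show "Im w \<le> - sin \<mu> / (2 * M\<^sup>2)" using * M by (simp add: field_simps)
qed

text \<open>The phase is raised on a whole half-line since site phases are differences: only the one
  at \<open>s\<close> changes, and the configuration moves by at most |\<theta>| at each
  site.\<close>

definition kick :: "int \<Rightarrow> real \<Rightarrow> (int \<Rightarrow> complex \<times> real) \<Rightarrow> int \<Rightarrow> complex \<times> real"
  where "kick s \<theta> x j = (fst (x j), snd (x j) + (if s \<le> j then \<theta> else 0))"

abbreviation rot :: "real \<Rightarrow> (int \<Rightarrow> complex \<times> real) \<Rightarrow> int \<Rightarrow> complex \<times> real"
  where "rot \<equiv> kick 0"

lemma amp_kick [simp]: "amp (kick s \<theta> x) = amp x"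
  by (auto simp: amp_def kick_def)

lemma site_phase_kick: "site_phase (kick s \<theta> x) = (site_phase x)(s := cis \<theta> * site_phase x s)"
proof
  fix j :: int
  consider "j < s" | "j = s" | "j > s" by linarith
  then show "site_phase (kick s \<theta> x) j = ((site_phase x)(s := cis \<theta> * site_phase x s)) j"
    by cases (auto simp: site_phase_def kick_def cis_mult algebra_simps)
qed

lemma kick_0 [simp]: "kick s 0 x = x"
  by (auto simp: kick_def)

text \<open>The site phases differ at 0 only, where both solutions equal 1; the weighted sum is
  therefore the inner product plus one explicit term.\<close>

lemma rot_form_limit:
  assumes a: "\<And>j. cmod (amp x j) \<le> 1"
    and s: "normalized_solution (rot \<theta> x) z \<psi> \<xi>" "normalized_solution (rot \<theta>' x) z' \<psi>' \<xi>'"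
    and m: "\<And>n. mass \<psi> n \<le> M" "\<And>n. mass \<psi>' n \<le> M"
  shows "(\<lambda>n. (1 - z * cnj z') * inner_window \<psi> \<psi>' n - (z * cnj z') * (cis (\<theta> - \<theta>') - 1)) \<longlonglongrightarrow> 0"
proof -
  have st: "\<And>j. step (amp x) (site_phase (rot \<theta> x)) z \<psi> \<xi> j" "\<And>j. step (amp x) (site_phase (rot \<theta>' x)) z' \<psi>' \<xi>' j"
    using s by (auto simp: normalized_solution_def)
  let ?w = "\<lambda>j. 1 - z * site_phase (rot \<theta> x) j * cnj (z' * site_phase (rot \<theta>' x) j)"
  have "(\<lambda>n. \<Sum>j\<in>window n. ?w j * (\<psi> j * cnj (\<psi>' j))) \<longlonglongrightarrow> 0"
    by (rule form_limit[OF a _ _ st vanishes_mass[OF m(1)] vanishes_mass[OF m(2)]]) auto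
  moreover have "(\<Sum>j\<in>window n. ?w j * (\<psi> j * cnj (\<psi>' j)))
      = (1 - z * cnj z') * inner_window \<psi> \<psi>' n - (z * cnj z') * (cis (\<theta> - \<theta>') - 1)" if "n \<ge> 1" for n
  proof -
    have 0: "0 \<in> window n" using that by (auto simp: window_def)
    have u: "site_phase x j * cnj (site_phase x j) = 1" for j by (rule unit_mult_cnj) simp
    have w: "?w j = 1 - z * cnj z' * (if j = 0 then cis (\<theta> - \<theta>') else 1)" for j
    proof -
      have "z * site_phase (rot \<theta> x) j * cnj (z' * site_phase (rot \<theta>' x) j) =
         z * cnj z' * (site_phase x j * cnj (site_phase x j)) * (if j = 0 then cis \<theta> * cnj (cis \<theta>') else 1)"
        by (simp add: site_phase_kick)
      also have "\<dots> = z * cnj z' * (if j = 0 then cis (\<theta> - \<theta>') else 1)"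
        unfolding u by (simp add: cis_cnj cis_mult)
      finally show ?thesis by simp
    qed
    have "(\<Sum>j\<in>window n. ?w j * (\<psi> j * cnj (\<psi>' j))) =
      (\<Sum>j\<in>window n. (1 - z * cnj z') * (\<psi> j * cnj (\<psi>' j)) + (if j = 0 then - (z * cnj z') * (cis (\<theta> - \<theta>') - 1) else 0))"
      unfolding w using s by (intro sum.cong) (auto simp: normalized_solution_def algebra_simps)
    also have "\<dots> = (1 - z * cnj z') * inner_window \<psi> \<psi>' n - (z * cnj z') * (cis (\<theta> - \<theta>') - 1)"
      using 0 by (simp add: sum.distrib inner_window_def sum_distrib_left)
    finally show ?thesis .
  qed
  then have "\<forall>\<^sub>F n in sequentially. (\<Sum>j\<in>window n. ?w j * (\<psi> j * cnj (\<psi>' j)))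
      = (1 - z * cnj z') * inner_window \<psi> \<psi>' n - (z * cnj z') * (cis (\<theta> - \<theta>') - 1)"
    by (rule eventually_sequentiallyI)
  ultimately show ?thesis by (simp add: filterlim_cong)
qed

section \<open>Interior configurations and the common eigenvalue\<close>

lemma open_fun_nhd:
  fixes U :: "(int \<Rightarrow> 'b::metric_space) set"
  assumes "open U" "c \<in> U"
  obtains K \<delta> where "\<delta> > 0" "\<And>x. (\<And>j. \<bar>j\<bar> \<le> int K \<Longrightarrow> dist (x j) (c j) \<le> \<delta>) \<Longrightarrow> x \<in> U"
proof -
  have "\<exists>K::nat. \<forall>x. (\<forall>j. \<bar>j\<bar> \<le> int K \<longrightarrow> dist (x j) (c j) \<le> 1 / Suc K) \<longrightarrow> x \<in> U"
  proof (rule ccontr)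
    assume "\<not> ?thesis"
    then obtain x where x: "\<And>K j. \<bar>j\<bar> \<le> int K \<Longrightarrow> dist (x K j) (c j) \<le> 1 / Suc K" "\<And>K. x K \<notin> U"
      by metis
    have "(\<lambda>k. x k j) \<longlonglongrightarrow> c j" for j
    proof (rule metric_tendsto_imp_tendsto)
      show "(\<lambda>n. 1 / real (Suc n)) \<longlonglongrightarrow> 0" using LIMSEQ_inverse_real_of_nat by (simp add: field_simps)
      show "\<forall>\<^sub>F k in sequentially. dist (x k j) (c j) \<le> dist (1 / real (Suc k)) 0"
        using eventually_ge_at_top[of "nat \<bar>j\<bar>"] by eventually_elim (use x(1) in auto)
    qed
    then have "x \<longlonglongrightarrow> c" by (simp add: tendsto_fun_iff)
    then show False using topological_tendstoD[of x c sequentially U] assms x(2) by (auto simp: eventually_sequentially)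
  qed
  then show ?thesis using that by (metis of_nat_0_less_iff zero_less_Suc zero_less_divide_1_iff)
qed

context persistent
begin

text \<open>The slack \<open>s\<close>, uniform over all sites, is what later pays for the
  recurrence error and for the kicks; \<open>K\<close> and \<delta> describe a basic product
  neighbourhood.\<close>

lemma exists_center:
  assumes "openin (top_of_set B) W" "W \<noteq> {}"
  obtains c s K \<delta> where "c \<in> W" "s > 0" "\<delta> > 0" "s < f" "\<And>j. cmod (fst (c j) - g j) \<le> e - s" "\<And>j. \<bar>snd (c j)\<bar> \<le> f - s"
    "\<And>x. x \<in> B \<Longrightarrow> \<forall>j. \<bar>j\<bar> \<le> int K \<longrightarrow> dist (x j) (c j) \<le> \<delta> \<Longrightarrow> x \<in> W"
proof -
  obtain U where U: "open U" "W = B \<inter> U" using assms(1) by (metis openin_open)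
  obtain b where b: "b \<in> B" "b \<in> U" using assms(2) U by blast
  \<comment> \<open>Contractions of \<open>b\<close> towards the centre \<open>(g, 0)\<close> of the
    box: they tend to \<open>b\<close>, so one lies in \<open>U\<close>, and each is strictly inside
    the box.\<close>
  define x where "x k j = (g j + (1 - 1 / (real k + 2)) *\<^sub>R (fst (b j) - g j), (1 - 1 / (real k + 2)) * snd (b j))" for k :: nat and j
  have t0: "(\<lambda>k. 1 / (real k + 2)) \<longlonglongrightarrow> 0" by real_asymp
  have "(\<lambda>k. x k j) \<longlonglongrightarrow> (g j + (1 - 0) *\<^sub>R (fst (b j) - g j), (1 - 0) * snd (b j))" for j
    unfolding x_def by (intro tendsto_intros t0)
  then have "x \<longlonglongrightarrow> b" by (simp add: tendsto_fun_iff)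
  then obtain k where k: "x k \<in> U" using topological_tendstoD[of x b sequentially U] U(1) b(2) by (auto simp: eventually_sequentially)
  define t where "t = 1 / (real k + 2)"
  have t: "0 < t" "t < 1" by (auto simp: t_def)
  define s where "s = min (t * e) (t * f)"
  have s: "s > 0" "s \<le> t * e" "s \<le> t * f" using t e f by (auto simp: s_def)
  have "t * f < f" using t f by simp
  have c1: "cmod (fst (x k j) - g j) \<le> e - s" for j
  proof -
    have "cmod (fst (x k j) - g j) = (1 - t) * cmod (fst (b j) - g j)" using t by (simp add: x_def t_def)
    also have "\<dots> \<le> (1 - t) * e" using b(1) t by (intro mult_left_mono) (auto simp: B_def)
    finally show ?thesis using s by (simp add: algebra_simps)
  qed
  have c2: "\<bar>snd (x k j)\<bar> \<le> f - s" for j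
  proof -
    have "\<bar>snd (x k j)\<bar> = (1 - t) * \<bar>snd (b j)\<bar>" using t by (simp add: x_def t_def abs_mult)
    also have "\<dots> \<le> (1 - t) * f" using b(1) t by (intro mult_left_mono) (auto simp: B_def)
    finally show ?thesis using s by (simp add: algebra_simps)
  qed
  have "x k \<in> B" unfolding B_def mem_Collect_eq using c1 c2 s(1) by (smt (verit))
  moreover obtain K \<delta> where "\<delta> > 0" "\<And>y. (\<And>j. \<bar>j\<bar> \<le> int K \<Longrightarrow> dist (y j) (x k j) \<le> \<delta>) \<Longrightarrow> y \<in> U"
    using open_fun_nhd[OF U(1) k] by blast
  ultimately show ?thesis using that[of "x k" s \<delta> K] s c1 c2 k U \<open>t * f < f\<close> by auto
qed

text \<open>A kick at the origin moves the localized eigenvalue monotonically and at a speed that does not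
  depend on the far coefficients, so by the intermediate value theorem it can be tuned to one and
  the same value \<open>z\<close> for all of them.\<close>

theorem exists_common_eigenvalue:
  obtains c s K l z M where
    "s > 0" "0 < l" "8 * l \<le> s" "l \<le> 1/8" "s < f" "cmod z = 1"
    "\<And>j. cmod (fst (c j) - g j) \<le> e - s" "\<And>j. \<bar>snd (c j)\<bar> \<le> f - s"
    "\<exists>\<psi> \<xi>. normalized_solution c z \<psi> \<xi> \<and> (\<forall>n. mass \<psi> n \<le> M)"
    "\<And>x. x \<in> B \<Longrightarrow> (\<And>j. \<bar>j\<bar> \<le> int K \<Longrightarrow> x j = c j) \<Longrightarrow> (\<And>j. \<bar>snd (x j)\<bar> \<le> f - l) \<Longrightarrow>
       \<exists>\<theta> \<psi> \<xi>. \<bar>\<theta>\<bar> \<le> l \<and> normalized_solution (rot \<theta> x) z \<psi> \<xi> \<and> (\<forall>n. mass \<psi> n \<le> M)"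
proof -
  obtain M W L and G :: "(int \<Rightarrow> complex \<times> real) \<Rightarrow> complex \<Rightarrow> (int \<Rightarrow> complex) \<Rightarrow> (int \<Rightarrow> complex) \<Rightarrow> bool"
    where M: "1 \<le> M" and W: "openin (top_of_set B) W" "W \<noteq> {}"
    and ex: "\<And>x. x \<in> W \<Longrightarrow> \<exists>z \<psi> \<xi>. G x z \<psi> \<xi>"
    and G: "\<And>x z \<psi> \<xi>. G x z \<psi> \<xi> \<Longrightarrow> x \<in> W \<and> normalized_solution x z \<psi> \<xi> \<and> (\<forall>n. mass \<psi> n \<le> M)"
    and inn: "\<And>x z \<psi> \<xi> x' z' \<psi>' \<xi>' n. G x z \<psi> \<xi> \<Longrightarrow> G x' z' \<psi>' \<xi>' \<Longrightarrow> n \<ge> L \<Longrightarrow>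
       Re (inner_window \<psi> \<psi>' n) \<ge> 9/10 \<and> \<bar>Im (inner_window \<psi> \<psi>' n)\<bar> \<le> 1/10 \<and> cmod (inner_window \<psi> \<psi>' n) \<le> M"
    and cl: "\<And>x z \<psi> \<xi> x' z'. \<forall>j. (\<lambda>k. x k j) \<longlonglongrightarrow> x' j \<Longrightarrow> x' \<in> W \<Longrightarrow> \<forall>k. G (x k) (z k) (\<psi> k) (\<xi> k) \<Longrightarrow>
       z \<longlonglongrightarrow> z' \<Longrightarrow> \<exists>\<psi>' \<xi>'. G x' z' \<psi>' \<xi>'"
    by (rule exists_rigid) (rule that)
  have nz: "cmod z = 1" if "G x z \<psi> \<xi>" for x z \<psi> \<xi> using G[OF that] by (simp add: normalized_solution_def)
  have shift: "cmod (z - z') \<le> 2 * \<bar>\<theta> - \<theta>'\<bar>"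
      "0 < \<theta> - \<theta>' \<Longrightarrow> \<theta> - \<theta>' \<le> 1 \<Longrightarrow> Im (z * cnj z') \<le> - sin (\<theta> - \<theta>') / (2 * M\<^sup>2)"
    if x: "x \<in> B" and g1: "G (rot \<theta> x) z \<psi> \<xi>" and g2: "G (rot \<theta>' x) z' \<psi>' \<xi>'" for x \<theta> \<theta>' z z' \<psi> \<psi>' \<xi> \<xi>'
  proof -
    have w: "cmod (z * cnj z') = 1" using nz[OF g1] nz[OF g2] by (simp add: norm_mult)
    have s: "normalized_solution (rot \<theta> x) z \<psi> \<xi>" "normalized_solution (rot \<theta>' x) z' \<psi>' \<xi>'" "\<And>n. mass \<psi> n \<le> M" "\<And>n. mass \<psi>' n \<le> M"
      using G[OF g1] G[OF g2] by auto
    note lim = rot_form_limit[OF amp_le_1[OF x] s]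
    have "cmod (1 - z * cnj z') \<le> 2 * \<bar>\<theta> - \<theta>'\<bar>"
      by (rule eigenvalue_shift_bounds(1)[OF w lim inn[OF g1 g2] M])
    moreover have "z - z' = - z' * (1 - z * cnj z')"
      using unit_mult_cnj[OF nz[OF g2]] by (simp add: algebra_simps)
    ultimately show "cmod (z - z') \<le> 2 * \<bar>\<theta> - \<theta>'\<bar>" using nz[OF g2] by (simp add: norm_mult)
    show "Im (z * cnj z') \<le> - sin (\<theta> - \<theta>') / (2 * M\<^sup>2)" if "0 < \<theta> - \<theta>'" "\<theta> - \<theta>' \<le> 1"
      by (rule eigenvalue_shift_bounds(2)[OF w lim inn[OF g1 g2] M that])
  qed
  obtain c s K \<delta> where c: "c \<in> W" "s > 0" "\<delta> > 0" "s < f" "\<And>j. cmod (fst (c j) - g j) \<le> e - s" "\<And>j. \<bar>snd (c j)\<bar> \<le> f - s"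
    "\<And>x. x \<in> B \<Longrightarrow> \<forall>j. \<bar>j\<bar> \<le> int K \<longrightarrow> dist (x j) (c j) \<le> \<delta> \<Longrightarrow> x \<in> W"
    by (rule exists_center[OF W]) (rule that)
  have cB: "c \<in> B" using c(1) openin_imp_subset[OF W(1)] by blast
  \<comment> \<open>Later kicks and the tuning use several multiples of \<open>l\<close>, covered by
    \<open>s / 8\<close>; \<delta> keeps tuned configurations in \<open>W\<close>, and 1/8 keeps all
    angles small.\<close>
  define l where "l = Min {s / 8, \<delta>, 1/8}"
  have l: "0 < l" "8 * l \<le> s" "l \<le> 1/8" "l \<le> \<delta>" using c(2,3) by (auto simp: l_def)
  obtain z0 \<psi>0 \<xi>0 where z0: "G c z0 \<psi>0 \<xi>0" using ex[OF c(1)] by blast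
  \<comment> \<open>The imaginary displacement of the eigenvalue that a kick of size
    \<open>l\<close> guarantees.\<close>
  define h where "h = sin l / (2 * M\<^sup>2)"
  have sin: "sin l > 0" using l pi_gt3 by (intro sin_gt_zero) auto
  have h: "h > 0" using sin M by (simp add: h_def)
  have "sin l \<le> l" using l sin_x_le_x by auto
  then have "h \<le> l / 2" unfolding h_def using M l one_le_power[of M 2] sin by (intro frac_le) auto
  then have hl: "h \<le> 1/16" using l by simp
  \<comment> \<open>Compactness: changes far enough out move the eigenvalue by at most half of what
    the kick can compensate.\<close>
  have cont: "\<exists>K1\<ge>K. \<forall>x\<in>B. (\<forall>j. \<bar>j\<bar> \<le> int K1 \<longrightarrow> x j = c j) \<longrightarrow> (\<forall>z \<psi> \<xi>. G x z \<psi> \<xi> \<longrightarrow> cmod (z - z0) \<le> h / 2)"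
  proof (rule ccontr)
    assume "\<not> ?thesis"
    then have no: "\<not> (\<forall>x\<in>B. (\<forall>j. \<bar>j\<bar> \<le> int K1 \<longrightarrow> x j = c j) \<longrightarrow> (\<forall>z \<psi> \<xi>. G x z \<psi> \<xi> \<longrightarrow> cmod (z - z0) \<le> h / 2))"
      if "K1 \<ge> K" for K1 using that by blast
    have "\<exists>x z \<psi> \<xi>. (\<forall>j. \<bar>j\<bar> \<le> int (k + K) \<longrightarrow> x j = c j) \<and> G x z \<psi> \<xi> \<and> \<not> cmod (z - z0) \<le> h / 2" for k
      using no[of "k + K", OF le_add2] by blast
    then obtain x z \<psi> \<xi> where x: "\<And>k j. \<bar>j\<bar> \<le> int (k + K) \<Longrightarrow> x k j = c j" and g: "\<And>k. G (x k) (z k) (\<psi> k) (\<xi> k)"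
        and far: "\<And>k. \<not> cmod (z k - z0) \<le> h / 2" by metis
    have "bounded (range z)" using nz[OF g] by (intro boundedI[of _ 1]) auto
    then obtain z' r where r: "strict_mono (r :: nat \<Rightarrow> nat)" "(z \<circ> r) \<longlonglongrightarrow> z'"
      using bounded_imp_convergent_subsequence by blast
    have xl: "(\<lambda>k. x (r k) j) \<longlonglongrightarrow> c j" for j
    proof (rule tendsto_eventually)
      show "\<forall>\<^sub>F k in sequentially. x (r k) j = c j"
        using eventually_ge_at_top[of "nat \<bar>j\<bar>"]
      proof eventually_elim
        case (elim k)
        then have "\<bar>j\<bar> \<le> int (r k + K)" using seq_suble[OF r(1), of k] by linarith
        then show ?case by (rule x)
      qed
    qed
    obtain \<psi>' \<xi>' where "G c z' \<psi>' \<xi>'"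
      using cl[of "\<lambda>k. x (r k)" c "\<lambda>k. z (r k)" "\<lambda>k. \<psi> (r k)" "\<lambda>k. \<xi> (r k)" z'] xl c(1) g r(2)
      unfolding o_def by blast
    \<comment> \<open>For equal kicks the Lipschitz bound is zero, so all good solutions of one
      configuration have the same eigenvalue.\<close>
    then have "z' = z0" using shift(1)[OF cB, of 0 z' \<psi>' \<xi>' 0 z0 \<psi>0 \<xi>0] z0 by simp
    then have "(\<lambda>k. cmod (z (r k) - z0)) \<longlonglongrightarrow> cmod (z0 - z0)"
      using r(2) by (intro tendsto_intros) (simp add: o_def)
    then have "(\<lambda>k. cmod (z (r k) - z0)) \<longlonglongrightarrow> 0" by simp
    then have "\<forall>\<^sub>F k in sequentially. cmod (z (r k) - z0) < h / 2" by (rule order_tendstoD) (use h in simp)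
    then show False using far unfolding eventually_sequentially by (meson le_refl less_imp_le)
  qed
  then obtain K1 where K1: "K1 \<ge> K" "\<And>x z \<psi> \<xi>. x \<in> B \<Longrightarrow> (\<And>j. \<bar>j\<bar> \<le> int K1 \<Longrightarrow> x j = c j) \<Longrightarrow> G x z \<psi> \<xi> \<Longrightarrow> cmod (z - z0) \<le> h / 2"
    by blast
  show ?thesis
  proof (rule that[of s l z0 c M K1])
    show "cmod z0 = 1" by (rule nz[OF z0])
    show "\<exists>\<psi> \<xi>. normalized_solution c z0 \<psi> \<xi> \<and> (\<forall>n. mass \<psi> n \<le> M)" using G[OF z0] by blast
    fix x assume x: "x \<in> B" "\<And>j. \<bar>j\<bar> \<le> int K1 \<Longrightarrow> x j = c j" "\<And>j. \<bar>snd (x j)\<bar> \<le> f - l"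
    have "rot \<theta> x \<in> W" if "\<bar>\<theta>\<bar> \<le> l" for \<theta>
    proof (rule c(7))
      have "\<bar>snd (x j) + \<theta>\<bar> \<le> f" "\<bar>snd (x j)\<bar> \<le> f" for j using x(3)[of j] that by linarith+
      then show "rot \<theta> x \<in> B" using x(1) by (auto simp: B_def kick_def)
      have "dist (rot \<theta> x j) (c j) \<le> \<delta>" if "\<bar>j\<bar> \<le> int K" for j
        using x(2)[of j] that K1(1) \<open>\<bar>\<theta>\<bar> \<le> l\<close> l(4) c(3) by (auto simp: kick_def dist_prod_def dist_real_def)
      then show "\<forall>j. \<bar>j\<bar> \<le> int K \<longrightarrow> dist (rot \<theta> x j) (c j) \<le> \<delta>" by blast
    qed
    then have "\<forall>\<theta>. \<bar>\<theta>\<bar> \<le> l \<longrightarrow> (\<exists>z \<psi> \<xi>. G (rot \<theta> x) z \<psi> \<xi>)" using ex by blast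
    then obtain Z \<Psi> \<Xi> where Z: "\<And>\<theta>. \<bar>\<theta>\<bar> \<le> l \<Longrightarrow> G (rot \<theta> x) (Z \<theta>) (\<Psi> \<theta>) (\<Xi> \<theta>)" by metis
    have lip: "cmod (Z \<theta> - Z \<theta>') \<le> 2 * \<bar>\<theta> - \<theta>'\<bar>" if "\<bar>\<theta>\<bar> \<le> l" "\<bar>\<theta>'\<bar> \<le> l" for \<theta> \<theta>'
      by (rule shift(1)[OF x(1) Z Z]) (use that in auto)
    have Z0: "cmod (Z 0 - z0) \<le> h / 2" using K1(2)[OF x(1,2), of "Z 0" "\<Psi> 0" "\<Xi> 0"] Z[of 0] l by simp
    have uz: "z0 * cnj z0 = 1" by (rule unit_mult_cnj[OF nz[OF z0]])
    have "lipschitz_on 2 {-l..l} Z"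
      by (rule lipschitz_onI) (use lip in \<open>auto simp: dist_norm\<close>)
    then have "continuous_on {-l..l} Z" by (rule lipschitz_on_continuous_on)
    then have c: "continuous_on {-l..l} (\<lambda>\<theta>. Im (Z \<theta> * cnj z0))" by (intro continuous_intros)
    have near: "\<bar>Im (w * Z 0 * cnj z0) - Im w\<bar> \<le> h / 2" if "cmod w = 1" for w
    proof -
      have "w * Z 0 * cnj z0 - w = w * cnj z0 * (Z 0 - z0)" using uz by (simp add: algebra_simps)
      then have "cmod (w * Z 0 * cnj z0 - w) \<le> h / 2" using Z0 that nz[OF z0] by (simp add: norm_mult)
      then show ?thesis using abs_Im_le_cmod[of "w * Z 0 * cnj z0 - w"] by simp
    qed
    have u0: "Z 0 * cnj (Z 0) = 1" using unit_mult_cnj[OF nz[OF Z[of 0]]] l by simp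
    have nZ: "cmod (Z \<theta>) = 1" if "\<bar>\<theta>\<bar> \<le> l" for \<theta> using nz[OF Z[OF that]] .
    have fac: "Z \<theta> * cnj z0 = (Z \<theta> * cnj (Z 0)) * Z 0 * cnj z0" for \<theta>
      using u0 by (simp add: mult.assoc mult.commute[of "cnj (Z 0)"])
    have near': "Im (Z \<theta> * cnj (Z 0)) - h / 2 \<le> Im (Z \<theta> * cnj z0)" "Im (Z \<theta> * cnj z0) \<le> Im (Z \<theta> * cnj (Z 0)) + h / 2"
      if "\<bar>\<theta>\<bar> \<le> l" for \<theta>
    proof -
      have "\<bar>Im (Z \<theta> * cnj z0) - Im (Z \<theta> * cnj (Z 0))\<bar> \<le> h / 2"
        unfolding fac[of \<theta>] by (rule near) (use nZ[OF that] nZ[of 0] l in \<open>simp add: norm_mult\<close>)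
      then show "Im (Z \<theta> * cnj (Z 0)) - h / 2 \<le> Im (Z \<theta> * cnj z0)" "Im (Z \<theta> * cnj z0) \<le> Im (Z \<theta> * cnj (Z 0)) + h / 2"
        by linarith+
    qed
    \<comment> \<open>The kicks \<open>l\<close> and \<open>-l\<close> displace the eigenvalue by at
      least \<open>h\<close> in opposite senses; replacing \<open>Z 0\<close> by \<open>z0\<close>
      costs \<open>h / 2\<close>, so the signs at the ends persist.\<close>
    have "Im (Z l * cnj (Z 0)) \<le> - h"
      using shift(2)[OF x(1) Z[of l] Z[of 0]] l by (simp add: h_def)
    then have neg: "Im (Z l * cnj z0) \<le> 0"
      using near'[of l] l h by linarith
    have "Im (Z 0 * cnj (Z (-l))) \<le> - h"
      using shift(2)[OF x(1) Z[of 0] Z[of "-l"]] l by (simp add: h_def)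
    then have "Im (Z (-l) * cnj (Z 0)) \<ge> h" by (simp add: algebra_simps)
    then have pos: "Im (Z (-l) * cnj z0) \<ge> 0"
      using near'[of "-l"] l h by linarith
    obtain \<theta> where \<theta>: "-l \<le> \<theta>" "\<theta> \<le> l" "Im (Z \<theta> * cnj z0) = 0"
      using IVT2'[OF neg pos _ c] l by auto
    then have tl: "\<bar>\<theta>\<bar> \<le> l" by auto
    \<comment> \<open>A zero imaginary part leaves \<open>z0\<close> and \<open>-z0\<close>;
      nearness to \<open>z0\<close> excludes the latter.\<close>
    have "cmod (Z \<theta> - z0) \<le> cmod (Z \<theta> - Z 0) + cmod (Z 0 - z0)"
      using norm_triangle_ineq[of "Z \<theta> - Z 0" "Z 0 - z0"] by simp
    also have "\<dots> < 1" using lip[OF tl, of 0] Z0 hl l tl by simp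
    finally have "cmod (Z \<theta> * cnj z0 - 1) < 1"
      using uz nz[OF z0] by (metis (no_types, lifting) complex_mod_cnj left_diff_distrib mult.right_neutral norm_mult)
    then have re: "Re (Z \<theta> * cnj z0) > 0" using abs_Re_le_cmod[of "Z \<theta> * cnj z0 - 1"] by simp
    have "cmod (Z \<theta> * cnj z0) = 1" using nZ[OF tl] nz[OF z0] by (simp add: norm_mult)
    then have "Re (Z \<theta> * cnj z0) = 1" using re cmod_eq_Re[OF \<theta>(3)] by linarith
    then have "Z \<theta> * cnj z0 = 1" using \<theta>(3) by (simp add: complex_eq_iff)
    then have "Z \<theta> = z0" using uz by (metis mult.commute mult.left_commute mult.right_neutral)
    then show "\<exists>\<theta> \<psi> \<xi>. \<bar>\<theta>\<bar> \<le> l \<and> normalized_solution (rot \<theta> x) z0 \<psi> \<xi> \<and> (\<forall>n. mass \<psi> n \<le> M)"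
      using tl G[OF Z[OF tl]] by blast
  qed (use c l in auto)
qed

end

section \<open>Steering through a far copy\<close>

text \<open>The squared chord is \<open>2 - 2 * cos t\<close>, which increases with the angle on
  \<open>[0, pi]\<close>.\<close>

lemma cis_of_close:
  assumes "cmod u = 1" "cmod (u - 1) \<le> cmod (cis \<theta>0 - 1)" "0 \<le> \<theta>0" "\<theta>0 \<le> pi"
  obtains \<theta> where "\<bar>\<theta>\<bar> \<le> \<theta>0" "u = cis \<theta>"
proof -
  have dist: "(cmod (cis t - 1))\<^sup>2 = 2 - 2 * cos t" for t
    using sin_cos_squared_add[of t] by (simp add: cmod_power2 power2_diff)
  have "u \<noteq> 0" using assms(1) by auto
  then have u: "u = cis (Arg u)" using cis_Arg[of u] assms(1) by (simp add: sgn_eq)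
  have "\<bar>Arg u\<bar> \<le> \<theta>0"
  proof (rule ccontr)
    assume "\<not> \<bar>Arg u\<bar> \<le> \<theta>0"
    then have "cos \<bar>Arg u\<bar> < cos \<theta>0"
      using assms(3) mpi_less_Arg[of u] Arg_le_pi[of u] by (intro cos_monotone_0_pi) auto
    then have "(cmod (cis \<theta>0 - 1))\<^sup>2 < (cmod (u - 1))\<^sup>2" 
      using dist[of \<theta>0] dist[of "Arg u"] u by simp
    moreover have "(cmod (u - 1))\<^sup>2 \<le> (cmod (cis \<theta>0 - 1))\<^sup>2" using assms(2) by (intro power_mono) auto
    ultimately show False by simp
  qed
  then show ?thesis using that u by blast
qed

text \<open>The kicked and unkicked trial vectors at \<open>m\<close> have form value of modulus
  \<open>A\<^sup>2 * D\<close>; conservation makes one of the two solutions large at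
  \<open>n\<close>. Its form value against \<open>p\<close> is small, as \<open>p\<close> is small
  at \<open>m\<close>, so at \<open>n\<close> it nearly has the direction of \<open>p\<close>. The
  abstract \<open>Sol\<close> serves segments on either side of \<open>n\<close>.\<close>

lemma trial_solution:
  assumes ex: "\<And>u v. \<exists>\<psi> \<xi>. Sol \<psi> \<xi> \<and> \<psi> m = u \<and> \<xi> m = v"
    and cons: "\<And>\<psi> \<xi> \<psi>' \<xi>'. Sol \<psi> \<xi> \<Longrightarrow> Sol \<psi>' \<xi>' \<Longrightarrow>
      cmod (wronski \<psi> \<xi> \<psi>' \<xi>' n) = cmod (wronski \<psi> \<xi> \<psi>' \<xi>' m)"
    and ref: "Sol p p\<xi>" "p n = 1" "cmod (p m) \<le> \<tau>" "cmod (p\<xi> m) \<le> \<tau>"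
    and v: "cmod v1 = cmod v2" "v1 \<noteq> 0"
    and D: "D = cmod (cis \<theta>0 - 1)" "D > 0" "4 * \<tau> \<le> D * sqrt (D / 2)"
  obtains \<theta> F F\<xi> where "\<theta> = 0 \<or> \<theta> = \<theta>0" "Sol F F\<xi>" "F m = cis \<theta> * v1" "F\<xi> m = v2"
    "cmod (F n) = cmod (F\<xi> n)" "F n \<noteq> 0" "cmod (F n - F\<xi> n * cnj (p\<xi> n)) \<le> D / 2 * cmod (F n)"
proof -
  obtain \<psi> \<xi> where f: "Sol \<psi> \<xi>" "\<psi> m = v1" "\<xi> m = v2" using ex by blast
  obtain \<psi>' \<xi>' where f': "Sol \<psi>' \<xi>'" "\<psi>' m = cis \<theta>0 * v1" "\<xi>' m = v2" using ex by blast
  define A where "A = cmod v1"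
  have A: "A > 0" using v(2) by (simp add: A_def)
  have eqmod: "cmod (F n) = cmod (F\<xi> n)" if "Sol F F\<xi>" "cmod (F m) = cmod (F\<xi> m)" for F F\<xi>
  proof -
    have sq: "wronski F F\<xi> F F\<xi> i = complex_of_real ((cmod (F i))\<^sup>2 - (cmod (F\<xi> i))\<^sup>2)" for i
      unfolding wronski_def of_real_diff complex_norm_square ..
    have "cmod (wronski F F\<xi> F F\<xi> n) = 0" unfolding cons[OF that(1,1)] unfolding sq that(2) by simp
    then have "(cmod (F n))\<^sup>2 = (cmod (F\<xi> n))\<^sup>2" unfolding sq norm_of_real by simp
    then show ?thesis by simp
  qed
  have e: "cmod (\<psi> n) = cmod (\<xi> n)" "cmod (\<psi>' n) = cmod (\<xi>' n)"
    using eqmod[OF f(1)] eqmod[OF f'(1)] f(2,3) f'(2,3) v(1) by (simp_all add: norm_mult)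
  have "wronski \<psi> \<xi> \<psi>' \<xi>' m = (v1 * cnj v1) * cnj (cis \<theta>0) - v2 * cnj v2"
    by (simp add: wronski_def f f')
  also have "\<dots> = complex_of_real (A\<^sup>2) * cnj (cis \<theta>0 - 1)"
    unfolding complex_norm_square[symmetric] using v(1) by (simp add: A_def algebra_simps)
  finally have "cmod (wronski \<psi> \<xi> \<psi>' \<xi>' m) = A\<^sup>2 * D"
    by (simp only: norm_mult complex_mod_cnj D(1) norm_of_real) simp
  then have "A\<^sup>2 * D = cmod (\<psi> n * cnj (\<psi>' n) - \<xi> n * cnj (\<xi>' n))"
    using cons[OF f(1) f'(1)] by (simp add: wronski_def)
  also have "\<dots> \<le> 2 * (cmod (\<psi> n) * cmod (\<psi>' n))"
    using norm_triangle_ineq4[of "\<psi> n * cnj (\<psi>' n)" "\<xi> n * cnj (\<xi>' n)"] by (simp add: norm_mult e mult.commute)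
  finally have big: "A\<^sup>2 * D / 2 \<le> cmod (\<psi> n) * cmod (\<psi>' n)" by simp
  \<comment> \<open>The geometric mean of the two values at \<open>n\<close> is at least \<kappa>;
    the condition on \<tau> says that \<open>2 * A * \<tau>\<close> is at most
    \<open>D / 2 * \<kappa>\<close>.\<close>
  define \<kappa> where "\<kappa> = A * sqrt (D / 2)"
  have "\<kappa> * \<kappa> = A\<^sup>2 * (sqrt (D / 2) * sqrt (D / 2))" by (simp only: \<kappa>_def power2_eq_square mult_ac)
  also have "sqrt (D / 2) * sqrt (D / 2) = D / 2" using D(2) by (intro real_sqrt_mult_self[THEN trans]) simp
  finally have \<kappa>2: "\<kappa> * \<kappa> = A\<^sup>2 * D / 2" by simp
  have "\<kappa> > 0" using A D(2) by (simp add: \<kappa>_def)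
  note \<kappa> = this \<kappa>2
  have "\<kappa> \<le> cmod (\<psi> n) \<or> \<kappa> \<le> cmod (\<psi>' n)"
  proof (rule ccontr)
    assume "\<not> ?thesis"
    then have "cmod (\<psi> n) * cmod (\<psi>' n) < \<kappa> * \<kappa>" using \<kappa>(1) by (intro mult_strict_mono) auto
    then show False using big \<kappa> by simp
  qed
  then obtain \<theta> F F\<xi> where F: "\<theta> = 0 \<or> \<theta> = \<theta>0" "Sol F F\<xi>" "F m = cis \<theta> * v1" "F\<xi> m = v2" "\<kappa> \<le> cmod (F n)"
  proof
    assume "\<kappa> \<le> cmod (\<psi> n)"
    then show ?thesis using that[of 0 \<psi> \<xi>] f by simp
  next
    assume "\<kappa> \<le> cmod (\<psi>' n)"
    then show ?thesis using that[of \<theta>0 \<psi>' \<xi>'] f' by simp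
  qed
  have "cmod (F n - F\<xi> n * cnj (p\<xi> n)) = cmod (wronski F F\<xi> p p\<xi> n)"
    by (simp add: wronski_def ref)
  also have "\<dots> = cmod (F m * cnj (p m) - F\<xi> m * cnj (p\<xi> m))"
    unfolding cons[OF F(2) ref(1)] by (simp add: wronski_def)
  also have "\<dots> \<le> A * cmod (p m) + A * cmod (p\<xi> m)"
    using norm_triangle_ineq4[of "F m * cnj (p m)" "F\<xi> m * cnj (p\<xi> m)"] F(3,4) v(1) by (simp add: norm_mult A_def)
  also have "\<dots> \<le> A * \<tau> + A * \<tau>"
    using A ref by (intro add_mono mult_left_mono) auto
  also have "\<dots> = A * (4 * \<tau>) / 2" by simp
  also have "\<dots> \<le> A * (D * sqrt (D / 2)) / 2"
    using A D by (intro divide_right_mono mult_left_mono) auto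
  also have "\<dots> = D / 2 * \<kappa>" by (simp add: \<kappa>_def)
  also have "\<dots> \<le> D / 2 * cmod (F n)" using F(5) D by (intro mult_left_mono) auto
  finally have "cmod (F n - F\<xi> n * cnj (p\<xi> n)) \<le> D / 2 * cmod (F n)" .
  moreover have "cmod (F n) = cmod (F\<xi> n)" using eqmod[OF F(2)] F(3,4) v(1) by (simp add: norm_mult)
  moreover have "F n \<noteq> 0" using F(5) \<kappa>(1) by auto
  ultimately show ?thesis using that F by blast
qed

text \<open>A stretch of coefficients that carries a well-localized solution \<open>p\<close> is so sensitive to
  phase kicks that any direction on its left can be steered to any direction on its right.\<close>

lemma steering:
  assumes a: "\<And>j. cmod (a j) < 1" and d: "\<And>j. cmod (d j) = 1" and z: "cmod z = 1"
    and qn: "q \<le> n" "n \<le> q'"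
    and p: "\<And>i. q \<le> i \<Longrightarrow> i < q' \<Longrightarrow> step a d z p p\<xi> i" "p n = 1" "cmod (p\<xi> n) = 1"
    and small: "cmod (p q) \<le> \<tau>" "cmod (p\<xi> q) \<le> \<tau>" "cmod (p q') \<le> \<tau>" "cmod (p\<xi> q') \<le> \<tau>"
    and v: "cmod v1 = cmod v2" "v1 \<noteq> 0" and w: "cmod w1 = cmod w2" "w1 \<noteq> 0"
    and l: "0 < l" "l \<le> 1" "4 * \<tau> \<le> cmod (cis l - 1) * sqrt (cmod (cis l - 1) / 2)"
  obtains \<theta>1 \<theta>2 \<theta>3 F F\<xi> H H\<xi> C where "\<bar>\<theta>1\<bar> \<le> l" "\<bar>\<theta>2\<bar> \<le> l" "\<bar>\<theta>3\<bar> \<le> l"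
    "F q = cis \<theta>1 * v1" "F\<xi> q = v2" "\<And>i. q \<le> i \<Longrightarrow> i < n \<Longrightarrow> step a d z F F\<xi> i"
    "H n = cis \<theta>2 * F n" "H\<xi> n = F\<xi> n" "\<And>i. n \<le> i \<Longrightarrow> i < q' \<Longrightarrow> step a d z H H\<xi> i"
    "C * w1 = cis \<theta>3 * H q'" "C * w2 = H\<xi> q'"
proof -
  define D where "D = cmod (cis l - 1)"
  have z0: "z \<noteq> 0" using z by auto
  have d0: "d j \<noteq> 0" for j using d[of j] by auto
  have a': "cmod (a j) \<le> 1" for j using a[of j] by simp
  have "sin l > 0" using l pi_gt3 by (intro sin_gt_zero) auto
  then have "cis l \<noteq> 1" by (auto simp: complex_eq_iff)
  then have D: "D > 0" by (simp add: D_def)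
  have Dm: "D = cmod (cis (-l) - 1)"
    unfolding D_def by (metis cis_cnj complex_cnj_diff complex_cnj_one complex_mod_cnj)
  let ?L = "\<lambda>\<psi> \<xi>. \<forall>i. q \<le> i \<longrightarrow> i < n \<longrightarrow> step a d z \<psi> \<xi> i"
  let ?R = "\<lambda>\<psi> \<xi>. \<forall>i. n \<le> i \<longrightarrow> i < q' \<longrightarrow> step a d z \<psi> \<xi> i"
  obtain \<theta>1 F F\<xi> where F: "\<theta>1 = 0 \<or> \<theta>1 = l" "?L F F\<xi>" "F q = cis \<theta>1 * v1" "F\<xi> q = v2"
    "cmod (F n) = cmod (F\<xi> n)" "F n \<noteq> 0" "cmod (F n - F\<xi> n * cnj (p\<xi> n)) \<le> D / 2 * cmod (F n)"
  proof (rule trial_solution[where Sol="?L" and m=q and n=n and p=p and p\<xi>=p\<xi> and ?v1.0=v1 and ?v2.0=v2 and \<tau>=\<tau> and D=D and ?\<theta>0.0=l])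
    show "\<exists>\<psi> \<xi>. ?L \<psi> \<xi> \<and> \<psi> q = u \<and> \<xi> q = v" for u v
      using segment_forward[where a=a and d=d and z=z and u=u and v=v, OF a z0 d0 qn(1)] by blast
    show "cmod (wronski \<psi> \<xi> \<psi>' \<xi>' n) = cmod (wronski \<psi> \<xi> \<psi>' \<xi>' q)" if "?L \<psi> \<xi>" "?L \<psi>' \<xi>'" for \<psi> \<xi> \<psi>' \<xi>'
      using wronski_segment[where a=a and d=d and z=z and \<psi>=\<psi> and \<xi>=\<xi> and \<psi>'=\<psi>' and \<xi>'=\<xi>', OF qn(1) a' z d] that by blast
    show "?L p p\<xi>" using p(1) qn by auto
    show "4 * \<tau> \<le> D * sqrt (D / 2)" using l(3) by (simp add: D_def)
  qed (use p small v D in \<open>auto simp: D_def\<close>)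
  obtain \<theta>3 H H\<xi> where H: "\<theta>3 = 0 \<or> \<theta>3 = -l" "?R H H\<xi>" "H q' = cis \<theta>3 * w1" "H\<xi> q' = w2"
    "cmod (H n) = cmod (H\<xi> n)" "H n \<noteq> 0" "cmod (H n - H\<xi> n * cnj (p\<xi> n)) \<le> D / 2 * cmod (H n)"
  proof (rule trial_solution[where Sol="?R" and m=q' and n=n and p=p and p\<xi>=p\<xi> and ?v1.0=w1 and ?v2.0=w2 and \<tau>=\<tau> and D=D and ?\<theta>0.0="-l"])
    show "\<exists>\<psi> \<xi>. ?R \<psi> \<xi> \<and> \<psi> q' = u \<and> \<xi> q' = v" for u v
      using segment_backward[where a=a and d=d and z=z and u=u and v=v, OF a z0 d0 qn(2)] by blast
    show "cmod (wronski \<psi> \<xi> \<psi>' \<xi>' n) = cmod (wronski \<psi> \<xi> \<psi>' \<xi>' q')" if "?R \<psi> \<xi>" "?R \<psi>' \<xi>'" for \<psi> \<xi> \<psi>' \<xi>'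
      using wronski_segment[where a=a and d=d and z=z and \<psi>=\<psi> and \<xi>=\<xi> and \<psi>'=\<psi>' and \<xi>'=\<xi>', OF qn(2) a' z d] that by force
    show "?R p p\<xi>" using p(1) qn by auto
    show "4 * \<tau> \<le> D * sqrt (D / 2)" using l(3) by (simp add: D_def)
  qed (use p small w D Dm in auto)
  \<comment> \<open>The left and the right direction are each within \<open>D / 2\<close> of the
    direction of \<open>p\<close>, hence within \<open>D\<close>, the chord of angle
    \<open>l\<close>, of each other.\<close>
  have near: "cmod (1 - (G\<xi> / G) * cnj (p\<xi> n)) \<le> D / 2"
    if "G \<noteq> 0" "cmod (G - G\<xi> * cnj (p\<xi> n)) \<le> D / 2 * cmod G" for G G\<xi>
  proof -
    have "1 - (G\<xi> / G) * cnj (p\<xi> n) = (G - G\<xi> * cnj (p\<xi> n)) / G" using that by (simp add: field_simps)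
    then show ?thesis using that by (simp add: norm_divide field_simps)
  qed
  \<comment> \<open>The rotation carrying the right direction to the left one: a kick at
    \<open>n\<close> by its angle, with the scaling \<open>C\<close>, joins the two halves.\<close>
  define u where "u = (F\<xi> n / F n) / (H\<xi> n / H n)"
  have nz: "H\<xi> n \<noteq> 0" "F\<xi> n \<noteq> 0" using H F by (metis norm_eq_zero)+
  have u1: "cmod u = 1" using F H nz by (simp add: u_def norm_divide norm_mult)
  have "cmod ((F\<xi> n / F n) * cnj (p\<xi> n) - (H\<xi> n / H n) * cnj (p\<xi> n)) \<le> D / 2 + D / 2"
    using norm_triangle_mono[OF near[OF H(6,7)] near[OF F(6,7), unfolded norm_minus_commute[of 1]]]
    by (simp add: algebra_simps)
  moreover have "(F\<xi> n / F n) * cnj (p\<xi> n) - (H\<xi> n / H n) * cnj (p\<xi> n) = (u - 1) * (H\<xi> n / H n) * cnj (p\<xi> n)"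
    using nz F H by (simp add: u_def field_simps)
  ultimately have "cmod (u - 1) \<le> D"
    using H(5) nz p(3) by (simp add: norm_mult norm_divide)
  then obtain \<theta>2 where \<theta>2: "\<bar>\<theta>2\<bar> \<le> l" "u = cis \<theta>2"
    using cis_of_close[OF u1, of l] l pi_gt3 by (auto simp: D_def)
  define C where "C = cis \<theta>2 * F n / H n"
  show ?thesis
  proof (rule that[of \<theta>1 \<theta>2 "-\<theta>3" F F\<xi> "\<lambda>i. C * H i" "\<lambda>i. C * H\<xi> i" C])
    show "step a d z (\<lambda>i. C * H i) (\<lambda>i. C * H\<xi> i) i" if "n \<le> i" "i < q'" for i
      using H(2) that by (intro step_scale) auto
    show "C * H n = cis \<theta>2 * F n" using H(6) by (simp add: C_def)
    show "C * H\<xi> n = F\<xi> n" unfolding C_def \<theta>2(2)[symmetric] u_def using H(6) F(6) nz by (simp add: field_simps)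
    show "C * w1 = cis (- \<theta>3) * (C * H q')" unfolding H(3) by (simp add: cis_mult mult.left_commute flip: mult.assoc)
  qed (use F H \<theta>2 l in auto)
qed

text \<open>Even translations preserve the type of each block; this is why recurrence is demanded
  along even times.\<close>

lemma step_shift:
  assumes "even n"
  shows "step (\<lambda>j. a (j - n)) (\<lambda>j. d (j - n)) z (\<lambda>j. \<psi> (j - n)) (\<lambda>j. \<xi> (j - n)) j \<longleftrightarrow> step a d z \<psi> \<xi> (j - n)"
  using assms by (simp add: step_def rho_def algebra_simps)

text \<open>The diagonal form |\<psi>|^2 - |\<xi>|^2 has constant modulus and tends to zero.\<close>

lemma vanishing_equal_modulus:
  assumes a: "\<And>j. cmod (a j) \<le> 1" and d: "\<And>j. cmod (d j) = 1" and z: "cmod z = 1"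
    and s: "\<And>j. step a d z \<psi> \<xi> j" and v: "vanishes \<psi>"
  shows "cmod (\<psi> j) = cmod (\<xi> j)"
proof -
  have sq: "wronski \<psi> \<xi> \<psi> \<xi> i = complex_of_real ((cmod (\<psi> i))\<^sup>2 - (cmod (\<xi> i))\<^sup>2)" for i
    unfolding wronski_def of_real_diff complex_norm_square ..
  define h where "h k = max j 0 + int k" for k
  have h: "int k \<le> \<bar>h k\<bar>" "j \<le> h k" for k by (auto simp: h_def)
  have "(\<lambda>k. cmod (wronski \<psi> \<xi> \<psi> \<xi> (h k))) \<longlonglongrightarrow> cmod (0 * cnj 0 - 0 * cnj 0)"
    unfolding wronski_def by (intro tendsto_intros vanishes_tendsto[OF v h(1)] vanishes_tendsto[OF vanishes_xi[OF v s a] h(1)])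
  moreover have "cmod (wronski \<psi> \<xi> \<psi> \<xi> (h k)) = cmod (wronski \<psi> \<xi> \<psi> \<xi> j)" for k
    by (rule wronski_segment[OF h(2) a z d s s])
  ultimately have "cmod (wronski \<psi> \<xi> \<psi> \<xi> j) = 0" by (simp add: LIMSEQ_const_iff)
  then have "(cmod (\<psi> j))\<^sup>2 = (cmod (\<xi> j))\<^sup>2" unfolding sq norm_of_real by simp
  then show ?thesis by simp
qed

lemma segment_zero:
  assumes "\<And>j. cmod (a j) < 1" "z \<noteq> 0" "\<And>j. d j \<noteq> 0" "q \<le> k" "\<And>i. q \<le> i \<Longrightarrow> i < k \<Longrightarrow> step a d z \<psi> \<xi> i"
  shows "\<psi> k = 0 \<and> \<xi> k = 0 \<longleftrightarrow> \<psi> q = 0 \<and> \<xi> q = 0"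
  using assms(4,5)
proof (induction k rule: int_ge_induct)
  case base
  then show ?case by simp
next
  case (step i)
  then show ?case using step_zero_iff[of a i z d \<psi> \<xi>] assms(1-3) by simp
qed

context persistent
begin

text \<open>By recurrence a copy of the central stretch can be placed far to the right. Steering through
  it yields an \<open>\<ell>\<^sup>2\<close>-solution at \<open>z\<close> for the kick \<open>2 l\<close> at the origin, whereas the same far
  coefficients admit one for a kick of size at most \<open>l\<close>; the form identity rules this out.\<close>

theorem not_recurrent:
  assumes rec: "\<And>J \<eta>. \<eta> > 0 \<Longrightarrow> \<exists>n. even n \<and> n \<ge> int J \<and> (\<forall>j. \<bar>j\<bar> \<le> int J \<longrightarrow> cmod (g (j + n) - g j) \<le> \<eta>)"
  shows False
proof -
  obtain c s K l z M where sl: "s > 0" "0 < l" "8 * l \<le> s" "l \<le> 1/8" "s < f" and z: "cmod z = 1"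
    and c: "\<And>j. cmod (fst (c j) - g j) \<le> e - s" "\<And>j. \<bar>snd (c j)\<bar> \<le> f - s"
    and exc: "\<exists>\<psi> \<xi>. normalized_solution c z \<psi> \<xi> \<and> (\<forall>n. mass \<psi> n \<le> M)"
    and ex: "\<And>x. x \<in> B \<Longrightarrow> (\<And>j. \<bar>j\<bar> \<le> int K \<Longrightarrow> x j = c j) \<Longrightarrow> (\<And>j. \<bar>snd (x j)\<bar> \<le> f - l) \<Longrightarrow>
       \<exists>\<theta> \<psi> \<xi>. \<bar>\<theta>\<bar> \<le> l \<and> normalized_solution (rot \<theta> x) z \<psi> \<xi> \<and> (\<forall>n. mass \<psi> n \<le> M)"
    by (rule exists_common_eigenvalue) blast
  have z0: "z \<noteq> 0" using z by auto
  have cB: "c \<in> B" using c sl(1) unfolding B_def mem_Collect_eq by (smt (verit))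
  obtain \<psi>c \<xi>c where nc: "normalized_solution c z \<psi>c \<xi>c" and mc: "\<And>n. mass \<psi>c n \<le> M" using exc by blast
  have sc: "\<And>j. step (amp c) (site_phase c) z \<psi>c \<xi>c j" "\<psi>c 0 = 1" using nc by (auto simp: normalized_solution_def)
  have vc: "vanishes \<psi>c" by (rule vanishes_mass[OF mc])
  have uc: "cmod (\<psi>c j) = cmod (\<xi>c j)" for j
    by (rule vanishing_equal_modulus[OF amp_le_1[OF cB] _ z sc(1) vc]) simp
  define D where "D = cmod (cis l - 1)"
  have sinp: "sin t > 0" if "0 < t" "t < 1" for t :: real
    using that pi_gt3 by (intro sin_gt_zero) auto
  have "cis l \<noteq> 1" using sinp[of l] sl by (auto simp: complex_eq_iff)
  then have D: "D > 0" by (simp add: D_def)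
  \<comment> \<open>Chosen to give equality in the smallness condition of
    \<open>steering\<close>.\<close>
  define \<tau> where "\<tau> = D * sqrt (D / 2) / 4"
  have "\<tau> > 0" using D by (simp add: \<tau>_def)
  then obtain J where J: "\<And>j. J \<le> \<bar>j\<bar> \<Longrightarrow> cmod (\<psi>c j) < \<tau>" using vc unfolding vanishes_def by blast
  define R where "R = 2 * (\<bar>J\<bar> + 1)"
  have R: "even R" "R > 0" "cmod (\<psi>c R) \<le> \<tau>" "cmod (\<psi>c (-R)) \<le> \<tau>"
    using J[of R] J[of "-R"] by (auto simp: R_def less_imp_le)
  \<comment> \<open>The copy must lie to the right of \<open>K\<close> and include one extra site.
    The error \<open>s\<close> fits since \<open>c\<close> stays within \<open>e - s\<close> of
    \<open>g\<close>.\<close>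
  obtain n where n: "even n" "n \<ge> int (K + nat R + 5)" "\<And>j. \<bar>j\<bar> \<le> int (K + nat R + 5) \<Longrightarrow> cmod (g (j + n) - g j) \<le> s"
    using rec[OF sl(1)] by blast
  define q where "q = n - R"
  define q' where "q' = n + R"
  have qq: "even q" "even q'" "int K + 5 \<le> q" "q < n" "n < q'" "q > 0" using n R by (auto simp: q_def q'_def)
  \<comment> \<open>The copy starts at \<open>q - 1\<close> because the site phase at
    \<open>q\<close> involves the phase there. The last block before \<open>q'\<close> is odd, so
    the site phase at \<open>q'\<close> need not be copied.\<close>
  define x1 where "x1 j = (if q - 1 \<le> j \<and> j < q' then c (j - n) else c j)" for j
  have x1c: "x1 j = c j" if "\<bar>j\<bar> \<le> int K" for j using that qq by (auto simp: x1_def)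
  have fx1: "cmod (fst (x1 j) - g j) \<le> e" for j
  proof (cases "q - 1 \<le> j \<and> j < q'")
    case True
    then have "\<bar>j - n\<bar> \<le> int (K + nat R + 5)" using R by (auto simp: q_def q'_def)
    from n(3)[OF this] have "cmod (g (j - n) - g j) \<le> s" by (simp add: norm_minus_commute)
    then show ?thesis using True c(1)[of "j - n"] norm_triangle_ineq[of "fst (c (j - n)) - g (j - n)" "g (j - n) - g j"]
      by (simp add: x1_def)
  next
    case False
    then have "x1 j = c j" by (auto simp: x1_def)
    then show ?thesis using c(1)[of j] sl(1) by simp
  qed
  have sx1: "\<bar>snd (x1 j)\<bar> \<le> f - s" for j using c(2) by (simp add: x1_def)
  have "x1 \<in> B" unfolding B_def mem_Collect_eq using fx1 sx1 sl(1) by (smt (verit))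
  moreover have "\<bar>snd (x1 j)\<bar> \<le> f - l" for j using sx1[of j] sl by linarith
  ultimately obtain \<theta>1 \<psi>1 \<xi>1 where n1: "normalized_solution (rot \<theta>1 x1) z \<psi>1 \<xi>1" and m1: "\<And>n. mass \<psi>1 n \<le> M"
    using ex[of x1] x1c by blast
  define a where "a = amp x1"
  define d where "d = site_phase x1"
  have a: "cmod (a j) < 1" for j unfolding a_def by (rule amp_less_1[OF \<open>x1 \<in> B\<close>])
  have a': "cmod (a j) \<le> 1" for j using a[of j] by simp
  have d: "cmod (d j) = 1" "d j \<noteq> 0" for j by (auto simp: d_def)
  have s1: "step a (d(0 := cis \<theta>1 * d 0)) z \<psi>1 \<xi>1 j" for j
    using n1 by (simp add: normalized_solution_def a_def d_def site_phase_kick)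
  have s1': "step a d z \<psi>1 \<xi>1 j" if "j \<noteq> 0" for j
    using s1[of j] that by (subst step_cong[of a j a d "d(0 := cis \<theta>1 * d 0)"]) auto
  have v1: "vanishes \<psi>1" by (rule vanishes_mass[OF m1])
  have u1: "cmod (\<psi>1 j) = cmod (\<xi>1 j)" for j
    by (rule vanishing_equal_modulus[where a=a and d="d(0 := cis \<theta>1 * d 0)" and z=z, OF a' _ z s1 v1]) (simp add: norm_mult d)
  have p10: "\<psi>1 0 = 1" using n1 by (simp add: normalized_solution_def)
  \<comment> \<open>The left tail of \<psi>1 is continued with a kick outside the tuning range
    \<open>[-l, l]\<close>; it differs from every tuned kick by at least \<open>l\<close>.\<close>
  obtain f0 f0\<xi> where f0: "f0 0 = cis (2 * l) * \<psi>1 0" "f0\<xi> 0 = \<xi>1 0" "\<And>i. 0 \<le> i \<Longrightarrow> i < q \<Longrightarrow> step a d z f0 f0\<xi> i"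
    using segment_forward[where a=a and d=d and z=z and q=0 and k=q, OF a z0 d(2) less_imp_le[OF qq(6)],
        of "cis (2 * l) * \<psi>1 0" "\<xi>1 0"] by blast
  have f0m: "cmod (f0 q) = cmod (f0\<xi> q)"
  proof -
    have sq: "wronski f0 f0\<xi> f0 f0\<xi> i = complex_of_real ((cmod (f0 i))\<^sup>2 - (cmod (f0\<xi> i))\<^sup>2)" for i
      unfolding wronski_def of_real_diff complex_norm_square ..
    have "cmod (wronski f0 f0\<xi> f0 f0\<xi> q) = cmod (wronski f0 f0\<xi> f0 f0\<xi> 0)"
      by (rule wronski_segment[where a=a and d=d and z=z, OF less_imp_le[OF qq(6)] a' z d(1) f0(3) f0(3)])
    also have "\<dots> = 0" unfolding sq using f0 u1[of 0] by (simp add: norm_mult)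
    finally have "(cmod (f0 q))\<^sup>2 = (cmod (f0\<xi> q))\<^sup>2" unfolding sq norm_of_real by simp
    then show ?thesis by simp
  qed
  have f0nz: "f0 q \<noteq> 0"
  proof
    assume "f0 q = 0"
    then have "f0 q = 0 \<and> f0\<xi> q = 0" using f0m by simp
    then have "f0 0 = 0"
      using segment_zero[where a=a and d=d and z=z and q=0 and k=q and \<psi>=f0 and \<xi>=f0\<xi>, OF a z0 d(2) less_imp_le[OF qq(6)] f0(3)] by blast
    then show False using f0(1) p10 by simp
  qed
  have p1nz: "\<psi>1 q' \<noteq> 0"
  proof
    assume "\<psi>1 q' = 0"
    then have "\<psi>1 q' = 0 \<and> \<xi>1 q' = 0" using u1[of q'] by simp
    moreover have "(d(0 := cis \<theta>1 * d 0)) j \<noteq> 0" for j using d(2) by simp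
    ultimately have "\<psi>1 0 = 0"
      using segment_zero[where a=a and z=z and d="d(0 := cis \<theta>1 * d 0)" and q=0 and k=q' and \<psi>=\<psi>1 and \<xi>=\<xi>1, OF a z0 _ _ s1] qq
      by (smt (verit))
    then show False using p10 by simp
  qed
  have pst: "step a d z (\<lambda>j. \<psi>c (j - n)) (\<lambda>j. \<xi>c (j - n)) i" if "q \<le> i" "i < q'" for i
  proof -
    have "step (\<lambda>j. amp c (j - n)) (\<lambda>j. site_phase c (j - n)) z (\<lambda>j. \<psi>c (j - n)) (\<lambda>j. \<xi>c (j - n)) i"
      using step_shift[OF n(1)] sc(1) by blast
    moreover have "a i = amp c (i - n)" using that by (simp add: a_def amp_def x1_def)
    moreover have "d i = site_phase c (i - n)" using that by (simp add: d_def site_phase_def x1_def algebra_simps)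
    moreover have "d (i + 1) = site_phase c (i + 1 - n)" if "even i"
    proof -
      have "i + 1 < q'" using that \<open>i < q'\<close> qq(2) by (metis add.commute even_plus_one_iff order_le_imp_less_or_eq zless_imp_add1_zle)
      then show ?thesis using \<open>q \<le> i\<close> by (simp add: d_def site_phase_def x1_def algebra_simps)
    qed
    ultimately show ?thesis
      by (subst step_cong[of a i "\<lambda>j. amp c (j - n)" d "\<lambda>j. site_phase c (j - n)"]) auto
  qed
  obtain \<theta>a \<theta>b \<theta>c F F\<xi> H H\<xi> C where th: "\<bar>\<theta>a\<bar> \<le> l" "\<bar>\<theta>b\<bar> \<le> l" "\<bar>\<theta>c\<bar> \<le> l"
    and F: "F q = cis \<theta>a * f0 q" "F\<xi> q = f0\<xi> q" "\<And>i. q \<le> i \<Longrightarrow> i < n \<Longrightarrow> step a d z F F\<xi> i"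
    and H: "H n = cis \<theta>b * F n" "H\<xi> n = F\<xi> n" "\<And>i. n \<le> i \<Longrightarrow> i < q' \<Longrightarrow> step a d z H H\<xi> i"
    and C: "C * \<psi>1 q' = cis \<theta>c * H q'" "C * \<xi>1 q' = H\<xi> q'"
  proof (rule steering[OF a d(1) z less_imp_le[OF qq(4)] less_imp_le[OF qq(5)] pst _ _ _ _ _ _ f0m f0nz u1 p1nz sl(2)])
    show "4 * \<tau> \<le> cmod (cis l - 1) * sqrt (cmod (cis l - 1) / 2)" by (simp add: \<tau>_def D_def)
    show "\<psi>c (n - n) = 1" "cmod (\<xi>c (n - n)) = 1" using sc(2) uc[of 0] by auto
  qed (use R uc sl in \<open>auto simp: q_def q'_def\<close>)
  \<comment> \<open>Four gluings, at the even sites 0, \<open>q\<close>, \<open>n\<close> and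
    \<open>q'\<close>: the left tail of \<psi>1, then \<open>f0\<close>, \<open>F\<close>,
    \<open>H\<close>, and a multiple of the right tail of \<psi>1.\<close>
  define d2 where "d2 = d(0 := cis (2 * l) * d 0)"
  define P2 where "P2 j = (if j \<le> 0 then \<psi>1 j else f0 j)" for j
  define X2 where "X2 j = (if j \<le> 0 then \<xi>1 j else f0\<xi> j)" for j
  have s2: "step a d2 z P2 X2 i" if "i < q" for i
    unfolding d2_def P2_def X2_def
    by (rule solution_glue[where A="{..<q}"]) (use s1' f0 that in auto)
  have at_q: "P2 q = f0 q" "X2 q = f0\<xi> q" using qq by (auto simp: P2_def X2_def)
  define d3 where "d3 = d2(q := cis \<theta>a * d2 q)"
  define P3 where "P3 j = (if j \<le> q then P2 j else F j)" for j
  define X3 where "X3 j = (if j \<le> q then X2 j else F\<xi> j)" for j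
  have F2: "step a d2 z F F\<xi> i" if "q \<le> i" "i < n" for i
    using F(3)[OF that] that qq(6) by (subst step_cong[of a i a d2 d]) (auto simp: d2_def)
  have s3: "step a d3 z P3 X3 i" if "i < n" for i
    unfolding d3_def P3_def X3_def
    by (rule solution_glue[where A="{..<n}"]) (use s2 F2 F qq that at_q in auto)
  have at_n: "P3 n = F n" "X3 n = F\<xi> n" using qq by (auto simp: P3_def X3_def)
  define d4 where "d4 = d3(n := cis \<theta>b * d3 n)"
  define P4 where "P4 j = (if j \<le> n then P3 j else H j)" for j
  define X4 where "X4 j = (if j \<le> n then X3 j else H\<xi> j)" for j
  have H2: "step a d3 z H H\<xi> i" if "n \<le> i" "i < q'" for i
    using H(3)[OF that] that qq by (subst step_cong[of a i a d3 d]) (auto simp: d2_def d3_def)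
  have s4: "step a d4 z P4 X4 i" if "i < q'" for i
    unfolding d4_def P4_def X4_def
    by (rule solution_glue[where A="{..<q'}"]) (use s3 H2 H qq n(1) that at_n in auto)
  have at_q': "P4 q' = H q'" "X4 q' = H\<xi> q'" using qq by (auto simp: P4_def X4_def)
  define d5 where "d5 = d4(q' := cis \<theta>c * d4 q')"
  define P5 where "P5 j = (if j \<le> q' then P4 j else C * \<psi>1 j)" for j
  define X5 where "X5 j = (if j \<le> q' then X4 j else C * \<xi>1 j)" for j
  have T2: "step a d4 z (\<lambda>j. C * \<psi>1 j) (\<lambda>j. C * \<xi>1 j) i" if "q' \<le> i" for i
    using step_scale[OF s1'[of i], of C] that qq by (subst step_cong[of a i a d4 d]) (auto simp: d2_def d3_def d4_def)
  have s5: "step a d5 z P5 X5 i" for i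
    unfolding d5_def P5_def X5_def
    by (rule solution_glue[where A=UNIV]) (use s4 T2 C qq at_q' in auto)
  have P50: "P5 0 = 1" using qq p10 by (simp add: P5_def P4_def P3_def P2_def)
  have v5: "vanishes P5"
    unfolding vanishes_def
  proof (intro allI impI)
    fix \<epsilon> :: real assume \<epsilon>: "\<epsilon> > 0"
    define \<delta> where "\<delta> = \<epsilon> / (cmod C + 1)"
    have \<delta>: "\<delta> > 0" "\<delta> * (cmod C + 1) = \<epsilon>" using \<epsilon> by (auto simp: \<delta>_def add_nonneg_pos add_nonneg_eq_0_iff)
    obtain J where J: "\<And>j. J \<le> \<bar>j\<bar> \<Longrightarrow> cmod (\<psi>1 j) < \<delta>" using v1 \<delta>(1) unfolding vanishes_def by blast
    have "cmod (P5 j) < \<epsilon>" if "max J (q' + 1) \<le> \<bar>j\<bar>" for j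
    proof -
      have b: "cmod (\<psi>1 j) < \<delta>" using J that by simp
      have "cmod (\<psi>1 j) * 1 \<le> cmod (\<psi>1 j) * (cmod C + 1)" by (intro mult_left_mono) auto
      moreover have "cmod (\<psi>1 j) * cmod C \<le> cmod (\<psi>1 j) * (cmod C + 1)" by (intro mult_left_mono) auto
      moreover have "cmod (\<psi>1 j) * (cmod C + 1) < \<delta> * (cmod C + 1)"
        using b by (intro mult_strict_right_mono) (auto simp: add_nonneg_pos)
      moreover have "P5 j = \<psi>1 j \<or> P5 j = C * \<psi>1 j"
        using that qq by (auto simp: P5_def P4_def P3_def P2_def)
      ultimately show ?thesis using \<delta>(2) by (auto simp: norm_mult mult.commute)
    qed
    then show "\<exists>J. \<forall>j. J \<le> \<bar>j\<bar> \<longrightarrow> cmod (P5 j) < \<epsilon>" by blast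
  qed
  \<comment> \<open>The same kicks without the one at the origin. Tuning supplies a kick there for
    the same \<open>z\<close>, so the two systems of site phases differ at 0 only.\<close>
  define x2 where "x2 = kick q' \<theta>c (kick n \<theta>b (kick q \<theta>a x1))"
  have x2c: "x2 j = c j" if "\<bar>j\<bar> \<le> int K" for j 
  proof -
    have "j < q" using that qq by linarith
    then show ?thesis using x1c[OF that] qq by (simp add: x2_def kick_def)
  qed
  have sx2: "\<bar>snd (x2 j)\<bar> \<le> f - l" for j
  proof -
    define A where "A = (if q \<le> j then \<theta>a else 0)"
    define A' where "A' = (if n \<le> j then \<theta>b else 0)"
    define A'' where "A'' = (if q' \<le> j then \<theta>c else 0)"
    have "\<bar>A\<bar> \<le> l" "\<bar>A'\<bar> \<le> l" "\<bar>A''\<bar> \<le> l" using th sl by (auto simp: A_def A'_def A''_def)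
    moreover have "snd (x2 j) = snd (x1 j) + A + A' + A''" by (simp add: x2_def kick_def A_def A'_def A''_def)
    ultimately show ?thesis using sx1[of j] sl by linarith
  qed
  have fst2: "fst (x2 j) = fst (x1 j)" for j by (simp add: x2_def kick_def)
  have "x2 \<in> B" unfolding B_def mem_Collect_eq
    using fx1 sx2 sl(2) fst2 by (smt (verit))
  then obtain \<theta>3 \<psi>3 \<xi>3 where t3: "\<bar>\<theta>3\<bar> \<le> l" and n3: "normalized_solution (rot \<theta>3 x2) z \<psi>3 \<xi>3" and m3: "\<And>n. mass \<psi>3 n \<le> M"
    using ex[of x2] x2c sx2 by blast
  define d' where "d' = site_phase (rot \<theta>3 x2)"
  have d': "cmod (d' j) = 1" for j by (simp add: d'_def)
  have s3': "step a d' z \<psi>3 \<xi>3 j" for j using n3 by (simp add: normalized_solution_def a_def d'_def x2_def)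
  have d5u: "cmod (d5 j) = 1" for j by (auto simp: d5_def d4_def d3_def d2_def norm_mult d)
  have dd: "d5 j = (if j = 0 then cis (2 * l - \<theta>3) else 1) * d' j" for j
  proof -
    have "d' = ((d(q := cis \<theta>a * d q))(n := cis \<theta>b * d n))(q' := cis \<theta>c * d q', 0 := cis \<theta>3 * d 0)"
      using qq by (simp add: d'_def x2_def site_phase_kick d_def)
    then show ?thesis using qq by (auto simp: d5_def d4_def d3_def d2_def cis_mult simp flip: mult.assoc)
  qed
  \<comment> \<open>Every term except \<open>j = 0\<close> is zero, which forces
    \<open>cis (2 * l - \<theta>3) = 1\<close> for an angle strictly between 0 and 1.\<close>
  have "(\<lambda>k. \<Sum>j\<in>window k. (1 - z * d5 j * cnj (z * d' j)) * (P5 j * cnj (\<psi>3 j))) \<longlonglongrightarrow> 0"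
    by (rule form_limit[OF a' d5u d' s5 s3' v5 vanishes_mass[OF m3]])
  moreover have "(\<Sum>j\<in>window k. (1 - z * d5 j * cnj (z * d' j)) * (P5 j * cnj (\<psi>3 j))) = 1 - cis (2 * l - \<theta>3)"
    if "k \<ge> 1" for k
  proof -
    have w: "z * d5 j * cnj (z * d' j) = (if j = 0 then cis (2 * l - \<theta>3) else 1)" for j
    proof -
      have "z * d5 j * cnj (z * d' j) = (z * cnj z) * (d' j * cnj (d' j)) * (if j = 0 then cis (2 * l - \<theta>3) else 1)"
        unfolding dd by simp
      then show ?thesis using unit_mult_cnj[OF z] unit_mult_cnj[OF d'] by simp
    qed
    have "(\<Sum>j\<in>window k. (1 - z * d5 j * cnj (z * d' j)) * (P5 j * cnj (\<psi>3 j))) =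
       (\<Sum>j\<in>window k. if j = 0 then 1 - cis (2 * l - \<theta>3) else 0)"
      unfolding w using P50 n3 by (intro sum.cong) (auto simp: normalized_solution_def)
    also have "\<dots> = 1 - cis (2 * l - \<theta>3)" using that by (simp add: window_def)
    finally show ?thesis .
  qed
  then have "\<forall>\<^sub>F k in sequentially. (\<Sum>j\<in>window k. (1 - z * d5 j * cnj (z * d' j)) * (P5 j * cnj (\<psi>3 j))) = 1 - cis (2 * l - \<theta>3)"
    by (rule eventually_sequentiallyI)
  ultimately have "(\<lambda>k::nat. 1 - cis (2 * l - \<theta>3)) \<longlonglongrightarrow> 0" by (simp add: filterlim_cong)
  then have "cis (2 * l - \<theta>3) = 1" by (simp add: LIMSEQ_const_iff)
  then have "sin (2 * l - \<theta>3) = 0" by (simp add: complex_eq_iff)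
  moreover have "0 < 2 * l - \<theta>3" "2 * l - \<theta>3 < 1" using t3 sl by linarith+
  ultimately show False using sinp[of "2 * l - \<theta>3"] by simp
qed

end

section \<open>From sequences to sampling functions\<close>

lemma int_primitive:
  fixes h :: "int \<Rightarrow> real"
  obtains V where "V (-1) = 0" "\<And>j. V (j + 1) = V j + h j"
proof -
  define V where "V j = (\<Sum>i\<in>{-1..<j}. h i) - (\<Sum>i\<in>{j..<-1}. h i)" for j
  have "V (j + 1) = V j + h j" for j
  proof (cases "j \<ge> -1")
    case True
    then have "{-1..<j + 1} = insert j {-1..<j}" by auto
    then show ?thesis using True by (simp add: V_def)
  next
    case False
    then have "{j..<-1} = insert j {j+1..<-1}" by auto
    then show ?thesis using False by (simp add: V_def)
  qed
  then show ?thesis using that[of V] by (simp add: V_def)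
qed

text \<open>Multiplying the coefficients by slowly varying phases amounts, up to a diagonal change of
  gauge, to inserting the phases \<open>cis (\<phi> j - \<phi> (j - 1))\<close> at the sites.\<close>

lemma gauge:
  assumes "normalized_solution (\<lambda>j. (cis (snd (x j)) * fst (x j), 0)) z \<psi> \<xi>"
  obtains \<psi>' \<xi>' where "normalized_solution x z \<psi>' \<xi>'" "\<And>j. cmod (\<psi>' j) = cmod (\<psi> j)"
proof -
  define \<phi> where "\<phi> j = snd (x j)" for j
  \<comment> \<open>The alternating signs are dictated by the blocks, and the normalization at -1
    makes \<open>u 0 = v (-1) = 1\<close>, preserving \<psi> 0 = 1.\<close>
  obtain V where V: "V (-1) = 0" "\<And>j. V (j + 1) = V j + (if even j then \<phi> j else - \<phi> j)"
    by (rule int_primitive[of "\<lambda>j. if even j then \<phi> j else - \<phi> j"]) (rule that)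
  define v where "v j = cis (V j)" for j
  \<comment> \<open>Within an odd block \<psi> at each site takes the gauge that \<xi> has at the
    other; in the even blocks the mismatch is then exactly a site phase.\<close>
  define u where "u j = (if even j then v (j - 1) else v (j + 1))" for j
  let ?a = "\<lambda>j. cis (\<phi> j) * amp x j"
  have rho: "rho ?a j = rho (amp x) j" for j by (simp add: rho_def norm_mult)
  have st: "step ?a (\<lambda>j. 1) z \<psi> \<xi> j" for j
  proof -
    have "amp (\<lambda>j. (cis (snd (x j)) * fst (x j), 0)) = ?a" "site_phase (\<lambda>j. (cis (snd (x j)) * fst (x j), 0)) = (\<lambda>j. 1)"
      by (auto simp: amp_def site_phase_def \<phi>_def fun_eq_iff)
    then show ?thesis using assms by (simp add: normalized_solution_def)
  qed
  have vodd: "v j * cnj (cis (\<phi> j)) = v (j + 1)" "v (j + 1) * cis (\<phi> j) = v j" if "odd j" for j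
    using that V(2)[of j] by (auto simp: v_def cis_cnj cis_mult)
  have veven: "v (j + 1) * cnj (cis (\<phi> j)) = v j" "v j * cis (\<phi> j) = v (j + 1)" if "even j" for j
    using that V(2)[of j] by (auto simp: v_def cis_cnj cis_mult)
  have "step (amp x) (site_phase x) z (\<lambda>j. u j * \<psi> j) (\<lambda>j. v j * \<xi> j) j" for j
  proof (cases "odd j")
    case True
    have e: "\<xi> j = cnj (?a j) * \<psi> j + rho (amp x) j * \<psi> (j + 1)" "\<xi> (j + 1) = rho (amp x) j * \<psi> j - ?a j * \<psi> (j + 1)"
      using st[of j] True by (auto simp: step_def rho)
    have uu: "u j = v (j + 1)" "u (j + 1) = v j" using True by (auto simp: u_def)
    have "v j * \<xi> j = (v j * cnj (cis (\<phi> j))) * (cnj (amp x j) * \<psi> j) + rho (amp x) j * (v j * \<psi> (j + 1))"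
      unfolding e by (simp add: algebra_simps)
    moreover have "v (j + 1) * \<xi> (j + 1) = rho (amp x) j * (v (j + 1) * \<psi> j) - (v (j + 1) * cis (\<phi> j)) * (amp x j * \<psi> (j + 1))"
      unfolding e by (simp add: algebra_simps)
    ultimately have "v j * \<xi> j = cnj (amp x j) * (u j * \<psi> j) + rho (amp x) j * (u (j + 1) * \<psi> (j + 1))"
      "v (j + 1) * \<xi> (j + 1) = rho (amp x) j * (u j * \<psi> j) - amp x j * (u (j + 1) * \<psi> (j + 1))"
      unfolding vodd[OF True] uu by (simp_all add: mult_ac)
    then show ?thesis using True by (simp add: step_def)
  next
    case False
    have e: "z * \<psi> j = cnj (?a j) * \<xi> j + rho (amp x) j * \<xi> (j + 1)" "z * \<psi> (j + 1) = rho (amp x) j * \<xi> j - ?a j * \<xi> (j + 1)"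
      using st[of j] False by (auto simp: step_def rho)
    have "V j = V (j - 1) - \<phi> (j - 1)" using V(2)[of "j - 1"] False by simp
    moreover have Vj: "V (j + 1) = V j + \<phi> j" using V(2)[of j] False by simp
    moreover have "V (j + 2) = V (j + 1) - \<phi> (j + 1)" using V(2)[of "j + 1"] False by (simp add: add.assoc)
    ultimately have e1: "\<phi> j - \<phi> (j - 1) + V (j - 1) = V (j + 1)" and e2: "\<phi> (j + 1) - \<phi> j + V (j + 2) = V j"
      by linarith+
    have "site_phase x j * u j = cis (\<phi> j - \<phi> (j - 1) + V (j - 1))"
      using False by (simp add: u_def v_def site_phase_def cis_mult \<phi>_def)
    then have du1: "site_phase x j * u j = v (j + 1)" unfolding e1 by (simp add: v_def)
    have "site_phase x (j + 1) * u (j + 1) = cis (\<phi> (j + 1) - \<phi> j + V (j + 2))"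
      using False by (simp add: u_def v_def site_phase_def cis_mult \<phi>_def add.assoc)
    then have "site_phase x (j + 1) * u (j + 1) = v j" unfolding e2 by (simp add: v_def)
    note du = du1 this
    have "z * site_phase x j * (u j * \<psi> j) = v (j + 1) * (z * \<psi> j)" unfolding du(1)[symmetric] by simp
    also have "\<dots> = (v (j + 1) * cnj (cis (\<phi> j))) * (cnj (amp x j) * \<xi> j) + rho (amp x) j * (v (j + 1) * \<xi> (j + 1))"
      unfolding e by (simp add: algebra_simps)
    finally have 1: "z * site_phase x j * (u j * \<psi> j) = cnj (amp x j) * (v j * \<xi> j) + rho (amp x) j * (v (j + 1) * \<xi> (j + 1))"
      using veven(1)[of j] False by (simp add: mult_ac)
    have "z * site_phase x (j + 1) * (u (j + 1) * \<psi> (j + 1)) = v j * (z * \<psi> (j + 1))" unfolding du(2)[symmetric] by simp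
    also have "\<dots> = rho (amp x) j * (v j * \<xi> j) - (v j * cis (\<phi> j)) * (amp x j * \<xi> (j + 1))"
      unfolding e by (simp add: algebra_simps)
    also have "v j * cis (\<phi> j) = v (j + 1)" using veven(2)[of j] False by simp
    finally have 2: "z * site_phase x (j + 1) * (u (j + 1) * \<psi> (j + 1)) = rho (amp x) j * (v j * \<xi> j) - amp x j * (v (j + 1) * \<xi> (j + 1))"
      by (simp add: mult_ac)
    show ?thesis using False 1 2 by (simp add: step_def)
  qed
  moreover have "u 0 = 1" using V(1) by (simp add: u_def v_def)
  ultimately have "normalized_solution x z (\<lambda>j. u j * \<psi> j) (\<lambda>j. v j * \<xi> j)" using assms by (simp add: normalized_solution_def)
  moreover have "cmod (u j * \<psi> j) = cmod (\<psi> j)" for j by (simp add: norm_mult u_def v_def)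
  ultimately show ?thesis using that by blast
qed

corollary localized_gauge:
  assumes "localized (\<lambda>j. (cis (snd (x j)) * fst (x j), 0)) N"
  shows "localized x N"
proof -
  obtain z \<psi> \<xi> where s: "normalized_solution (\<lambda>j. (cis (snd (x j)) * fst (x j), 0)) z \<psi> \<xi>" "\<And>n. mass \<psi> n \<le> N"
    using assms unfolding localized_def by blast
  obtain \<psi>' \<xi>' where s': "normalized_solution x z \<psi>' \<xi>'" "\<And>j. cmod (\<psi>' j) = cmod (\<psi> j)"
    by (rule gauge[OF s(1)]) (rule that)
  have "mass \<psi>' n \<le> N" for n using s(2)[of n] s'(2) by (simp add: mass_def)
  then show ?thesis using s'(1) unfolding localized_def by blast
qed

text \<open>The row grouped along \<open>L M\<close>: the two brackets are the components of
  \<open>M \<psi>\<close> at \<open>2 * m\<close> and \<open>2 * m + 1\<close>.\<close>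

lemma cmv_even:
  "cmv \<alpha> \<psi> (2 * m) = cnj (\<alpha> (2*m)) * (rho \<alpha> (2*m-1) * \<psi> (2*m-1) - \<alpha> (2*m-1) * \<psi> (2*m))
     + rho \<alpha> (2*m) * (cnj (\<alpha> (2*m+1)) * \<psi> (2*m+1) + rho \<alpha> (2*m+1) * \<psi> (2*m+2))"
proof -
  have "cmv \<alpha> \<psi> (2 * m) = infsum (\<lambda>k. cmv_entry \<alpha> (2*m) k * \<psi> k) {2*m-1, 2*m, 2*m+1, 2*m+2}"
    unfolding cmv_def by (rule infsum_cong_neutral) (auto simp: cmv_entry_def)
  then show ?thesis by (simp add: cmv_entry_def algebra_simps)
qed

lemma cmv_odd:
  "cmv \<alpha> \<psi> (2 * m + 1) = rho \<alpha> (2*m) * (rho \<alpha> (2*m-1) * \<psi> (2*m-1) - \<alpha> (2*m-1) * \<psi> (2*m))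
     - \<alpha> (2*m) * (cnj (\<alpha> (2*m+1)) * \<psi> (2*m+1) + rho \<alpha> (2*m+1) * \<psi> (2*m+2))"
proof -
  have "cmv \<alpha> \<psi> (2 * m + 1) = infsum (\<lambda>k. cmv_entry \<alpha> (2*m+1) k * \<psi> k) {2*m-1, 2*m, 2*m+1, 2*m+2}"
    unfolding cmv_def by (rule infsum_cong_neutral) (auto simp: cmv_entry_def)
  moreover have "2 * m + 1 \<noteq> 2 * ((2 * m + 1) div 2)" by presburger
  ultimately show ?thesis by (simp add: cmv_entry_def algebra_simps)
qed

text \<open>An eigenvector can be normalized at the origin: if \<psi> vanished there, so would \<xi>
  by equality of moduli, and then everything. Integral bounds \<open>N\<close> make the later union
  of exceptional sets countable.\<close>

lemma eigenvector_localized: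
  assumes \<alpha>: "\<And>j. cmod (\<alpha> j) < 1" and "point_spectrum (cmv \<alpha>) \<noteq> {}"
  shows "\<exists>N::nat. localized (\<lambda>j. (\<alpha> j, 0)) (real N)"
proof -
  obtain z \<psi> where \<psi>: "\<psi> \<in> ell2" "\<psi> \<noteq> (\<lambda>n. 0)" and ev: "cmv \<alpha> \<psi> = (\<lambda>n. z * \<psi> n)"
    using assms(2) unfolding point_spectrum_def by blast
  define \<xi> where "\<xi> j = (if odd j then cnj (\<alpha> j) * \<psi> j + rho \<alpha> j * \<psi> (j + 1)
      else rho \<alpha> (j - 1) * \<psi> (j - 1) - \<alpha> (j - 1) * \<psi> j)" for j
  have st: "step \<alpha> (\<lambda>_. 1) z \<psi> \<xi> j" for j
  proof (cases "odd j")
    case True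
    then show ?thesis by (simp add: step_def \<xi>_def)
  next
    case False
    then obtain m where m: "j = 2 * m" by (auto elim: evenE)
    have "z * \<psi> (2*m) = cmv \<alpha> \<psi> (2*m)" "z * \<psi> (2*m+1) = cmv \<alpha> \<psi> (2*m+1)" by (simp_all add: ev)
    then show ?thesis unfolding m cmv_even cmv_odd by (simp add: step_def \<xi>_def add.assoc)
  qed
  have \<alpha>': "cmod (\<alpha> j) \<le> 1" for j using \<alpha>[of j] by simp
  define M where "M = (\<Sum>\<^sub>\<infinity>j. (cmod (\<psi> j))\<^sup>2)"
  have M: "mass \<psi> n \<le> M" for n
    unfolding mass_def M_def using \<psi>(1) by (intro finite_sum_le_infsum) (auto simp: ell2_def)
  have v: "vanishes \<psi>" by (rule vanishes_mass[OF M])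
  obtain i where i: "\<psi> i \<noteq> 0" using \<psi>(2) by auto
  \<comment> \<open>Compared with itself, \<psi> yields \<open>1 - (cmod z)\<^sup>2\<close> times
    its mass, so that the eigenvalue is unimodular.\<close>
  have "(\<lambda>n. \<Sum>j\<in>window n. (1 - z * 1 * cnj (z * 1)) * (\<psi> j * cnj (\<psi> j))) \<longlonglongrightarrow> 0"
    by (rule form_limit[OF \<alpha>' _ _ st st v v]) auto
  moreover have "(\<Sum>j\<in>window n. (1 - z * 1 * cnj (z * 1)) * (\<psi> j * cnj (\<psi> j))) = complex_of_real ((1 - (cmod z)\<^sup>2) * mass \<psi> n)" for n
    unfolding mass_def of_real_mult of_real_sum of_real_diff complex_norm_square by (simp add: sum_distrib_left)
  ultimately have "(\<lambda>n. complex_of_real ((1 - (cmod z)\<^sup>2) * mass \<psi> n)) \<longlonglongrightarrow> of_real 0" by simp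
  then have lim: "(\<lambda>n. (1 - (cmod z)\<^sup>2) * mass \<psi> n) \<longlonglongrightarrow> 0" unfolding tendsto_of_real_iff .
  have z: "cmod z = 1"
  proof (rule ccontr)
    assume "cmod z \<noteq> 1"
    then have nz: "1 - (cmod z)\<^sup>2 \<noteq> 0" by (metis eq_iff_diff_eq_0 norm_ge_zero one_power2 power2_eq_imp_eq zero_le_one)
    have "(\<lambda>n. (1 - (cmod z)\<^sup>2) * mass \<psi> n / (1 - (cmod z)\<^sup>2)) \<longlonglongrightarrow> 0 / (1 - (cmod z)\<^sup>2)"
      by (intro tendsto_divide lim tendsto_const nz)
    then have "mass \<psi> \<longlonglongrightarrow> 0" using nz by simp
    then have "(cmod (\<psi> i))\<^sup>2 \<le> 0"
    proof (rule LIMSEQ_le_const)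
      show "\<exists>N. \<forall>n\<ge>N. (cmod (\<psi> i))\<^sup>2 \<le> mass \<psi> n" using term_le_mass[OF in_window] by blast
    qed
    then show False using i by simp
  qed
  then have z0: "z \<noteq> 0" by auto
  have p0: "\<psi> 0 \<noteq> 0"
  proof
    assume 0: "\<psi> 0 = 0"
    have "cmod (\<psi> 0) = cmod (\<xi> 0)" by (rule vanishing_equal_modulus[OF \<alpha>' _ z st v]) simp
    then have z00: "\<psi> 0 = 0 \<and> \<xi> 0 = 0" using 0 by simp
    have "\<psi> i = 0"
    proof (cases "0 \<le> i")
      case True
      then show ?thesis
        using segment_zero[where a=\<alpha> and d="\<lambda>_. 1" and z=z and q=0 and k=i and \<psi>=\<psi> and \<xi>=\<xi>, OF \<alpha> z0 _ True st] z00 by simp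
    next
      case False
      then have "i \<le> 0" by simp
      then show ?thesis
        using segment_zero[where a=\<alpha> and d="\<lambda>_. 1" and z=z and q=i and k=0 and \<psi>=\<psi> and \<xi>=\<xi>, OF \<alpha> z0 _ _ st] z00 by simp
    qed
    then show False using i by simp
  qed
  have a: "amp (\<lambda>j. (\<alpha> j, 0)) = \<alpha>" "site_phase (\<lambda>j. (\<alpha> j, 0)) = (\<lambda>_. 1)" by (auto simp: amp_def site_phase_def)
  define c where "c = 1 / \<psi> 0"
  have n: "normalized_solution (\<lambda>j. (\<alpha> j, 0)) z (\<lambda>j. c * \<psi> j) (\<lambda>j. c * \<xi> j)"
    unfolding normalized_solution_def a by (intro conjI allI step_scale st z) (simp add: c_def p0)
  obtain N :: nat where N: "(cmod c)\<^sup>2 * M \<le> real N" using real_arch_simple by blast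
  have "mass (\<lambda>j. c * \<psi> j) k \<le> real N" for k
  proof -
    have "mass (\<lambda>j. c * \<psi> j) k = (cmod c)\<^sup>2 * mass \<psi> k"
      by (simp add: mass_def norm_mult power_mult_distrib sum_distrib_left)
    also have "\<dots> \<le> (cmod c)\<^sup>2 * M" using M by (intro mult_left_mono) auto
    finally show ?thesis using N by simp
  qed
  then show ?thesis using n unfolding localized_def by blast
qed

text \<open>The correction is extended in Euclidean space by Tietze, which keeps the bound
  \<open>e\<close>, and pulled back along the injection \<epsilon>.\<close>

lemma prescribe_values:
  fixes \<epsilon> :: "'a::topological_space \<Rightarrow> 'm::euclidean_space" and g :: "'a \<Rightarrow>\<^sub>C complex"
  assumes "continuous_on UNIV \<epsilon>" "inj \<epsilon>" "finite P" "\<And>p. p \<in> P \<Longrightarrow> cmod (h p - apply_bcontfun g p) \<le> e" "e \<ge> 0"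
  obtains f :: "'a \<Rightarrow>\<^sub>C complex" where "dist f g \<le> e" "\<And>p. p \<in> P \<Longrightarrow> apply_bcontfun f p = h p"
proof -
  define h' where "h' y = h (inv \<epsilon> y) - apply_bcontfun g (inv \<epsilon> y)" for y
  have fin: "finite (\<epsilon> ` P)" using assms(3) by simp
  obtain G where G: "continuous_on UNIV G" "\<And>y. y \<in> \<epsilon> ` P \<Longrightarrow> G y = h' y" "\<And>y. norm (G y) \<le> e"
  proof (rule Tietze[of "\<epsilon> ` P" h' UNIV e])
    show "continuous_on (\<epsilon> ` P) h'" by (rule continuous_on_finite[OF fin])
    show "closedin (top_of_set UNIV) (\<epsilon> ` P)" using finite_imp_closed[OF fin] by simp
    show "norm (h' y) \<le> e" if "y \<in> \<epsilon> ` P" for y using that assms(2,4) by (auto simp: h'_def)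
  qed (use assms in auto)
  have c: "continuous_on UNIV (\<lambda>x. G (\<epsilon> x))"
    using continuous_on_compose2[OF G(1) assms(1)] by simp
  then have b: "(\<lambda>x. G (\<epsilon> x)) \<in> bcontfun" using G(3) by (rule bcontfun_normI)
  define f where "f = g + Bcontfun (\<lambda>x. G (\<epsilon> x))"
  have f: "apply_bcontfun f x = apply_bcontfun g x + G (\<epsilon> x)" for x
    by (simp add: f_def Bcontfun_inverse[OF b])
  show ?thesis
  proof (rule that[of f])
    show "dist f g \<le> e" by (rule dist_bound) (simp add: f dist_norm G(3))
    show "apply_bcontfun f p = h p" if "p \<in> P" for p
      using G(2)[of "\<epsilon> p"] that assms(2) by (simp add: f h'_def)
  qed
qed

section \<open>The space of sampling functions and the Baire argument\<close>

lemma disk_functions_bound: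
  assumes "compact (UNIV :: 'a::topological_space set)" "g \<in> (disk_functions :: ('a \<Rightarrow>\<^sub>C complex) set)"
  obtains r where "r < 1" "\<And>x. cmod (apply_bcontfun g x) \<le> r"
proof -
  have "continuous_on UNIV (\<lambda>x. cmod (apply_bcontfun g x))" by (intro continuous_intros) auto
  then obtain x where "\<And>y. cmod (apply_bcontfun g y) \<le> cmod (apply_bcontfun g x)"
    using continuous_attains_sup[OF assms(1), of "\<lambda>x. cmod (apply_bcontfun g x)"] by auto
  moreover have "cmod (apply_bcontfun g x) < 1" using assms(2) by (simp add: disk_functions_def)
  ultimately show ?thesis using that by blast
qed

lemma open_disk_functions:
  assumes "compact (UNIV :: 'a::topological_space set)"
  shows "open (disk_functions :: ('a \<Rightarrow>\<^sub>C complex) set)"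
  unfolding open_dist
proof
  fix g :: "'a \<Rightarrow>\<^sub>C complex" assume "g \<in> disk_functions"
  then obtain r where r: "r < 1" "\<And>x. cmod (apply_bcontfun g x) \<le> r"
    using disk_functions_bound[OF assms] by blast
  have "f \<in> disk_functions" if "dist f g < 1 - r" for f :: "'a \<Rightarrow>\<^sub>C complex"
  proof -
    have "cmod (apply_bcontfun f x) < 1" for x
      using dist_bounded[of f x g] that r(2)[of x] norm_triangle_sub[of "apply_bcontfun f x" "apply_bcontfun g x"]
      by (simp add: dist_norm)
    then show ?thesis by (simp add: disk_functions_def)
  qed
  then show "\<exists>e>0. \<forall>y. dist y g < e \<longrightarrow> y \<in> disk_functions" using r(1) by (intro exI[of _ "1 - r"]) auto
qed

lemma complete_bcontfun: "complete (UNIV :: ('a::topological_space \<Rightarrow>\<^sub>C 'b::complete_space) set)"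
  unfolding complete_def
proof (intro allI impI, elim conjE)
  fix F :: "nat \<Rightarrow> 'a \<Rightarrow>\<^sub>C 'b" assume C: "Cauchy F"
  have "\<exists>M. \<forall>m\<ge>M. \<forall>n\<ge>M. \<forall>x. dist (apply_bcontfun (F m) x) (apply_bcontfun (F n) x) < e" if "e > 0" for e
    using metric_CauchyD[OF C that] by (meson dist_bounded le_less_trans)
  then have "uniformly_Cauchy_on UNIV (\<lambda>n. apply_bcontfun (F n))"
    unfolding uniformly_Cauchy_on_def by blast
  then obtain l where l: "uniform_limit UNIV (\<lambda>n. apply_bcontfun (F n)) l sequentially"
    using Cauchy_uniformly_convergent unfolding uniformly_convergent_on_def by blast
  obtain l' where "F \<longlonglongrightarrow> l'"
    by (rule uniform_limit_bcontfunE[OF l sequentially_bot]) (rule that)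
  then show "\<exists>l\<in>UNIV. F \<longlonglongrightarrow> l" by blast
qed

text \<open>Of the dynamics only an injective sequence of points, recurrent along even times, is
  retained. A non-dense \<open>U N\<close> would place every sampling function near some
  \<open>g\<close> in \<open>A N\<close>, which yields an instance of
  \<open>persistent\<close>.\<close>

theorem generic_continuous_spectrum:
  fixes x :: "int \<Rightarrow> 'a::topological_space" and \<epsilon> :: "'a \<Rightarrow> 'm::euclidean_space"
  assumes comp: "compact (UNIV :: 'a set)" and \<epsilon>: "continuous_on UNIV \<epsilon>" "inj \<epsilon>"
    and x: "inj x" and n: "\<And>k. even (n k)" "filterlim n at_top sequentially"
    and rec: "\<And>j. (\<lambda>k. x (j + n k)) \<longlonglongrightarrow> x j"
  shows "\<exists>G. gdelta_in (top_of_set disk_functions) G \<and>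
     top_of_set disk_functions closure_of G = disk_functions \<and>
     (\<forall>f\<in>G. point_spectrum (cmv (\<lambda>j. apply_bcontfun f (x j))) = {})"
proof -
  define cfg :: "('a \<Rightarrow>\<^sub>C complex) \<Rightarrow> int \<Rightarrow> complex \<times> real" where "cfg f j = (apply_bcontfun f (x j), 0)" for f j
  define A where "A N = {f \<in> disk_functions. localized (cfg f) (real N)}" for N :: nat
  define U where "U N = disk_functions - A N" for N
  have amp_cfg: "cmod (amp (cfg f) j) \<le> 1" if "f \<in> disk_functions" for f j
    using that by (auto simp: amp_def cfg_def disk_functions_def less_imp_le)
  have "disk_functions \<inter> closure (A N) \<subseteq> A N" for N
  proof
    fix f assume f: "f \<in> disk_functions \<inter> closure (A N)"
    then obtain F where F: "\<And>k. F k \<in> A N" "F \<longlonglongrightarrow> f" by (auto simp: closure_sequential)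
    have "(\<lambda>k. apply_bcontfun (F k) y) \<longlonglongrightarrow> apply_bcontfun f y" for y
    proof (rule metric_tendsto_imp_tendsto[OF F(2)])
      show "\<forall>\<^sub>F k in sequentially. dist (apply_bcontfun (F k) y) (apply_bcontfun f y) \<le> dist (F k) f"
        by (simp add: dist_bounded)
    qed
    then have "(\<lambda>k. cfg (F k) j) \<longlonglongrightarrow> cfg f j" for j unfolding cfg_def by (intro tendsto_intros)
    then have "localized (cfg f) (real N)"
      using localized_limit[of "\<lambda>k. cfg (F k)" "cfg f" "real N"] F(1) amp_cfg by (auto simp: A_def)
    then show "f \<in> A N" using f by (simp add: A_def)
  qed
  then have "U N = disk_functions \<inter> - closure (A N)" for N
    unfolding U_def using closure_subset[of "A N"] by blast
  then have opU: "openin (top_of_set disk_functions) (U N)" for N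
    by (metis closed_closure open_Compl openin_open_Int)
  have dense: "top_of_set disk_functions closure_of U N = disk_functions" for N
  proof -
    have "U N \<inter> T \<noteq> {}" if T: "openin (top_of_set disk_functions) T" "T \<noteq> {}" for T
    proof
      assume emp: "U N \<inter> T = {}"
      have "open T" using T(1) open_disk_functions[OF comp] by (metis openin_open_eq)
      obtain g where g: "g \<in> T" using T(2) by blast
      then have gd: "g \<in> disk_functions" using openin_imp_subset[OF T(1)] by blast
      obtain \<delta> where \<delta>: "\<delta> > 0" "\<And>f. dist f g < \<delta> \<Longrightarrow> f \<in> T"
        using \<open>open T\<close> g unfolding open_dist by blast
      have TA: "f \<in> A N" if "f \<in> T" for f
        using that emp openin_imp_subset[OF T(1)] unfolding U_def by blast
      obtain r where r: "r < 1" "\<And>y. cmod (apply_bcontfun g y) \<le> r" using disk_functions_bound[OF comp gd] by blast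
      define e where "e = min (\<delta> / 2) ((1 - r) / 2)"
      have e: "e > 0" "e < \<delta>" "r + e < 1" using \<delta>(1) r(1) by (auto simp: e_def min_def field_simps)
      \<comment> \<open>Localization spreads from sampling functions to every sequence \<beta> near
        \<open>g\<close> along the orbit: functions agreeing with \<beta> on growing intervals
        converge to it pointwise.\<close>
      have presc: "localized (\<lambda>j. (\<beta> j, 0)) (real N)" if \<beta>: "\<And>j. cmod (\<beta> j - apply_bcontfun g (x j)) \<le> e" for \<beta>
      proof -
        have "\<exists>f :: 'a \<Rightarrow>\<^sub>C complex. dist f g \<le> e \<and> (\<forall>j. \<bar>j\<bar> \<le> int k \<longrightarrow> apply_bcontfun f (x j) = \<beta> j)" for k :: nat
        proof -
          have fin: "finite (x ` {- int k..int k})" by simp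
          have val: "cmod (\<beta> (inv x p) - apply_bcontfun g p) \<le> e" if "p \<in> x ` {- int k..int k}" for p
            using that \<beta> x by auto
          obtain f :: "'a \<Rightarrow>\<^sub>C complex" where f: "dist f g \<le> e" "\<And>p. p \<in> x ` {- int k..int k} \<Longrightarrow> apply_bcontfun f p = \<beta> (inv x p)"
            using prescribe_values[OF \<epsilon> fin val less_imp_le[OF e(1)]] by blast
          have "apply_bcontfun f (x j) = \<beta> j" if "\<bar>j\<bar> \<le> int k" for j using f(2)[of "x j"] that x by (simp add: inj_image_mem_iff[OF x] abs_le_iff)
          then show ?thesis using f(1) by blast
        qed
        then obtain F :: "nat \<Rightarrow> 'a \<Rightarrow>\<^sub>C complex" where F: "\<And>k. dist (F k) g \<le> e" "\<And>k j. \<bar>j\<bar> \<le> int k \<Longrightarrow> apply_bcontfun (F k) (x j) = \<beta> j"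
          by metis
        have FT: "F k \<in> A N" for k using F(1)[of k] e(2) by (intro TA \<delta>(2)) simp
        show ?thesis
        proof (rule localized_limit[of "\<lambda>k. cfg (F k)"])
          show "(\<lambda>k. cfg (F k) j) \<longlonglongrightarrow> (\<beta> j, 0)" for j
          proof (rule tendsto_eventually)
            show "\<forall>\<^sub>F k in sequentially. cfg (F k) j = (\<beta> j, 0)"
              using eventually_ge_at_top[of "nat \<bar>j\<bar>"] by eventually_elim (simp add: cfg_def F(2))
          qed
          show "cmod (amp (cfg (F k)) j) \<le> 1" for k j using FT[of k] by (intro amp_cfg) (simp add: A_def)
          show "localized (cfg (F k)) (real N)" for k using FT[of k] by (simp add: A_def)
        qed
      qed
      \<comment> \<open>Half of the tolerance \<open>e\<close> is for the amplitude and half for the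
        effect of the phase.\<close>
      interpret persistent "\<lambda>j. apply_bcontfun g (x j)" "e / 2" "e / 2" "real N"
      proof
        show "cmod (apply_bcontfun g (x j)) + e / 2 < 1" for j using r(2)[of "x j"] e by linarith
        fix y :: "int \<Rightarrow> complex \<times> real"
        assume y: "\<And>j. cmod (fst (y j) - apply_bcontfun g (x j)) \<le> e / 2" "\<And>j. \<bar>snd (y j)\<bar> \<le> e / 2"
        show "localized y (real N)"
        proof (rule localized_gauge, rule presc)
          fix j
          have "cmod (fst (y j)) \<le> 1"
            using y(1)[of j] r(2)[of "x j"] e norm_triangle_sub[of "fst (y j)" "apply_bcontfun g (x j)"] by linarith
          moreover have "cmod (cis (snd (y j)) - 1) \<le> e / 2"
            using dist_exp_i_1[of "snd (y j)"] abs_sin_x_le_abs_x[of "snd (y j) / 2"] y(2)[of j] by (simp add: cis_conv_exp)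
          ultimately have "cmod ((cis (snd (y j)) - 1) * fst (y j)) \<le> e / 2 * 1"
            unfolding norm_mult using e by (intro mult_mono) auto
          then show "cmod (cis (snd (y j)) * fst (y j) - apply_bcontfun g (x j)) \<le> e"
            using y(1)[of j] norm_triangle_ineq[of "(cis (snd (y j)) - 1) * fst (y j)" "fst (y j) - apply_bcontfun g (x j)"]
            by (simp add: algebra_simps)
        qed
      qed (use e in auto)
      show False
      proof (rule not_recurrent)
        fix J :: nat and \<eta> :: real assume \<eta>: "\<eta> > 0"
        have "\<forall>\<^sub>F k in sequentially. cmod (apply_bcontfun g (x (j + n k)) - apply_bcontfun g (x j)) \<le> \<eta>" for j
        proof -
          have "(\<lambda>k. apply_bcontfun g (x (j + n k))) \<longlonglongrightarrow> apply_bcontfun g (x j)"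
            by (rule continuous_on_tendsto_compose[OF continuous_on_apply_bcontfun[of UNIV] rec]) auto
          then have "\<forall>\<^sub>F k in sequentially. dist (apply_bcontfun g (x (j + n k))) (apply_bcontfun g (x j)) < \<eta>"
            using \<eta> by (rule tendstoD)
          then show ?thesis by eventually_elim (simp add: dist_norm)
        qed
        then have "\<forall>\<^sub>F k in sequentially. \<forall>j\<in>{- int J..int J}. cmod (apply_bcontfun g (x (j + n k)) - apply_bcontfun g (x j)) \<le> \<eta>"
          by (intro eventually_ball_finite) auto
        moreover have "\<forall>\<^sub>F k in sequentially. n k \<ge> int J" using n(2) by (simp add: filterlim_at_top)
        ultimately have "\<forall>\<^sub>F k in sequentially. n k \<ge> int J \<and> (\<forall>j\<in>{- int J..int J}. cmod (apply_bcontfun g (x (j + n k)) - apply_bcontfun g (x j)) \<le> \<eta>)"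
          by eventually_elim simp
        then obtain k where "n k \<ge> int J" "\<forall>j\<in>{- int J..int J}. cmod (apply_bcontfun g (x (j + n k)) - apply_bcontfun g (x j)) \<le> \<eta>"
          by (auto simp: eventually_sequentially)
        then show "\<exists>n. even n \<and> n \<ge> int J \<and> (\<forall>j. \<bar>j\<bar> \<le> int J \<longrightarrow> cmod (apply_bcontfun g (x (j + n)) - apply_bcontfun g (x j)) \<le> \<eta>)"
          using n(1) by (intro exI[of _ "n k"]) (auto simp: abs_le_iff minus_le_iff)
      qed
    qed
    then show ?thesis using dense_intersects_open[of "top_of_set disk_functions" "U N"] by auto
  qed
  define G where "G = (\<Inter>N. U N)"
  have "gdelta_in (top_of_set disk_functions) G"
    unfolding G_def by (rule gdelta_in_Inter) (auto intro: open_imp_gdelta_in opU)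
  moreover have "top_of_set disk_functions closure_of G = disk_functions"
  proof -
    have "completely_metrizable_space (top_of_set (disk_functions :: ('a \<Rightarrow>\<^sub>C complex) set))"
    proof (rule completely_metrizable_space_openin)
      show "completely_metrizable_space (euclidean :: ('a \<Rightarrow>\<^sub>C complex) topology)"
        using Met_TC.completely_metrizable_space_mtopology complete_bcontfun by auto
      show "openin euclidean (disk_functions :: ('a \<Rightarrow>\<^sub>C complex) set)"
        using open_disk_functions[OF comp] by simp
    qed
    then have "top_of_set disk_functions closure_of (\<Inter>(range U)) = topspace (top_of_set (disk_functions :: ('a \<Rightarrow>\<^sub>C complex) set))"
      using opU dense by (intro Baire_category) auto
    then show ?thesis by (simp add: G_def)
  qed
  moreover have "point_spectrum (cmv (\<lambda>j. apply_bcontfun f (x j))) = {}" if "f \<in> G" for f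
  proof (rule ccontr)
    assume "\<not> ?thesis"
    moreover have fU: "f \<in> U N" for N using that by (simp add: G_def)
    moreover have "cmod (apply_bcontfun f (x j)) < 1" for j using fU[of 0] by (auto simp: U_def disk_functions_def)
    ultimately obtain N :: nat where "localized (\<lambda>j. (apply_bcontfun f (x j), 0)) (real N)"
      using eigenvector_localized[of "\<lambda>j. apply_bcontfun f (x j)"] by blast
    then show False using fU[of N] by (auto simp: U_def A_def cfg_def[abs_def])
  qed
  ultimately show ?thesis by blast
qed

section \<open>Orbits on the torus\<close>

lemma circle_of_eq_iff: "circle_of x = circle_of y \<longleftrightarrow> x - y \<in> \<int>"
  by transfer simp

lemma circle_of_add: "circle_of x + circle_of y = circle_of (x + y)"
  by transfer simp

lemma circle_of_surj: "\<exists>x. c = circle_of x"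
  by transfer (metis Ints_0 diff_self)

lemma circle_of_add_int: "circle_of (x + of_int m) = circle_of x"
  by (simp add: circle_of_eq_iff)

text \<open>The standard embedding into the plane. Besides feeding Tietze, it transfers closedness
  of points to the quotient topology.\<close>

lift_definition circle_embedding :: "circle \<Rightarrow> complex" is "\<lambda>x. cis (2 * pi * x)"
proof -
  fix x y :: real assume "x - y \<in> \<int>"
  then obtain m :: int where "x - y = of_int m" by (auto elim: Ints_cases)
  then have "x = y + of_int m" by simp
  then have "2 * pi * x = 2 * pi * y + 2 * pi * of_int m" by (simp add: algebra_simps)
  then show "cis (2 * pi * x) = cis (2 * pi * y)"
    by (simp add: cis_mult[symmetric])
qed

lemma circle_embedding_circle_of: "circle_embedding (circle_of x) = cis (2 * pi * x)"
  by transfer simp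

lemma continuous_on_circle_embedding: "continuous_on UNIV circle_embedding"
proof -
  have "open (circle_embedding -` U)" if "open U" for U
  proof -
    have "circle_of -` (circle_embedding -` U) = (\<lambda>x. cis (2 * pi * x)) -` U"
      by (auto simp: circle_embedding_circle_of)
    moreover have "open ((\<lambda>x. cis (2 * pi * x)) -` U)"
      by (intro open_vimage that continuous_intros)
    ultimately show ?thesis by (simp add: open_circle_def)
  qed
  then show ?thesis by (simp add: continuous_on_open_vimage)
qed

lemma inj_circle_embedding: "inj circle_embedding"
proof (rule injI)
  fix c d assume eq: "circle_embedding c = circle_embedding d"
  obtain x y where xy: "c = circle_of x" "d = circle_of y" using circle_of_surj by metis
  have "cis (2 * pi * x) = cis (2 * pi * y)" using eq by (simp add: xy circle_embedding_circle_of)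
  then have "cis (2 * pi * (x - y)) = 1" by (simp add: right_diff_distrib cis_divide[symmetric])
  then have "cos (2 * pi * (x - y)) = 1" by (simp add: complex_eq_iff)
  then obtain m :: int where "2 * pi * (x - y) = of_int m * 2 * pi" unfolding cos_one_2pi_int by blast
  then have "x - y = of_int m" by simp
  then show "c = d" by (simp add: xy circle_of_eq_iff)
qed

lemma circle_of_unit_interval: "\<exists>x\<in>{0..<1}. c = circle_of x"
proof -
  obtain x where "c = circle_of x" using circle_of_surj by blast
  then have "c = circle_of (frac x)" by (simp add: circle_of_eq_iff frac_def)
  then show ?thesis using frac_ge_0 frac_lt_1 by force
qed

lemma tendsto_circle_of: "(f \<longlongrightarrow> l) F \<Longrightarrow> ((\<lambda>x. circle_of (f x)) \<longlongrightarrow> circle_of l) F"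
  by (rule continuous_on_tendsto_compose[OF continuous_on_circle_of]) auto

lemma continuous_on_vec_map:
  fixes h :: "'a::topological_space \<Rightarrow> 'b::topological_space"
  assumes "continuous_on UNIV h"
  shows "continuous_on UNIV (\<lambda>c :: 'a ^ 'd. \<chi> i. h (c $ i))"
proof (rule continuous_on_vec_lambda)
  fix i
  have "continuous_on UNIV (\<lambda>c :: 'a ^ 'd. c $ i)"
    unfolding continuous_on_def by (auto intro!: tendsto_vec_nth tendsto_ident_at)
  then show "continuous_on UNIV (\<lambda>c :: 'a ^ 'd. h (c $ i))"
    by (rule continuous_on_compose2[OF assms]) simp
qed

lemma continuous_on_pair_map:
  fixes h :: "'a::topological_space \<Rightarrow> 'b::topological_space"
  assumes "continuous_on UNIV h"
  shows "continuous_on UNIV (\<lambda>c. (h (fst c), h (snd c)))"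
proof (rule continuous_on_Pair)
  show "continuous_on UNIV (\<lambda>c :: 'a \<times> 'a. h (fst c))"
    by (rule continuous_on_compose2[OF assms continuous_on_fst[OF continuous_on_id]]) simp
  show "continuous_on UNIV (\<lambda>c :: 'a \<times> 'a. h (snd c))"
    by (rule continuous_on_compose2[OF assms continuous_on_snd[OF continuous_on_id]]) simp
qed

text \<open>Injectivity makes \<open>inv T\<close> undo \<open>T\<close> along a sequence already
  known to be an orbit, so a closed formula also describes the negative times.\<close>

lemma iterate_orbit:
  assumes "inj T" "X 0 = \<omega>" "\<And>n. T (X n) = X (n + 1)"
  shows "iterate T n \<omega> = X n"
proof (cases "0 \<le> n")
  case True
  have "(T ^^ k) \<omega> = X (int k)" for k by (induction k) (auto simp: assms add.commute)
  then show ?thesis using True by (simp add: iterate_def)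
next
  case False
  have "inv T (X j) = X (j - 1)" for j using assms(1) assms(3)[of "j - 1"] by (metis inv_f_f diff_add_cancel)
  then have "(inv T ^^ k) \<omega> = X (- int k)" for k
  proof (induction k)
    case 0
    then show ?case by (simp add: assms(2))
  next
    case (Suc k)
    then have "(inv T ^^ Suc k) \<omega> = X (- int k - 1)" using \<open>\<And>j. inv T (X j) = X (j - 1)\<close> by simp
    moreover have "- int k - 1 = - int (Suc k)" by simp
    ultimately show ?case by (simp only:)
  qed
  then show ?thesis using False by (simp add: iterate_def)
qed

section \<open>Recurrence modulo the integers\<close>

definition near_int :: "real \<Rightarrow> real \<Rightarrow> bool"
  where "near_int x \<delta> \<longleftrightarrow> (\<exists>m::int. \<bar>x - of_int m\<bar> < \<delta>)"

lemma near_int_add: "near_int x \<delta> \<Longrightarrow> near_int y \<delta>' \<Longrightarrow> near_int (x + y) (\<delta> + \<delta>')"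
  unfolding near_int_def
proof (elim exE)
  fix m m' :: int assume "\<bar>x - of_int m\<bar> < \<delta>" "\<bar>y - of_int m'\<bar> < \<delta>'"
  then show "\<exists>m::int. \<bar>x + y - of_int m\<bar> < \<delta> + \<delta>'" by (intro exI[of _ "m + m'"]) auto
qed

lemma near_int_mult:
  assumes "near_int x \<delta>" "k \<ge> 0"
  shows "near_int (of_int k * x) ((of_int k + 1) * \<delta>)"
proof -
  obtain m :: int where m: "\<bar>x - of_int m\<bar> < \<delta>" using assms by (auto simp: near_int_def)
  have "\<bar>of_int k * x - of_int (k * m)\<bar> = of_int k * \<bar>x - of_int m\<bar>"
    using assms(2) by (simp add: abs_mult flip: right_diff_distrib)
  also have "\<dots> \<le> of_int k * \<delta>" using m assms(2) by (intro mult_left_mono) auto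
  also have "\<dots> < (of_int k + 1) * \<delta>" using m by (simp add: distrib_right)
  finally show ?thesis unfolding near_int_def by blast
qed

lemma near_int_mono: "near_int x \<delta> \<Longrightarrow> \<delta> \<le> \<delta>' \<Longrightarrow> near_int x \<delta>'"
  unfolding near_int_def by (meson less_le_trans)

text \<open>Pigeonhole by compactness: a convergent subsequence of the even multiples in the unit
  cube has close members, and the difference of their times is an even return time.\<close>

lemma simultaneous_recurrence:
  fixes \<alpha> :: "real ^ 'd"
  assumes "\<delta> > 0"
  shows "\<exists>n. even n \<and> n \<ge> K \<and> (\<forall>i. near_int (of_int n * \<alpha> $ i) \<delta>)"
proof -
  define v :: "nat \<Rightarrow> real ^ 'd" where "v k = (\<chi> i. frac (real (2 * k) * \<alpha> $ i))" for k
  have "v k \<in> cbox 0 (\<chi> i. 1)" for k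
    by (auto simp: v_def mem_box_cart frac_ge_0 less_imp_le[OF frac_lt_1])
  then obtain l r where r: "strict_mono (r :: nat \<Rightarrow> nat)" "(v \<circ> r) \<longlonglongrightarrow> l"
    using compact_cbox[of "0 :: real ^ 'd" "\<chi> i. 1"] unfolding compact_def by meson
  then have "Cauchy (v \<circ> r)" by (auto intro: LIMSEQ_imp_Cauchy)
  then obtain M where M: "\<And>m n. m \<ge> M \<Longrightarrow> n \<ge> M \<Longrightarrow> dist ((v \<circ> r) m) ((v \<circ> r) n) < \<delta>"
    using metric_CauchyD[OF _ assms] by blast
  \<comment> \<open>Since \<open>r\<close> is strictly increasing, the second index exceeds
    \<open>r M\<close> by at least \<open>k\<close>, which makes the return time at least
    \<open>K\<close>.\<close>
  define k where "k = M + nat K"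
  define p where "p = r (r M + k)"
  have p: "r M + k \<le> p" unfolding p_def by (rule seq_suble[OF r(1)])
  define n where "n = 2 * (int p - int (r M))"
  have n: "even n" "n \<ge> K" using p by (auto simp: n_def k_def)
  have "near_int (of_int n * \<alpha> $ i) \<delta>" for i
  proof -
    have "\<bar>frac (real (2 * p) * \<alpha> $ i) - frac (real (2 * r M) * \<alpha> $ i)\<bar> = \<bar>(v p - v (r M)) $ i\<bar>"
      by (simp add: v_def)
    also have "\<dots> \<le> dist (v p) (v (r M))" unfolding dist_norm by (rule component_le_norm_cart)
    also have "\<dots> < \<delta>" using M[of "r M + k" M] by (simp add: p_def k_def)
    finally have "\<bar>of_int n * \<alpha> $ i - of_int (\<lfloor>real (2 * p) * \<alpha> $ i\<rfloor> - \<lfloor>real (2 * r M) * \<alpha> $ i\<rfloor>)\<bar> < \<delta>"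
      by (simp add: frac_def n_def algebra_simps)
    then show ?thesis unfolding near_int_def by blast
  qed
  then show ?thesis using n by blast
qed

lemma real_recurrence: "\<delta> > 0 \<Longrightarrow> \<exists>n. even n \<and> n \<ge> K \<and> near_int (of_int n * \<alpha>) \<delta>"
  using simultaneous_recurrence[of \<delta> K "\<chi> i::1. \<alpha>"] by simp

text \<open>The cluster points of \<open>n x + n (n - 1) \<alpha>\<close> along the times at which \<open>2 n \<alpha>\<close> is
  close to an integer form a nonempty closed semigroup of \<open>\<real>/\<int>\<close>, which contains zero.\<close>

lemma quadratic_recurrence:
  fixes \<alpha> x :: real
  assumes "\<delta> > 0"
  shows "\<exists>n. even n \<and> n \<ge> K \<and> near_int (2 * of_int n * \<alpha>) \<delta> \<and> near_int (of_int n * x + of_int (n * (n - 1)) * \<alpha>) \<delta>"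
proof -
  define \<theta> where "\<theta> n = of_int n * x + of_int (n * (n - 1)) * \<alpha>" for n :: int
  \<comment> \<open>The condition on \<open>2 n \<alpha>\<close> is what gives additivity:
    \<open>\<theta> (m + n)\<close> exceeds \<open>\<theta> m + \<theta> n\<close> by the cross term
    \<open>2 m n \<alpha>\<close>.\<close>
  define \<Lambda> where "\<Lambda> = {g. \<forall>K. \<forall>\<delta>>0. \<exists>n. even n \<and> n \<ge> K \<and> near_int (2 * of_int n * \<alpha>) \<delta> \<and> near_int (\<theta> n - g) \<delta>}"
  have \<Lambda>D: "\<exists>n. even n \<and> n \<ge> K \<and> near_int (2 * of_int n * \<alpha>) \<delta> \<and> near_int (\<theta> n - g) \<delta>"
    if "g \<in> \<Lambda>" "\<delta> > 0" for g K \<delta>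
    using that unfolding \<Lambda>_def by blast
  have "\<exists>g. g \<in> \<Lambda>"
  proof -
    have "\<exists>n. even n \<and> n \<ge> int k \<and> near_int (2 * of_int n * \<alpha>) (1 / real (Suc k))" for k
      using real_recurrence[of "1 / real (Suc k)" "int k" "2 * \<alpha>"] by (simp add: mult_ac)
    then obtain n where n: "\<And>k. even (n k)" "\<And>k. n k \<ge> int k" "\<And>k. near_int (2 * of_int (n k) * \<alpha>) (1 / real (Suc k))"
      by metis
    have "bounded (range (\<lambda>k. frac (\<theta> (n k))))"
      by (rule boundedI[of _ 1]) (auto simp: abs_of_nonneg frac_ge_0 less_imp_le[OF frac_lt_1])
    then obtain g r where r: "strict_mono (r :: nat \<Rightarrow> nat)" "((\<lambda>k. frac (\<theta> (n k))) \<circ> r) \<longlonglongrightarrow> g"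
      using bounded_imp_convergent_subsequence by blast
    have "g \<in> \<Lambda>"
      unfolding \<Lambda>_def
    proof (intro CollectI allI impI)
      fix K :: int and \<delta> :: real assume \<delta>: "\<delta> > 0"
      obtain k0 where k0: "\<And>k. k \<ge> k0 \<Longrightarrow> \<bar>frac (\<theta> (n (r k))) - g\<bar> < \<delta>"
        using LIMSEQ_D[OF r(2) \<delta>] by auto
      obtain k1 where k1: "1 / real (Suc k1) < \<delta>" using nat_approx_posE[OF \<delta>] by blast
      define k where "k = max k0 (max k1 (nat K))"
      have kK: "nat K \<le> k" by (simp add: k_def)
      have rk: "r k \<ge> k" by (rule seq_suble[OF r(1)])
      have "1 / real (Suc (r k)) \<le> 1 / real (Suc k1)"
        using rk by (intro divide_left_mono) (auto simp: k_def)
      then have "near_int (2 * of_int (n (r k)) * \<alpha>) \<delta>"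
        using near_int_mono[OF n(3)[of "r k"], of \<delta>] k1 by simp
      moreover have "near_int (\<theta> (n (r k)) - g) \<delta>"
        unfolding near_int_def using k0[of k] by (intro exI[of _ "\<lfloor>\<theta> (n (r k))\<rfloor>"]) (auto simp: k_def frac_def algebra_simps)
      moreover have "n (r k) \<ge> K" using n(2)[of "r k"] rk kK by linarith
      ultimately show "\<exists>n. even n \<and> n \<ge> K \<and> near_int (2 * of_int n * \<alpha>) \<delta> \<and> near_int (\<theta> n - g) \<delta>"
        using n(1) by blast
    qed
    then show ?thesis by blast
  qed
  then obtain g where g: "g \<in> \<Lambda>" by blast
  have add: "g + h \<in> \<Lambda>" if "g \<in> \<Lambda>" "h \<in> \<Lambda>" for g h
    unfolding \<Lambda>_def
  proof (intro CollectI allI impI)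
    fix K :: int and \<delta> :: real assume \<delta>: "\<delta> > 0"
    have "\<exists>m. even m \<and> m \<ge> max K 0 \<and> near_int (2 * of_int m * \<alpha>) (\<delta>/3) \<and> near_int (\<theta> m - g) (\<delta>/3)"
      by (rule \<Lambda>D[OF that(1)]) (use \<delta> in simp)
    then obtain m where m: "even m" "m \<ge> K" "m \<ge> 0" "near_int (2 * of_int m * \<alpha>) (\<delta>/3)" "near_int (\<theta> m - g) (\<delta>/3)"
      by auto
    \<comment> \<open>As \<open>m\<close> is chosen before \<open>n\<close>, the tolerance for
      \<open>n\<close> can absorb the factor \<open>m\<close> of the cross term.\<close>
    define \<delta>' where "\<delta>' = \<delta> / 3 / (of_int m + 1)"
    have m1: "(1::real) \<le> of_int m + 1" using m(3) by simp
    have \<delta>': "\<delta>' > 0" "(of_int m + 1) * \<delta>' = \<delta> / 3"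
    proof -
      have "(of_int m + 1 :: real) \<noteq> 0" using m1 by linarith
      then show "(of_int m + 1) * \<delta>' = \<delta> / 3" by (metis \<delta>'_def mult.commute nonzero_eq_divide_eq)
      show "\<delta>' > 0" unfolding \<delta>'_def using \<delta> m1 by (intro divide_pos_pos) linarith+
    qed
    have \<delta>'3: "\<delta>' \<le> \<delta> / 3"
      using mult_right_mono[OF m1 less_imp_le[OF \<delta>'(1)]] \<delta>'(2) by simp
    have "\<exists>n. even n \<and> n \<ge> max K 0 \<and> near_int (2 * of_int n * \<alpha>) \<delta>' \<and> near_int (\<theta> n - h) \<delta>'"
      by (rule \<Lambda>D[OF that(2) \<delta>'(1)])
    then obtain n where n: "even n" "n \<ge> 0" "near_int (2 * of_int n * \<alpha>) \<delta>'" "near_int (\<theta> n - h) \<delta>'" by auto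
    have "near_int (2 * of_int m * \<alpha> + 2 * of_int n * \<alpha>) (\<delta> / 3 + \<delta>')" by (rule near_int_add[OF m(4) n(3)])
    then have 1: "near_int (2 * of_int (m + n) * \<alpha>) \<delta>"
      using near_int_mono[of "2 * of_int m * \<alpha> + 2 * of_int n * \<alpha>" "\<delta>/3 + \<delta>'" \<delta>] \<delta>'3 \<delta> by (simp add: algebra_simps)
    have "near_int (of_int m * (2 * of_int n * \<alpha>)) (\<delta> / 3)"
      using near_int_mult[OF n(3) m(3)] unfolding \<delta>'(2) .
    then have "near_int ((\<theta> m - g) + (\<theta> n - h) + of_int m * (2 * of_int n * \<alpha>)) (\<delta> / 3 + \<delta>' + \<delta> / 3)"
      by (intro near_int_add m(5) n(4))
    moreover have "(\<theta> m - g) + (\<theta> n - h) + of_int m * (2 * of_int n * \<alpha>) = \<theta> (m + n) - (g + h)"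
      by (simp add: \<theta>_def algebra_simps)
    ultimately have 2: "near_int (\<theta> (m + n) - (g + h)) \<delta>"
      using near_int_mono[of "\<theta> (m + n) - (g + h)" "\<delta> / 3 + \<delta>' + \<delta> / 3" \<delta>] \<delta>'3 by simp
    show "\<exists>n. even n \<and> n \<ge> K \<and> near_int (2 * of_int n * \<alpha>) \<delta> \<and> near_int (\<theta> n - (g + h)) \<delta>"
      using 1 2 m n by (intro exI[of _ "m + n"]) auto
  qed
  have mult: "of_nat (Suc k) * g \<in> \<Lambda>" for k
  proof (induction k)
    case 0
    then show ?case using g by simp
  next
    case (Suc k)
    then show ?case using add[OF Suc g] by (simp add: algebra_simps)
  qed
  \<comment> \<open>A positive multiple of \<open>g\<close> close to an integer serves as an
    approximate zero element, leaving \<open>\<delta> / 2\<close> for its approximation by \<theta>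
    n.\<close>
  obtain k where k: "k \<ge> 1" "near_int (of_int k * g) (\<delta> / 2)"
    using real_recurrence[of "\<delta> / 2" 1 g] assms by auto
  have "of_int k * g \<in> \<Lambda>" using mult[of "nat k - 1"] k(1) by (simp add: of_nat_diff)
  then obtain n where n: "even n" "n \<ge> K" "near_int (2 * of_int n * \<alpha>) (\<delta> / 2)" "near_int (\<theta> n - of_int k * g) (\<delta> / 2)"
    using \<Lambda>D[of "of_int k * g" "\<delta> / 2" K] assms by auto
  have "near_int (\<theta> n) \<delta>" using near_int_add[OF n(4) k(2)] by simp
  moreover have "near_int (2 * of_int n * \<alpha>) \<delta>" using near_int_mono[OF n(3)] assms by simp
  ultimately show ?thesis using n unfolding \<theta>_def by blast
qed

lemma near_int_sequence:
  assumes "\<And>K \<delta>. \<delta> > 0 \<Longrightarrow> \<exists>n. even n \<and> n \<ge> (K::int) \<and> (\<forall>i. near_int (h i n) \<delta>)"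
  obtains n m where "\<And>k::nat. even (n k)" "filterlim n at_top sequentially"
    "\<And>i. (\<lambda>k. h i (n k) - of_int (m i k)) \<longlonglongrightarrow> 0"
proof -
  have "\<exists>n. even n \<and> n \<ge> int k \<and> (\<forall>i. near_int (h i n) (1 / real (Suc k)))" for k by (rule assms) simp
  then obtain n where n: "\<And>k. even (n k)" "\<And>k. n k \<ge> int k" "\<And>k i. near_int (h i (n k)) (1 / real (Suc k))" by metis
  obtain m where m: "\<And>i k. \<bar>h i (n k) - of_int (m i k)\<bar> < 1 / real (Suc k)"
    using n(3) unfolding near_int_def by metis
  have "filterlim n at_top sequentially"
    unfolding filterlim_at_top
  proof
    fix Z :: int
    show "\<forall>\<^sub>F k in sequentially. Z \<le> n k"
      using eventually_ge_at_top[of "nat Z"]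
    proof eventually_elim
      case (elim k)
      then show ?case using n(2)[of k] by linarith
    qed
  qed
  moreover have "(\<lambda>k. h i (n k) - of_int (m i k)) \<longlonglongrightarrow> 0" for i
  proof (rule Lim_null_comparison)
    show "\<forall>\<^sub>F k in sequentially. norm (h i (n k) - of_int (m i k)) \<le> 1 / real (Suc k)"
      using m by (auto intro!: always_eventually less_imp_le)
    show "(\<lambda>k. 1 / real (Suc k)) \<longlonglongrightarrow> 0" using LIMSEQ_inverse_real_of_nat by (simp add: field_simps)
  qed
  ultimately show ?thesis using that n(1) by blast
qed

text \<open>The argument covers every \<omega>: minimality makes the orbit infinite, and rotations
  return simultaneously in all coordinates.\<close>

lemma shift_generic:
  fixes a :: "circle ^ 'd"
  assumes "minimal (shift a)"
  shows "\<exists>G. gdelta_in (top_of_set disk_functions) G \<and>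
    top_of_set disk_functions closure_of G = disk_functions \<and>
    (\<forall>f\<in>G. point_spectrum (cmv (verblunsky (shift a) f \<omega>)) = {})"
proof -
  define \<epsilon> :: "circle ^ 'd \<Rightarrow> complex ^ 'd" where "\<epsilon> c = (\<chi> i. circle_embedding (c $ i))" for c
  have \<epsilon>c: "continuous_on UNIV \<epsilon>"
    unfolding \<epsilon>_def by (rule continuous_on_vec_map[OF continuous_on_circle_embedding])
  have \<epsilon>i: "inj \<epsilon>"
    by (rule injI) (auto simp: \<epsilon>_def vec_eq_iff inj_eq[OF inj_circle_embedding])
  define q :: "real ^ 'd \<Rightarrow> circle ^ 'd" where "q y = (\<chi> i. circle_of (y $ i))" for y
  have qc: "continuous_on UNIV q"
    unfolding q_def by (rule continuous_on_vec_map[OF continuous_on_circle_of])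
  have qs: "\<exists>y\<in>cbox 0 (\<chi> i. 1). c = q y" for c
  proof -
    have "\<forall>i. \<exists>y. y \<in> {0..<1} \<and> c $ i = circle_of y" using circle_of_unit_interval by blast
    then obtain y where "\<And>i. y i \<in> {0..<1} \<and> c $ i = circle_of (y i)" by metis
    then show ?thesis by (intro bexI[of _ "\<chi> i. y i"]) (auto simp: q_def vec_eq_iff mem_box_cart less_imp_le)
  qed
  have comp: "compact (UNIV :: (circle ^ 'd) set)"
  proof -
    have "compact (q ` cbox 0 (\<chi> i. 1))"
      by (rule compact_continuous_image[OF continuous_on_subset[OF qc] compact_cbox]) simp
    moreover have "q ` cbox 0 (\<chi> i. 1) = UNIV" using qs by blast
    ultimately show ?thesis by simp
  qed
  obtain \<alpha> where \<alpha>: "a = q \<alpha>" using qs by blast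
  obtain w where w: "\<omega> = q w" using qs by blast
  define X where "X n = q (w + of_int n *\<^sub>R \<alpha>)" for n
  have X0: "X 0 = \<omega>" by (simp add: X_def w)
  have XS: "shift a (X n) = X (n + 1)" for n
    by (simp add: shift_def X_def \<alpha> q_def vec_eq_iff circle_of_add algebra_simps)
  have injT: "inj (shift a)" by (auto simp: inj_def shift_def)
  have it: "iterate (shift a) n \<omega> = X n" for n by (rule iterate_orbit[OF injT X0 XS])
  have injX: "inj X"
  proof (rule ccontr)
    assume "\<not> inj X"
    then obtain n m where "X n = X m" "m < n" unfolding inj_def by (metis linorder_neqE)
    then have "(w $ i + of_int n * \<alpha> $ i) - (w $ i + of_int m * \<alpha> $ i) \<in> \<int>" for i
      by (simp add: X_def q_def vec_eq_iff circle_of_eq_iff)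
    then have D: "of_int (n - m) * \<alpha> $ i \<in> \<int>" for i by (simp add: algebra_simps)
    define d where "d = n - m"
    have d: "d > 0" using \<open>m < n\<close> by (simp add: d_def)
    \<comment> \<open>A repetition makes the orbit periodic, hence finite and closed; by minimality
      it would be the whole torus.\<close>
    have "X j = X (j mod d)" for j
    proof -
      have "of_int j = of_int (j mod d) + of_int (j div d) * (of_int d :: real)"
        by (metis add.commute div_mult_mod_eq of_int_add of_int_mult)
      then have "(w $ i + of_int j * \<alpha> $ i) - (w $ i + of_int (j mod d) * \<alpha> $ i) = of_int (j div d) * (of_int d * \<alpha> $ i)" for i
        by (simp add: algebra_simps)
      then show ?thesis using D unfolding d_def[symmetric]
        by (simp add: X_def q_def vec_eq_iff circle_of_eq_iff)
    qed
    then have "range X \<subseteq> X ` {0..<d}" using d by force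
    then have fin: "finite (range X)" using finite_subset by blast
    have "range X = \<epsilon> -` (\<epsilon> ` range X)" using \<epsilon>i by (auto simp: inj_eq)
    moreover have "closed (\<epsilon> -` (\<epsilon> ` range X))"
      using fin by (intro closed_vimage \<epsilon>c finite_imp_closed) auto
    ultimately have "closed (range X)" by simp
    moreover have "closure (range (\<lambda>n. iterate (shift a) n \<omega>)) = UNIV" using assms unfolding minimal_def by blast
    then have "closure (range X) = UNIV" unfolding it .
    ultimately have "finite (UNIV :: (circle ^ 'd) set)" using fin by simp
    \<comment> \<open>The diagonal circle shows that the torus is infinite in every
      dimension.\<close>
    moreover have "inj_on (\<lambda>t. q (\<chi> i. t)) {0..<1}"
    proof (rule inj_onI)
      fix s t :: real assume st: "s \<in> {0..<1}" "t \<in> {0..<1}" "q (\<chi> i. s) = q (\<chi> i. t)"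
      then have "s - t \<in> \<int>" by (simp add: q_def vec_eq_iff circle_of_eq_iff)
      then obtain k :: int where "s - t = of_int k" by (auto elim: Ints_cases)
      then have "k = 0" using st(1,2) by auto
      then show "s = t" using \<open>s - t = of_int k\<close> by simp
    qed
    ultimately have "finite ({0..<1} :: real set)" by (meson finite_imageD finite_subset subset_UNIV)
    then show False using infinite_Ico[of "0::real" 1] by simp
  qed
  have rec1: "\<exists>n. even n \<and> n \<ge> (K::int) \<and> (\<forall>i. near_int (of_int n * \<alpha> $ i) \<delta>)" if "\<delta> > 0" for K \<delta>
    by (rule simultaneous_recurrence[OF that])
  obtain n m where n: "\<And>k::nat. even (n k)" "filterlim n at_top sequentially"
    "\<And>i. (\<lambda>k. of_int (n k) * \<alpha> $ i - of_int (m i k)) \<longlonglongrightarrow> 0"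
    by (rule near_int_sequence[where h="\<lambda>i n. of_int n * \<alpha> $ i", OF rec1]) (assumption, rule that)
  have "(\<lambda>k. X (j + n k)) \<longlonglongrightarrow> X j" for j
  proof -
    have "X (j + n k) = (\<chi> i. circle_of ((w $ i + of_int j * \<alpha> $ i) + (of_int (n k) * \<alpha> $ i - of_int (m i k))))" for k
      by (simp add: X_def q_def vec_eq_iff circle_of_eq_iff algebra_simps)
    moreover have "(\<lambda>k. (\<chi> i. circle_of ((w $ i + of_int j * \<alpha> $ i) + (of_int (n k) * \<alpha> $ i - of_int (m i k)))))
        \<longlonglongrightarrow> (\<chi> i. circle_of ((w $ i + of_int j * \<alpha> $ i) + 0))"
      by (intro tendsto_vec_lambda tendsto_circle_of tendsto_add tendsto_const n)
    ultimately show ?thesis by (simp add: X_def q_def)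
  qed
  from generic_continuous_spectrum[OF comp \<epsilon>c \<epsilon>i injX n(1,2) this]
  show ?thesis by (simp add: verblunsky_def[abs_def] it)
qed

text \<open>Equality of the second coordinates at times \<open>n\<close> and \<open>m\<close> can be
  solved for \<open>x\<close> with \<open>r = n - m\<close>; the hypothesis excludes exactly such
  values and thus makes the orbit injective.\<close>

lemma skew_shift_generic:
  fixes a :: circle
  assumes a: "a = circle_of \<alpha>" and \<omega>: "\<omega> = (circle_of x, circle_of y)"
    and x: "\<And>p q r :: int. r \<noteq> 0 \<Longrightarrow> x \<noteq> (of_int p - of_int q * \<alpha>) / of_int r"
  shows "\<exists>G. gdelta_in (top_of_set disk_functions) G \<and>
    top_of_set disk_functions closure_of G = disk_functions \<and>
    (\<forall>f\<in>G. point_spectrum (cmv (verblunsky (skew_shift a) f \<omega>)) = {})"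
proof -
  define \<epsilon> :: "circle \<times> circle \<Rightarrow> complex \<times> complex"
    where "\<epsilon> c = (circle_embedding (fst c), circle_embedding (snd c))" for c
  have \<epsilon>c: "continuous_on UNIV \<epsilon>"
    unfolding \<epsilon>_def by (rule continuous_on_pair_map[OF continuous_on_circle_embedding])
  have \<epsilon>i: "inj \<epsilon>"
    by (rule injI) (auto simp: \<epsilon>_def inj_eq[OF inj_circle_embedding] prod_eq_iff)
  define q :: "real \<times> real \<Rightarrow> circle \<times> circle" where "q y = (circle_of (fst y), circle_of (snd y))" for y
  have qc: "continuous_on UNIV q"
    unfolding q_def by (rule continuous_on_pair_map[OF continuous_on_circle_of])
  have comp: "compact (UNIV :: (circle \<times> circle) set)"
  proof -
    have "compact (q ` ({0..1} \<times> {0..1}))"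
      by (rule compact_continuous_image[OF continuous_on_subset[OF qc]]) (auto intro: compact_Times)
    moreover have "c \<in> q ` ({0..1} \<times> {0..1})" for c
    proof -
      obtain s t where "s \<in> {0..<1}" "fst c = circle_of s" "t \<in> {0..<1}" "snd c = circle_of t"
        using circle_of_unit_interval by metis
      then show ?thesis by (intro image_eqI[of _ _ "(s, t)"]) (auto simp: q_def prod_eq_iff)
    qed
    then have "q ` ({0..1} \<times> {0..1}) = UNIV" by blast
    ultimately show ?thesis by simp
  qed
  define X where "X n = q (x + 2 * of_int n * \<alpha>, y + of_int n * x + of_int (n * (n - 1)) * \<alpha>)" for n
  have X0: "X 0 = \<omega>" by (simp add: X_def q_def \<omega>)
  have XS: "skew_shift a (X n) = X (n + 1)" for n
    by (simp add: skew_shift_def X_def a q_def circle_of_add algebra_simps)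
  have injT: "inj (skew_shift a)" by (auto simp: inj_def skew_shift_def)
  have it: "iterate (skew_shift a) n \<omega> = X n" for n by (rule iterate_orbit[OF injT X0 XS])
  have injX: "inj X"
  proof (rule ccontr)
    assume "\<not> inj X"
    then obtain n m where nm: "X n = X m" "n \<noteq> m" unfolding inj_def by blast
    then have "(y + of_int n * x + of_int (n * (n - 1)) * \<alpha>) - (y + of_int m * x + of_int (m * (m - 1)) * \<alpha>) \<in> \<int>"
      by (simp add: X_def q_def circle_of_eq_iff)
    then obtain p :: int where "(y + of_int n * x + of_int (n * (n - 1)) * \<alpha>) - (y + of_int m * x + of_int (m * (m - 1)) * \<alpha>) = of_int p"
      by (auto elim: Ints_cases)
    then have "of_int (n - m) * x = of_int p - of_int (n * (n - 1) - m * (m - 1)) * \<alpha>"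
      by (simp add: algebra_simps)
    then have "x = (of_int p - of_int (n * (n - 1) - m * (m - 1)) * \<alpha>) / of_int (n - m)"
      using nm(2) by (simp add: eq_divide_eq mult.commute)
    moreover have "n - m \<noteq> 0" using nm(2) by simp
    ultimately show False using x by blast
  qed
  define h where "h b n = (if b then 2 * of_int n * \<alpha> else of_int n * x + of_int (n * (n - 1)) * \<alpha>)" for b and n :: int
  have rec1: "\<exists>n. even n \<and> n \<ge> (K::int) \<and> (\<forall>b. near_int (h b n) \<delta>)" if "\<delta> > 0" for K \<delta>
    using quadratic_recurrence[OF that, of K \<alpha> x] by (auto simp: h_def)
  obtain n m where n: "\<And>k::nat. even (n k)" "filterlim n at_top sequentially"
    "\<And>b. (\<lambda>k. h b (n k) - of_int (m b k)) \<longlonglongrightarrow> 0"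
    by (rule near_int_sequence[where h=h, OF rec1]) (assumption, rule that)
  have "(\<lambda>k. X (j + n k)) \<longlonglongrightarrow> X j" for j
  proof -
    let ?u = "x + 2 * of_int j * \<alpha>" and ?v = "y + of_int j * x + of_int (j * (j - 1)) * \<alpha>"
    define A where "A b k = h b (n k) - of_int (m b k)" for b k
    \<comment> \<open>The cross term \<open>2 j n \<alpha>\<close> is \<open>j\<close> times the
      displacement of the first coordinate, so its error is \<open>j\<close> times that of the first
      coordinate.\<close>
    have "X (j + n k) = (circle_of (?u + A True k), circle_of (?v + A False k + of_int j * A True k))" for k
    proof -
      have e1: "x + 2 * of_int (j + n k) * \<alpha> = (?u + A True k) + of_int (m True k)"
        by (simp add: A_def h_def algebra_simps)
      have e2: "y + of_int (j + n k) * x + of_int ((j + n k) * (j + n k - 1)) * \<alpha>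
          = (?v + A False k + of_int j * A True k) + of_int (m False k + j * m True k)"
        by (simp add: A_def h_def algebra_simps)
      show ?thesis unfolding X_def q_def fst_conv snd_conv e1 e2 circle_of_add_int ..
    qed
    moreover have "(\<lambda>k. (circle_of (?u + A True k), circle_of (?v + A False k + of_int j * A True k)))
        \<longlonglongrightarrow> (circle_of (?u + 0), circle_of (?v + 0 + of_int j * 0))"
      unfolding A_def by (intro tendsto_Pair tendsto_circle_of tendsto_add tendsto_mult tendsto_const n)
    ultimately show ?thesis by (simp add: X_def q_def)
  qed
  from generic_continuous_spectrum[OF comp \<epsilon>c \<epsilon>i injX n(1,2) this]
  show ?thesis by (simp add: verblunsky_def[abs_def] it)
qed

text \<open>In the unit square the exceptional set lies on countably many vertical lines, a Lebesgue
  null set.\<close>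

lemma AE_haar_torus2_fst_notin:
  assumes "countable C"
  shows "AE \<omega> in haar_torus2. fst \<omega> \<notin> circle_of ` C"
proof -
  let ?F = "\<lambda>(x, y). (circle_of x, circle_of y)"
  let ?S = "cbox (0, 0) (1, 1) :: (real \<times> real) set"
  have "continuous_on UNIV ?F"
    unfolding case_prod_beta
    by (rule continuous_on_pair_map[OF continuous_on_circle_of])
  then have F: "?F \<in> borel_measurable borel"
    by (rule borel_measurable_continuous_onI)
  have meas: "?F \<in> measurable (restrict_space lborel ?S) borel"
    by (rule measurable_restrict_space1) (unfold measurable_cong_sets[OF sets_lborel refl], rule F)
  \<comment> \<open>Measurability is settled in the plane, where a countable set is visibly
    Borel.\<close>
  define E where "E \<omega> = circle_embedding (fst \<omega>)" for \<omega> :: "circle \<times> circle"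
  define D where "D = circle_embedding ` circle_of ` C"
  have "continuous_on UNIV E"
    unfolding E_def by (rule continuous_on_compose2[OF continuous_on_circle_embedding continuous_on_fst[OF continuous_on_id]]) simp
  then have Em: "E \<in> borel_measurable borel"
    by (rule borel_measurable_continuous_onI)
  have "countable D" unfolding D_def by (intro countable_image assms)
  then have "D \<in> sets borel"
    by (rule sets.countable[rotated]) (rule borel_closed[OF closed_singleton])
  then have "- D \<in> sets borel" by (rule borel_comp)
  with Em have "E -` (- D) \<inter> space borel \<in> sets borel" by (rule measurable_sets)
  moreover have "E \<omega> \<in> D \<longleftrightarrow> fst \<omega> \<in> circle_of ` C" for \<omega>
    unfolding E_def D_def by (rule inj_image_mem_iff[OF inj_circle_embedding])
  then have "E -` (- D) \<inter> space borel = {\<omega> \<in> space borel. fst \<omega> \<notin> circle_of ` C}"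
    by blast
  ultimately have set: "{\<omega> \<in> space (borel :: (circle \<times> circle) measure). fst \<omega> \<notin> circle_of ` C} \<in> sets borel"
    by simp
  \<comment> \<open>All integer translates are included because a point of the circle fixes its
    representative only modulo integers.\<close>
  define C' where "C' = (\<lambda>(c, m::int). c + of_int m) ` (C \<times> UNIV)"
  have C': "countable C'" unfolding C'_def using assms by auto
  have sub: "s \<in> C'" if st: "circle_of s \<in> circle_of ` C" for s
  proof -
    obtain c where "c \<in> C" "s - c \<in> \<int>" using st by (auto simp: circle_of_eq_iff)
    then obtain m :: int where "s = c + of_int m" by (auto elim!: Ints_cases simp: algebra_simps)
    then show ?thesis using \<open>c \<in> C\<close> by (auto simp: C'_def)
  qed
  have "emeasure (lborel :: (real \<times> real) measure) (C' \<times> UNIV) = 0"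
  proof -
    have "C' \<in> sets lborel" using C' by (simp add: sets.countable)
    then have "emeasure (lborel \<Otimes>\<^sub>M lborel) (C' \<times> (UNIV :: real set)) = emeasure lborel C' * emeasure lborel (UNIV :: real set)"
      by (intro lborel.emeasure_pair_measure_Times) auto
    then show ?thesis using emeasure_lborel_countable[OF C'] by (simp add: lborel_prod)
  qed
  moreover have "C' \<times> UNIV \<in> sets (lborel :: (real \<times> real) measure)"
  proof -
    have "C' \<times> (UNIV :: real set) \<in> sets (lborel \<Otimes>\<^sub>M lborel)"
      using C' by (intro pair_measureI) (auto simp: sets.countable)
    then show ?thesis unfolding lborel_prod .
  qed
  ultimately have "C' \<times> UNIV \<in> null_sets (lborel :: (real \<times> real) measure)" by auto
  then have "AE p in (lborel :: (real \<times> real) measure). p \<notin> C' \<times> UNIV" by (rule AE_not_in)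
  then have "AE p in (lborel :: (real \<times> real) measure). p \<in> ?S \<longrightarrow> fst (?F p) \<notin> circle_of ` C"
    by eventually_elim (use sub in auto)
  then have "AE p in restrict_space lborel ?S. fst (?F p) \<notin> circle_of ` C"
    by (subst AE_restrict_space_iff) auto
  then show ?thesis unfolding haar_torus2_def by (subst AE_distr_iff[OF meas set])
qed

theorem theorem1:
  shows "(\<forall>a :: circle ^ 'd. minimal (shift a) \<longrightarrow>
           (AE \<omega> in haar_torus.
             \<exists>G. gdelta_in (top_of_set disk_functions) G \<and>
                 top_of_set disk_functions closure_of G = disk_functions \<and>
                 (\<forall>f\<in>G. point_spectrum (cmv (verblunsky (shift a) f \<omega>)) = {}))) \<and>
         (\<forall>a :: circle.
           (AE \<omega> in haar_torus2.
             \<exists>G. gdelta_in (top_of_set disk_functions) G \<and>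
                 top_of_set disk_functions closure_of G = disk_functions \<and>
                 (\<forall>f\<in>G. point_spectrum (cmv (verblunsky (skew_shift a) f \<omega>)) = {})))"
proof (intro conjI allI impI)
  fix a :: "circle ^ 'd"
  assume "minimal (shift a)"
  then show "AE \<omega> in haar_torus.
             \<exists>G. gdelta_in (top_of_set disk_functions) G \<and>
                 top_of_set disk_functions closure_of G = disk_functions \<and>
                 (\<forall>f\<in>G. point_spectrum (cmv (verblunsky (shift a) f \<omega>)) = {})"
    by (intro AE_I2 shift_generic)
next
  fix a :: circle
  obtain \<alpha> where a: "a = circle_of \<alpha>" using circle_of_surj by blast
  \<comment> \<open>All first coordinates that could allow a repetition in the orbit; triples with
    \<open>r = 0\<close> merely contribute the value 0, so \<open>C\<close> stays countable.\<close>
  define C where "C = (\<lambda>(p, q, r). (of_int p - of_int q * \<alpha>) / of_int r) ` (UNIV :: (int \<times> int \<times> int) set)"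
  have "countable C" unfolding C_def by simp
  from AE_haar_torus2_fst_notin[OF this]
  show "AE \<omega> in haar_torus2.
             \<exists>G. gdelta_in (top_of_set disk_functions) G \<and>
                 top_of_set disk_functions closure_of G = disk_functions \<and>
                 (\<forall>f\<in>G. point_spectrum (cmv (verblunsky (skew_shift a) f \<omega>)) = {})"
  proof eventually_elim
    case (elim \<omega>)
    obtain x y where \<omega>: "\<omega> = (circle_of x, circle_of y)" using circle_of_surj by (metis prod.collapse)
    have "x \<notin> C" using elim by (auto simp: \<omega>)
    moreover have "(of_int p - of_int q * \<alpha>) / of_int r \<in> C" for p q r :: int
      unfolding C_def by (rule image_eqI[of _ _ "(p, q, r)"]) auto
    ultimately have "x \<noteq> (of_int p - of_int q * \<alpha>) / of_int r" for p q r :: int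
      by blast
    then show ?case by (intro skew_shift_generic[OF a \<omega>])
  qed
qed

end
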